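(* Let $\mathbb{X}$ be an exact Mal'tsev category, $X$ an object of $\mathbb{X}$ and $(R_i)_{i\in n}$ an $n$-tuple of equivalence relations on $X$, where $n\geq3$. Write $F=\mathrm{Coeq}_{i\in n}(R_i)$ for the induced $n$-fold regular epimorphism. Then the following conditions are equivalent: (i) $F$ is an $n$-cubic extension; (ii) the collection of equivalence relations $(R_i)_{i\in n}$ on $X$ is distributive; (iii) the parallelistic $n$-fold equivalence relation $\square_{i\in n}R_i$ is distributive.
   Context: An exact Mal'tsev category is a Barr exact category in which every (internal) reflexive relation is an equivalence relation; equivalence relations on an object form a lattice with $R\vee S=RS=SR$. We write $n=\{0,\dots,n-1\}$. $\mathsf{Arr}^n(\mathbb{X})=\mathsf{Arr}(\mathsf{Arr}^{n-1}(\mathbb{X}))$ is the category of $n$-fold arrows (commutative $n$-cubes). A $1$-cubic extension is a regular epimorphism in $\mathbb{X}$. For $n\geq 2$, an $n$-fold arrow, viewed as a commutative square in $\mathsf{Arr}^{n-2}(\mathbb{X})$, is an $n$-cubic extension when its four sides and the induced comparison from its initial corner to the pullback are all $(n-1)$-cubic extensions. $\square_{i\in n}R_i$ is the largest $n$-fold equivalence relation on $R_0,\dots,R_{n-1}$; its top object is the subobject of $X^{2^n}$ of families $(x_a)_{a\in\{0,1\}^n}$ with $x_aR_ix_b$ whenever $a$ and $b$ differ only in coordinate $i$. Parallelistic $n$-fold equivalence relations are those isomorphic to one of this form. $\mathrm{Coeq}_{i\in n}(R_i)$ is the $n$-cube obtained from $\square_{i\in n}R_i$ by taking coequalisers successively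 in all directions; equivalently, it is obtained by taking successive pushouts of the coequalisers $X\to X/R_i$, so that its vertices are the quotients $X/\bigvee_{i\in I}R_i$ for $I\subseteq n$, with the canonical quotient maps between them. The collection $(R_i)_{i\in n}$ is distributive when, for all $k\geq 1$ and all $J_0,J_1,\dots,J_k\subseteq n$ with $J_i\cap J_j=\emptyset$ for $i\neq j$, $$\Big(\bigwedge_{j\in J_0}R_j\Big)\wedge\bigvee_{i=1}^k\Big(\bigwedge_{j\in J_i}R_j\Big)=\bigvee_{i=1}^k\Big(\bigwedge_{j\in J_0\cup J_i}R_j\Big)$$ (an empty meet being the largest relation). $\square_{i\in n}R_i$ is called distributive when $(R_i)_{i\in n}$ is. *)

theory Defs
  imports "HOL-Algebra.Lattice" "HOL-Library.Disjoint_Sets"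
begin

section \<open>Categories\<close>

record ('o, 'm) cat =
  Obj :: "'o set"
  Arr :: "'m set"
  Dom :: "'m \<Rightarrow> 'o"
  Cod :: "'m \<Rightarrow> 'o"
  Ident :: "'o \<Rightarrow> 'm"
  Comp :: "'m \<Rightarrow> 'm \<Rightarrow> 'm" (infixr "\<odot>\<index>" 75)

text \<open>Composition is in applicative order, and unconstrained on non-composable pairs.\<close>

definition homset :: "('o, 'm) cat \<Rightarrow> 'o \<Rightarrow> 'o \<Rightarrow> 'm set" where
  "homset C A B = {f \<in> Arr C. Dom C f = A \<and> Cod C f = B}"

locale category =
  fixes C :: "('o, 'm) cat" (structure)
  assumes Dom_Obj: "f \<in> Arr C \<Longrightarrow> Dom C f \<in> Obj C"
    and Cod_Obj: "f \<in> Arr C \<Longrightarrow> Cod C f \<in> Obj C"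
    and Ident_hom: "A \<in> Obj C \<Longrightarrow> Ident C A \<in> homset C A A"
    and Comp_hom: "f \<in> homset C A B \<Longrightarrow> g \<in> homset C B D \<Longrightarrow> g \<odot> f \<in> homset C A D"
    and Comp_Ident: "f \<in> Arr C \<Longrightarrow> f \<odot> Ident C (Dom C f) = f"
    and Ident_Comp: "f \<in> Arr C \<Longrightarrow> Ident C (Cod C f) \<odot> f = f"
    and Comp_assoc: "f \<in> homset C A B \<Longrightarrow> g \<in> homset C B D \<Longrightarrow> h \<in> homset C D E \<Longrightarrow>
      (h \<odot> g) \<odot> f = h \<odot> (g \<odot> f)"

definition terminal :: "('o, 'm) cat \<Rightarrow> 'o \<Rightarrow> bool" where
  "terminal C T \<longleftrightarrow> T \<in> Obj C \<and> (\<forall>A\<in>Obj C. \<exists>!f. f \<in> homset C A T)"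

text \<open>\<open>pullback C f g p q\<close>: the legs \<open>p\<close> (into the domain of \<open>f\<close>) and \<open>q\<close> (into the
  domain of \<open>g\<close>) exhibit their common domain as a pullback of \<open>f\<close> and \<open>g\<close>.\<close>

definition pullback :: "('o, 'm) cat \<Rightarrow> 'm \<Rightarrow> 'm \<Rightarrow> 'm \<Rightarrow> 'm \<Rightarrow> bool" where
  "pullback C f g p q \<longleftrightarrow>
     f \<in> Arr C \<and> g \<in> Arr C \<and> Cod C f = Cod C g \<and>
     p \<in> homset C (Dom C p) (Dom C f) \<and> q \<in> homset C (Dom C p) (Dom C g) \<and>
     f \<odot>\<^bsub>C\<^esub> p = g \<odot>\<^bsub>C\<^esub> q \<and>
     (\<forall>T\<in>Obj C. \<forall>x\<in>homset C T (Dom C f). \<forall>y\<in>homset C T (Dom C g).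
        f \<odot>\<^bsub>C\<^esub> x = g \<odot>\<^bsub>C\<^esub> y \<longrightarrow>
        (\<exists>!h. h \<in> homset C T (Dom C p) \<and> p \<odot>\<^bsub>C\<^esub> h = x \<and> q \<odot>\<^bsub>C\<^esub> h = y))"

definition coequaliser :: "('o, 'm) cat \<Rightarrow> 'm \<Rightarrow> 'm \<Rightarrow> 'm \<Rightarrow> bool" where
  "coequaliser C u v q \<longleftrightarrow>
     u \<in> Arr C \<and> v \<in> homset C (Dom C u) (Cod C u) \<and>
     q \<in> homset C (Cod C u) (Cod C q) \<and> q \<odot>\<^bsub>C\<^esub> u = q \<odot>\<^bsub>C\<^esub> v \<and>
     (\<forall>Z\<in>Obj C. \<forall>h\<in>homset C (Cod C u) Z. h \<odot>\<^bsub>C\<^esub> u = h \<odot>\<^bsub>C\<^esub> v \<longrightarrow>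
        (\<exists>!k. k \<in> homset C (Cod C q) Z \<and> k \<odot>\<^bsub>C\<^esub> q = h))"

definition regular_epi :: "('o, 'm) cat \<Rightarrow> 'm \<Rightarrow> bool" where
  "regular_epi C q \<longleftrightarrow> (\<exists>u v. coequaliser C u v q)"


section \<open>Internal relations\<close>

text \<open>A relation on \<open>X\<close> is given by its pair of jointly monic projections.  Reflexivity,
  symmetry and transitivity are required of the relation induced on the
  generalised elements \<open>T \<rightarrow> X\<close>, for every \<open>T\<close>.\<close>

definition int_rel :: "('o, 'm) cat \<Rightarrow> 'o \<Rightarrow> 'm \<times> 'm \<Rightarrow> bool" where
  "int_rel C X R \<longleftrightarrow>
     fst R \<in> homset C (Dom C (fst R)) X \<and> snd R \<in> homset C (Dom C (fst R)) X \<and>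
     (\<forall>T\<in>Obj C. \<forall>h\<in>homset C T (Dom C (fst R)). \<forall>k\<in>homset C T (Dom C (fst R)).
        fst R \<odot>\<^bsub>C\<^esub> h = fst R \<odot>\<^bsub>C\<^esub> k \<and> snd R \<odot>\<^bsub>C\<^esub> h = snd R \<odot>\<^bsub>C\<^esub> k \<longrightarrow> h = k)"

definition related :: "('o, 'm) cat \<Rightarrow> 'm \<times> 'm \<Rightarrow> 'm \<Rightarrow> 'm \<Rightarrow> bool" where
  "related C R x y \<longleftrightarrow>
     (\<exists>h\<in>homset C (Dom C x) (Dom C (fst R)). fst R \<odot>\<^bsub>C\<^esub> h = x \<and> snd R \<odot>\<^bsub>C\<^esub> h = y)"

definition reflexive_rel :: "('o, 'm) cat \<Rightarrow> 'o \<Rightarrow> 'm \<times> 'm \<Rightarrow> bool" where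
  "reflexive_rel C X R \<longleftrightarrow> int_rel C X R \<and>
     (\<forall>T\<in>Obj C. \<forall>x\<in>homset C T X. related C R x x)"

definition equivalence_rel :: "('o, 'm) cat \<Rightarrow> 'o \<Rightarrow> 'm \<times> 'm \<Rightarrow> bool" where
  "equivalence_rel C X R \<longleftrightarrow> reflexive_rel C X R \<and>
     (\<forall>T\<in>Obj C. \<forall>x\<in>homset C T X. \<forall>y\<in>homset C T X.
        related C R x y \<longrightarrow> related C R y x) \<and>
     (\<forall>T\<in>Obj C. \<forall>x\<in>homset C T X. \<forall>y\<in>homset C T X. \<forall>z\<in>homset C T X.
        related C R x y \<and> related C R y z \<longrightarrow> related C R x z)"

text \<open>The order on relations on \<open>X\<close> is that of subobjects of \<open>X \<times> X\<close>; since relations are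
  represented by spans, equality is equivalence for this preorder.\<close>

definition rel_le :: "('o, 'm) cat \<Rightarrow> 'm \<times> 'm \<Rightarrow> 'm \<times> 'm \<Rightarrow> bool" where
  "rel_le C R S \<longleftrightarrow>
     (\<exists>h\<in>homset C (Dom C (fst R)) (Dom C (fst S)).
        fst S \<odot>\<^bsub>C\<^esub> h = fst R \<and> snd S \<odot>\<^bsub>C\<^esub> h = snd R)"

definition eq_lattice :: "('o, 'm) cat \<Rightarrow> 'o \<Rightarrow> ('m \<times> 'm) gorder" where
  "eq_lattice C X =
     \<lparr>carrier = {R. equivalence_rel C X R},
      eq = (\<lambda>R S. rel_le C R S \<and> rel_le C S R),
      le = rel_le C\<rparr>"


section \<open>Exact Mal'tsev categories\<close>

text \<open>Finite completeness is expressed by the existence of a terminal object and of pullbacks.\<close>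

locale regular_category = category C for C :: "('o, 'm) cat" (structure) +
  assumes has_terminal: "\<exists>T. terminal C T"
    and has_pullbacks: "f \<in> Arr C \<Longrightarrow> g \<in> Arr C \<Longrightarrow> Cod C f = Cod C g \<Longrightarrow>
      \<exists>p q. pullback C f g p q"
    and kernel_pair_coequaliser: "pullback C f f p q \<Longrightarrow> \<exists>c. coequaliser C p q c"
    and regular_epi_stable: "pullback C f g p q \<Longrightarrow> regular_epi C f \<Longrightarrow> regular_epi C q"

locale exact_category = regular_category C for C :: "('o, 'm) cat" (structure) +
  assumes effective: "equivalence_rel C X R \<Longrightarrow> \<exists>f. pullback C f f (fst R) (snd R)"

locale exact_maltsev_category = exact_category C for C :: "('o, 'm) cat" (structure) +
  assumes maltsev: "reflexive_rel C X R \<Longrightarrow> equivalence_rel C X R"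


section \<open>Higher arrows and cubic extensions\<close>

text \<open>All the categories \<open>Arr\<^sup>n(C)\<close> are carved out of one type.  \<open>Square f g a b\<close> is the
  morphism from the object \<open>f\<close> to the object \<open>g\<close> of an arrow category which has the
  components \<open>a\<close> on domains and \<open>b\<close> on codomains.\<close>

datatype ('o, 'm) narr =
    Vertex 'o
  | Edge 'm
  | Square (sq_source: "('o, 'm) narr") (sq_target: "('o, 'm) narr")
      (sq_dom: "('o, 'm) narr") (sq_cod: "('o, 'm) narr")

primrec the_Vertex :: "('o, 'm) narr \<Rightarrow> 'o" where
  "the_Vertex (Vertex A) = A"

primrec the_Edge :: "('o, 'm) narr \<Rightarrow> 'm" where
  "the_Edge (Edge f) = f"

type_synonym ('o, 'm) ncat = "(('o, 'm) narr, ('o, 'm) narr) cat"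

definition base_cat :: "('o, 'm) cat \<Rightarrow> ('o, 'm) ncat" where
  "base_cat C =
     \<lparr>Obj = Vertex ` Obj C,
      Arr = Edge ` Arr C,
      Dom = (\<lambda>f. Vertex (Dom C (the_Edge f))),
      Cod = (\<lambda>f. Vertex (Cod C (the_Edge f))),
      Ident = (\<lambda>A. Edge (Ident C (the_Vertex A))),
      Comp = (\<lambda>g f. Edge (the_Edge g \<odot>\<^bsub>C\<^esub> the_Edge f))\<rparr>"

definition Arr_cat :: "('o, 'm) ncat \<Rightarrow> ('o, 'm) ncat" where
  "Arr_cat K =
     \<lparr>Obj = Arr K,
      Arr = {Square f g a b | f g a b.
               f \<in> Arr K \<and> g \<in> Arr K \<and>
               a \<in> homset K (Dom K f) (Dom K g) \<and> b \<in> homset K (Cod K f) (Cod K g) \<and>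
               g \<odot>\<^bsub>K\<^esub> a = b \<odot>\<^bsub>K\<^esub> f},
      Dom = sq_source,
      Cod = sq_target,
      Ident = (\<lambda>f. Square f f (Ident K (Dom K f)) (Ident K (Cod K f))),
      Comp = (\<lambda>G F. Square (sq_source F) (sq_target G)
                (sq_dom G \<odot>\<^bsub>K\<^esub> sq_dom F) (sq_cod G \<odot>\<^bsub>K\<^esub> sq_cod F))\<rparr>"

primrec Arr_pow :: "nat \<Rightarrow> ('o, 'm) cat \<Rightarrow> ('o, 'm) ncat" where
  "Arr_pow 0 C = base_cat C"
| "Arr_pow (Suc n) C = Arr_cat (Arr_pow n C)"

text \<open>An \<open>n\<close>-fold arrow is an object of \<open>Arr_pow n C\<close>; for positive \<open>n\<close>, this is an arrow of
  \<open>Arr_pow (n - 1) C\<close>, and for \<open>n \<ge> 2\<close> a commutative square in \<open>Arr_pow (n - 2) C\<close>.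
  The notion of cubic extension starts at \<open>n = 1\<close>; the value at \<open>0\<close> is junk.\<close>

fun cubic_extension :: "('o, 'm) cat \<Rightarrow> nat \<Rightarrow> ('o, 'm) narr \<Rightarrow> bool" where
  "cubic_extension C 0 F = False"
| "cubic_extension C (Suc 0) F = (\<exists>f. F = Edge f \<and> regular_epi C f)"
| "cubic_extension C (Suc (Suc n)) F =
     (F \<in> Obj (Arr_pow (Suc (Suc n)) C) \<and>
      (\<exists>f g a b. F = Square f g a b \<and>
         cubic_extension C (Suc n) f \<and> cubic_extension C (Suc n) g \<and>
         cubic_extension C (Suc n) a \<and> cubic_extension C (Suc n) b \<and>
         (\<exists>p q c. pullback (Arr_pow n C) g b p q \<and>
            c \<in> homset (Arr_pow n C) (Dom (Arr_pow n C) f) (Dom (Arr_pow n C) p) \<and>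
            p \<odot>\<^bsub>Arr_pow n C\<^esub> c = a \<and> q \<odot>\<^bsub>Arr_pow n C\<^esub> c = f \<and>
            cubic_extension C (Suc n) c)))"

text \<open>A cube in functorial form: a vertex for each set \<open>I\<close> of directions, and for
  \<open>i \<notin> I\<close> an edge \<open>cedge i I\<close> from the vertex at \<open>I\<close> to the one at \<open>insert i I\<close>.\<close>

record ('o, 'm) cube =
  cvert :: "nat set \<Rightarrow> 'o"
  cedge :: "nat \<Rightarrow> nat set \<Rightarrow> 'm"

text \<open>\<open>face_arrow F k j I\<close>, for \<open>j \<ge> k\<close> and \<open>I \<subseteq> {k..}\<close> with \<open>j \<notin> I\<close>, is the arrow of
  \<open>Arr_pow k C\<close> given by the \<open>(k + 1)\<close>-dimensional face of \<open>F\<close> with initial vertex \<open>I\<close> and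
  directions \<open>0, \<dots>, k - 1\<close> and \<open>j\<close>, the latter being outermost.\<close>

primrec face_arrow :: "('o, 'm) cube \<Rightarrow> nat \<Rightarrow> nat \<Rightarrow> nat set \<Rightarrow> ('o, 'm) narr" where
  "face_arrow F 0 j I = Edge (cedge F j I)"
| "face_arrow F (Suc k) j I =
     Square (face_arrow F k k I) (face_arrow F k k (insert j I))
       (face_arrow F k j I) (face_arrow F k j (insert k I))"

definition nfold_arrow :: "nat \<Rightarrow> ('o, 'm) cube \<Rightarrow> ('o, 'm) narr" where
  "nfold_arrow n F =
     (case n of 0 \<Rightarrow> Vertex (cvert F {}) | Suc k \<Rightarrow> face_arrow F k k {})"


section \<open>Higher equivalence relations\<close>

text \<open>The vertex \<open>nvert I\<close> of an \<open>n\<close>-fold relation is the object obtained by taking the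
  relations in the directions in \<open>I\<close>, so \<open>nvert {}\<close> is the underlying object and
  \<open>nvert {..<n}\<close> the top object.  For \<open>i \<notin> I\<close>, the two projections
  \<open>nproj b i I\<close> from \<open>nvert (insert i I)\<close> to \<open>nvert I\<close> form a relation on \<open>nvert I\<close>.\<close>

record ('o, 'm) nrel =
  nvert :: "nat set \<Rightarrow> 'o"
  nproj :: "bool \<Rightarrow> nat \<Rightarrow> nat set \<Rightarrow> 'm"

definition nrel_at :: "('o, 'm) nrel \<Rightarrow> nat \<Rightarrow> nat set \<Rightarrow> 'm \<times> 'm" where
  "nrel_at E i I = (nproj E False i I, nproj E True i I)"

text \<open>Compatibility of the projections in different directions is all that is needed for
  each direction to be an equivalence relation in the category of higher equivalence
  relations in the other directions: compatibility with diagonals, symmetries and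
  transitivity follows by joint monicity.\<close>

definition nfold_equivalence :: "('o, 'm) cat \<Rightarrow> nat \<Rightarrow> ('o, 'm) nrel \<Rightarrow> bool" where
  "nfold_equivalence C n E \<longleftrightarrow>
     (\<forall>I\<subseteq>{..<n}. nvert E I \<in> Obj C) \<and>
     (\<forall>I\<subseteq>{..<n}. \<forall>i\<in>{..<n} - I.
        equivalence_rel C (nvert E I) (nrel_at E i I) \<and>
        (\<forall>b. nproj E b i I \<in> homset C (nvert E (insert i I)) (nvert E I))) \<and>
     (\<forall>I\<subseteq>{..<n}. \<forall>i\<in>{..<n} - I. \<forall>j\<in>{..<n} - I. i \<noteq> j \<longrightarrow>
        (\<forall>b c. nproj E b i I \<odot>\<^bsub>C\<^esub> nproj E c j (insert i I) =
               nproj E c j I \<odot>\<^bsub>C\<^esub> nproj E b i (insert j I)))"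

definition nfold_equivalence_on ::
    "('o, 'm) cat \<Rightarrow> nat \<Rightarrow> 'o \<Rightarrow> (nat \<Rightarrow> 'm \<times> 'm) \<Rightarrow> ('o, 'm) nrel \<Rightarrow> bool" where
  "nfold_equivalence_on C n X R E \<longleftrightarrow>
     nfold_equivalence C n E \<and> nvert E {} = X \<and> (\<forall>i<n. nrel_at E i {} = R i)"

definition nrel_morphism ::
    "('o, 'm) cat \<Rightarrow> nat \<Rightarrow> ('o, 'm) nrel \<Rightarrow> ('o, 'm) nrel \<Rightarrow> (nat set \<Rightarrow> 'm) \<Rightarrow> bool" where
  "nrel_morphism C n E E' m \<longleftrightarrow>
     (\<forall>I\<subseteq>{..<n}. m I \<in> homset C (nvert E I) (nvert E' I)) \<and>
     (\<forall>I\<subseteq>{..<n}. \<forall>i\<in>{..<n} - I. \<forall>b.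
        nproj E' b i I \<odot>\<^bsub>C\<^esub> m (insert i I) = m I \<odot>\<^bsub>C\<^esub> nproj E b i I)"

text \<open>\<open>is_box C n X R B\<close>: \<open>B\<close> is the largest \<open>n\<close>-fold equivalence relation on
  \<open>R 0, \<dots>, R (n - 1)\<close>, which determines it up to isomorphism.\<close>

definition is_box ::
    "('o, 'm) cat \<Rightarrow> nat \<Rightarrow> 'o \<Rightarrow> (nat \<Rightarrow> 'm \<times> 'm) \<Rightarrow> ('o, 'm) nrel \<Rightarrow> bool" where
  "is_box C n X R B \<longleftrightarrow>
     nfold_equivalence_on C n X R B \<and>
     (\<forall>E. nfold_equivalence_on C n X R E \<longrightarrow>
        (\<exists>m. nrel_morphism C n E B m \<and> m {} = Ident C X \<and>
             (\<forall>i<n. m {i} = Ident C (Dom C (fst (R i))))))"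

text \<open>The cube \<open>F\<close> is obtained from \<open>B\<close> by taking coequalisers in all directions.  The
  object \<open>V I J\<close>, for disjoint \<open>I\<close> and \<open>J\<close>, is what becomes of the vertex \<open>nvert B I\<close> after
  coequalising in the directions in \<open>J\<close>.  Coequalisers commute with coequalisers, so
  whatever the order in which the directions are treated, the outcome is the diagram \<open>V\<close>
  with a coequaliser fork in each direction at each place.  The cube \<open>F\<close> is its part at
  \<open>I = {}\<close>.\<close>

definition is_Coeq ::
    "('o, 'm) cat \<Rightarrow> nat \<Rightarrow> ('o, 'm) nrel \<Rightarrow> ('o, 'm) cube \<Rightarrow> bool" where
  "is_Coeq C n B F \<longleftrightarrow>
     (\<exists>(V :: nat set \<Rightarrow> nat set \<Rightarrow> 'o)
       (d :: bool \<Rightarrow> nat \<Rightarrow> nat set \<Rightarrow> nat set \<Rightarrow> 'm)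
       (q :: nat \<Rightarrow> nat set \<Rightarrow> nat set \<Rightarrow> 'm).
        (\<forall>I\<subseteq>{..<n}. V I {} = nvert B I \<and>
           (\<forall>i\<in>{..<n} - I. \<forall>b. d b i I {} = nproj B b i I)) \<and>
        (\<forall>J\<subseteq>{..<n}. cvert F J = V {} J \<and> (\<forall>i\<in>{..<n} - J. cedge F i J = q i {} J)) \<and>
        (\<forall>I\<subseteq>{..<n}. \<forall>J\<subseteq>{..<n}. I \<inter> J = {} \<longrightarrow>
           V I J \<in> Obj C \<and>
           (\<forall>i\<in>{..<n} - (I \<union> J).
              (\<forall>b. d b i I J \<in> homset C (V (insert i I) J) (V I J)) \<and>
              q i I J \<in> homset C (V I J) (V I (insert i J)) \<and>
              coequaliser C (d False i I J) (d True i I J) (q i I J)) \<and>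
           (\<forall>i\<in>{..<n} - (I \<union> J). \<forall>j\<in>{..<n} - (I \<union> J). i \<noteq> j \<longrightarrow>
              (\<forall>b c. d b i I J \<odot>\<^bsub>C\<^esub> d c j (insert i I) J =
                     d c j I J \<odot>\<^bsub>C\<^esub> d b i (insert j I) J) \<and>
              (\<forall>b. q j I J \<odot>\<^bsub>C\<^esub> d b i I J =
                   d b i I (insert j J) \<odot>\<^bsub>C\<^esub> q j (insert i I) J) \<and>
              q j I (insert i J) \<odot>\<^bsub>C\<^esub> q i I J = q i I (insert j J) \<odot>\<^bsub>C\<^esub> q j I J)))"


section \<open>Distributivity\<close>

text \<open>The infimum of the empty set is the largest equivalence relation, as required.\<close>

definition distributive ::
    "('o, 'm) cat \<Rightarrow> nat \<Rightarrow> 'o \<Rightarrow> (nat \<Rightarrow> 'm \<times> 'm) \<Rightarrow> bool" where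
  "distributive C n X R \<longleftrightarrow>
     (let L = eq_lattice C X in
      \<forall>k\<ge>1. \<forall>J :: nat \<Rightarrow> nat set.
        (\<forall>i\<le>k. J i \<subseteq> {..<n}) \<and> disjoint_family_on J {..k} \<longrightarrow>
        (\<Sqinter>\<^bsub>L\<^esub>(R ` J 0)) \<sqinter>\<^bsub>L\<^esub> (\<Squnion>\<^bsub>L\<^esub>((\<lambda>i. \<Sqinter>\<^bsub>L\<^esub>(R ` J i)) ` {1..k}))
        .=\<^bsub>L\<^esub> \<Squnion>\<^bsub>L\<^esub>((\<lambda>i. \<Sqinter>\<^bsub>L\<^esub>(R ` (J 0 \<union> J i))) ` {1..k}))"

definition nrel_distributive :: "('o, 'm) cat \<Rightarrow> nat \<Rightarrow> ('o, 'm) nrel \<Rightarrow> bool" where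
  "nrel_distributive C n B \<longleftrightarrow>
     (\<exists>X R. X \<in> Obj C \<and> (\<forall>i<n. equivalence_rel C X (R i)) \<and>
        is_box C n X R B \<and> distributive C n X R)"

end

theory Submission
  imports Defs
begin

text \<open>In a regular category, a cube is a cubic extension iff each of its vertices maps onto the
  limit of every punctured subcube starting there.  In terms of generalised elements, for the cube
  of the quotients \<open>X / R\<^sub>I\<close> (\<open>R\<^sub>I\<close> being the join of the \<open>R\<^sub>i\<close> with \<open>i \<in> I\<close>), this says that the
  Chinese remainder theorem holds for the congruences \<open>R\<^sub>I \<or> R\<^sub>j\<close>, \<open>j \<in> J\<close>, for all disjoint \<open>I\<close>
  and \<open>J\<close>.  As equivalence relations permute, it amounts by induction to the identity
  \<open>R\<^sub>I \<or> (\<Inter>j\<in>J. R\<^sub>j) = (\<Inter>j\<in>J. R\<^sub>I \<or> R\<^sub>j)\<close>, and in a modular lattice this is equivalent to its dual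
  and to the distributivity of the family.\<close>

section \<open>Regular categories\<close>

text \<open>The definition of cubic extensions offers only one pullback at a time, and that in a
  category of higher arrows, so limits of whole punctured cubes are not at hand. Each limit is
  therefore replaced by its generalised elements with a domain \<open>T\<close>, and "there exists"
  means existence after a regular epimorphism onto \<open>T\<close>. Such covers compose and can be
  pulled back, so arguments with elements go through, each existential step costing one cover. The
  delicate point of the induction on dimension is the comparison with the pullback: its target is a
  cube of pullback corners, which is no face of the given square, and the lifting property of that
  cube has to be derived from two sides of the square. The Mal'tsev axiom enters through composites:
  the image of a composite of two equivalence relations is reflexive, hence an equivalence relation,
  hence the join. A pair in a join then has, after a cover, a single middle element. This yields
  modularity as well as the correction step of the Chinese remainder argument.\<close>

lemma homset_iff: "f \<in> homset C A B \<longleftrightarrow> f \<in> Arr C \<and> Dom C f = A \<and> Cod C f = B"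
  by (simp add: homset_def)

context category
begin

lemma Arr_Comp [simp]: "f \<in> Arr C \<Longrightarrow> g \<in> Arr C \<Longrightarrow> Cod C f = Dom C g \<Longrightarrow> g \<odot> f \<in> Arr C"
  and Dom_Comp [simp]: "f \<in> Arr C \<Longrightarrow> g \<in> Arr C \<Longrightarrow> Cod C f = Dom C g \<Longrightarrow> Dom C (g \<odot> f) = Dom C f"
  and Cod_Comp [simp]: "f \<in> Arr C \<Longrightarrow> g \<in> Arr C \<Longrightarrow> Cod C f = Dom C g \<Longrightarrow> Cod C (g \<odot> f) = Cod C g"
  using Comp_hom[of f "Dom C f" "Cod C f" g "Cod C g"] by (auto simp: homset_iff)

lemma Comp_assoc' [simp]:
  "f \<in> Arr C \<Longrightarrow> g \<in> Arr C \<Longrightarrow> h \<in> Arr C \<Longrightarrow> Cod C f = Dom C g \<Longrightarrow> Cod C g = Dom C h \<Longrightarrow>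
    (h \<odot> g) \<odot> f = h \<odot> (g \<odot> f)"
  by (rule Comp_assoc) (auto simp: homset_iff)

lemma Arr_Ident [simp]: "A \<in> Obj C \<Longrightarrow> Ident C A \<in> Arr C"
  and Dom_Ident [simp]: "A \<in> Obj C \<Longrightarrow> Dom C (Ident C A) = A"
  and Cod_Ident [simp]: "A \<in> Obj C \<Longrightarrow> Cod C (Ident C A) = A"
  using Ident_hom by (auto simp: homset_iff)

lemma Comp_Ident' [simp]: "f \<in> Arr C \<Longrightarrow> Dom C f = A \<Longrightarrow> f \<odot> Ident C A = f"
  and Ident_Comp' [simp]: "f \<in> Arr C \<Longrightarrow> Cod C f = A \<Longrightarrow> Ident C A \<odot> f = f"
  using Comp_Ident Ident_Comp by auto

lemma homset_Obj: "f \<in> homset C A B \<Longrightarrow> A \<in> Obj C \<and> B \<in> Obj C"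
  using Dom_Obj Cod_Obj by (auto simp: homset_iff)

lemmas [simp] = Dom_Obj Cod_Obj

text \<open>\<open>Comp_assoc'\<close> normalises composites to the right, which buries the two
  sides of a commutative square as soon as something is composed on the right. This rule and
  \<open>Comp_extend1\<close> recover the square in that normal form.\<close>

lemma Comp_extend:
  assumes "g \<odot> f = g' \<odot> f'"
    and "f \<in> Arr C" "g \<in> Arr C" "f' \<in> Arr C" "g' \<in> Arr C" "x \<in> Arr C"
    and "Cod C f = Dom C g" "Cod C f' = Dom C g'" "Cod C x = Dom C f" "Cod C x = Dom C f'"
  shows "g \<odot> (f \<odot> x) = g' \<odot> (f' \<odot> x)"
proof -
  have "(g \<odot> f) \<odot> x = (g' \<odot> f') \<odot> x" using assms by simp
  thus ?thesis using assms(2-) by simp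
qed

lemma Comp_extend1:
  assumes "g \<odot> f = h"
    and "f \<in> Arr C" "g \<in> Arr C" "x \<in> Arr C" "Cod C f = Dom C g" "Cod C x = Dom C f"
  shows "g \<odot> (f \<odot> x) = h \<odot> x"
  using assms by auto

lemma pullbackD:
  assumes "pullback C f g p q"
  shows "f \<in> Arr C" "g \<in> Arr C" "p \<in> Arr C" "q \<in> Arr C" "Cod C f = Cod C g"
    "Dom C q = Dom C p" "Cod C p = Dom C f" "Cod C q = Dom C g" "f \<odot> p = g \<odot> q"
  using assms by (auto simp: pullback_def homset_iff)

lemma pullback_fill:
  assumes "pullback C f g p q" "x \<in> Arr C" "y \<in> Arr C" "Dom C x = Dom C y"
    "Cod C x = Dom C f" "Cod C y = Dom C g" "f \<odot> x = g \<odot> y"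
  obtains h where "h \<in> Arr C" "Dom C h = Dom C x" "Cod C h = Dom C p" "p \<odot> h = x" "q \<odot> h = y"
proof -
  have "Dom C x \<in> Obj C" "x \<in> homset C (Dom C x) (Dom C f)" "y \<in> homset C (Dom C x) (Dom C g)"
    using assms Dom_Obj by (auto simp: homset_iff)
  then have "\<exists>!h. h \<in> homset C (Dom C x) (Dom C p) \<and> p \<odot> h = x \<and> q \<odot> h = y"
    using assms(1,7) unfolding pullback_def by simp
  then show ?thesis using that by (auto simp: homset_iff)
qed

lemma pullback_cancel:
  assumes "pullback C f g p q" "h \<in> Arr C" "k \<in> Arr C" "Dom C h = Dom C k"
    "Cod C h = Dom C p" "Cod C k = Dom C p" "p \<odot> h = p \<odot> k" "q \<odot> h = q \<odot> k"
  shows "h = k"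
proof -
  note pb = pullbackD[OF assms(1)]
  have "Dom C h \<in> Obj C" "p \<odot> h \<in> homset C (Dom C h) (Dom C f)"
    "q \<odot> h \<in> homset C (Dom C h) (Dom C g)" "f \<odot> (p \<odot> h) = g \<odot> (q \<odot> h)"
    using assms(2-) pb Comp_extend[OF pb(9)] by (auto simp: homset_iff)
  then have "\<exists>!k. k \<in> homset C (Dom C h) (Dom C p) \<and> p \<odot> k = p \<odot> h \<and> q \<odot> k = q \<odot> h"
    using assms(1) unfolding pullback_def by simp
  then show ?thesis using assms(2-) unfolding homset_iff by metis
qed

lemma pullbackI:
  assumes "f \<in> Arr C" "g \<in> Arr C" "p \<in> Arr C" "q \<in> Arr C" "Cod C f = Cod C g"
    "Dom C q = Dom C p" "Cod C p = Dom C f" "Cod C q = Dom C g" "f \<odot> p = g \<odot> q"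
    and fill: "\<And>x y. x \<in> Arr C \<Longrightarrow> y \<in> Arr C \<Longrightarrow> Dom C x = Dom C y \<Longrightarrow> Cod C x = Dom C f \<Longrightarrow>
      Cod C y = Dom C g \<Longrightarrow> f \<odot> x = g \<odot> y \<Longrightarrow>
      \<exists>h\<in>Arr C. Dom C h = Dom C x \<and> Cod C h = Dom C p \<and> p \<odot> h = x \<and> q \<odot> h = y"
    and cancel: "\<And>h k. h \<in> Arr C \<Longrightarrow> k \<in> Arr C \<Longrightarrow> Dom C h = Dom C k \<Longrightarrow> Cod C h = Dom C p \<Longrightarrow>
      Cod C k = Dom C p \<Longrightarrow> p \<odot> h = p \<odot> k \<Longrightarrow> q \<odot> h = q \<odot> k \<Longrightarrow> h = k"
  shows "pullback C f g p q"
proof -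
  have "\<exists>!h. h \<in> homset C T (Dom C p) \<and> p \<odot> h = x \<and> q \<odot> h = y"
    if "x \<in> homset C T (Dom C f)" "y \<in> homset C T (Dom C g)" "f \<odot> x = g \<odot> y" for T x y
    using fill[of x y] that cancel unfolding homset_iff by metis
  then show ?thesis
    unfolding pullback_def by (intro conjI ballI impI) (use assms(1-9) in \<open>auto simp: homset_iff\<close>)
qed

text \<open>Together with \<open>pullback_iso_unique\<close>, this transfers facts about one
  constructed pullback to an arbitrary pullback of the same arrows.\<close>

lemma pullback_Comp_iso:
  assumes "pullback C f g p q" "h \<in> Arr C" "k \<in> Arr C" "Dom C k = Dom C p" "Cod C h = Dom C p"
    "Dom C h = Cod C k" "h \<odot> k = Ident C (Dom C p)" "k \<odot> h = Ident C (Dom C h)"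
  shows "pullback C f g (p \<odot> h) (q \<odot> h)"
proof -
  note pb = pullbackD[OF assms(1)]
  have hk: "h \<odot> (k \<odot> x) = x" if "x \<in> Arr C" "Cod C x = Dom C p" for x
    using Comp_extend1[OF assms(7), of x] that assms pb by simp
  have kh: "k \<odot> (h \<odot> x) = x" if "x \<in> Arr C" "Cod C x = Dom C h" for x
    using Comp_extend1[OF assms(8), of x] that assms pb by simp
  show ?thesis
  proof (rule pullbackI)
    show "f \<odot> (p \<odot> h) = g \<odot> (q \<odot> h)"
      using Comp_extend[OF pb(9)] pb assms by simp
  next
    fix x y assume *: "x \<in> Arr C" "y \<in> Arr C" "Dom C x = Dom C y" "Cod C x = Dom C f"
      "Cod C y = Dom C g" "f \<odot> x = g \<odot> y"
    obtain l where "l \<in> Arr C" "Dom C l = Dom C x" "Cod C l = Dom C p" "p \<odot> l = x" "q \<odot> l = y"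
      by (rule pullback_fill[OF assms(1) *])
    then show "\<exists>l\<in>Arr C. Dom C l = Dom C x \<and> Cod C l = Dom C (p \<odot> h) \<and> (p \<odot> h) \<odot> l = x \<and> (q \<odot> h) \<odot> l = y"
      using assms pb hk by (intro bexI[of _ "k \<odot> l"]) auto
  next
    fix x y assume *: "x \<in> Arr C" "y \<in> Arr C" "Dom C x = Dom C y" "Cod C x = Dom C (p \<odot> h)"
      "Cod C y = Dom C (p \<odot> h)" "(p \<odot> h) \<odot> x = (p \<odot> h) \<odot> y" "(q \<odot> h) \<odot> x = (q \<odot> h) \<odot> y"
    have "h \<odot> x = h \<odot> y"
      by (rule pullback_cancel[OF assms(1)]) (use * assms(2-) pb in auto)
    moreover have "Cod C x = Dom C h" "Cod C y = Dom C h" using *(4,5) pb(3) assms(2,5) by simp_all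
    ultimately show "x = y" using kh *(1,2) by metis
  qed (use assms pb in auto)
qed

lemma pullback_iso_unique:
  assumes "pullback C f g p q" "pullback C f g p' q'"
  obtains h k where "h \<in> Arr C" "k \<in> Arr C" "Dom C k = Dom C p" "Cod C h = Dom C p"
    "Dom C h = Dom C p'" "Cod C k = Dom C p'" "h \<odot> k = Ident C (Dom C p)"
    "k \<odot> h = Ident C (Dom C p')" "p' = p \<odot> h" "q' = q \<odot> h"
proof -
  note pb = pullbackD[OF assms(1)] and pb' = pullbackD[OF assms(2)]
  obtain h where h: "h \<in> Arr C" "Dom C h = Dom C p'" "Cod C h = Dom C p" "p \<odot> h = p'" "q \<odot> h = q'"
    using pullback_fill[OF assms(1), of p' q'] pb pb' by metis
  obtain k where k: "k \<in> Arr C" "Dom C k = Dom C p" "Cod C k = Dom C p'" "p' \<odot> k = p" "q' \<odot> k = q"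
    using pullback_fill[OF assms(2), of p q] pb pb' by metis
  have "h \<odot> k = Ident C (Dom C p)"
    by (rule pullback_cancel[OF assms(1)]) (use h k pb pb' Comp_extend1[OF h(4)] Comp_extend1[OF h(5)] in auto)
  moreover have "k \<odot> h = Ident C (Dom C p')"
    by (rule pullback_cancel[OF assms(2)]) (use h k pb pb' Comp_extend1[OF k(4)] Comp_extend1[OF k(5)] in auto)
  ultimately show ?thesis using h k that by auto
qed

lemma coequaliserD:
  assumes "coequaliser C u v q"
  shows "u \<in> Arr C" "v \<in> Arr C" "q \<in> Arr C" "Dom C v = Dom C u" "Cod C v = Cod C u"
    "Dom C q = Cod C u" "q \<odot> u = q \<odot> v"
  using assms by (auto simp: coequaliser_def homset_iff)

lemma coequaliser_fill:
  assumes "coequaliser C u v q" "h \<in> Arr C" "Dom C h = Cod C u" "h \<odot> u = h \<odot> v"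
  obtains k where "k \<in> Arr C" "Dom C k = Cod C q" "Cod C k = Cod C h" "k \<odot> q = h"
proof -
  have "\<exists>!k. k \<in> homset C (Cod C q) (Cod C h) \<and> k \<odot> q = h"
    using assms by (simp add: coequaliser_def homset_iff)
  then show ?thesis using that by (auto simp: homset_iff)
qed

lemma regular_epi_Arr [simp]: "regular_epi C q \<Longrightarrow> q \<in> Arr C"
  using coequaliserD unfolding regular_epi_def by blast

lemma regular_epi_cancel:
  assumes "regular_epi C q" "h \<in> Arr C" "k \<in> Arr C" "Dom C h = Cod C q" "Dom C k = Cod C q"
    "h \<odot> q = k \<odot> q"
  shows "h = k"
proof -
  obtain u v where uv: "coequaliser C u v q" using assms(1) by (auto simp: regular_epi_def)
  note cq = coequaliserD[OF uv]
  have cod: "Cod C h = Cod C k" using assms cq by (metis Cod_Comp)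
  have "(h \<odot> q) \<odot> u = (h \<odot> q) \<odot> v" using cq assms by simp
  then have "(h \<odot> q) \<odot> u = (h \<odot> q) \<odot> v" "h \<odot> q \<in> homset C (Cod C u) (Cod C h)" "Cod C h \<in> Obj C"
    using assms(2,4) cq by (simp_all add: homset_iff)
  then have "\<exists>!l. l \<in> homset C (Cod C q) (Cod C h) \<and> l \<odot> q = h \<odot> q"
    using uv unfolding coequaliser_def by blast
  then show ?thesis using assms cod unfolding homset_iff by metis
qed

text \<open>Frees later arguments from the particular pair that \<open>q\<close> coequalises: that
  pair is among those identified by \<open>q\<close>, so a condition on all of them covers
  it.\<close>

lemma regular_epi_fill:
  assumes "regular_epi C q" "h \<in> Arr C" "Dom C h = Dom C q"
    and "\<And>u v. u \<in> Arr C \<Longrightarrow> v \<in> Arr C \<Longrightarrow> Dom C u = Dom C v \<Longrightarrow> Cod C u = Dom C q \<Longrightarrow>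
      Cod C v = Dom C q \<Longrightarrow> q \<odot> u = q \<odot> v \<Longrightarrow> h \<odot> u = h \<odot> v"
  obtains k where "k \<in> Arr C" "Dom C k = Cod C q" "Cod C k = Cod C h" "k \<odot> q = h"
proof -
  obtain u v where uv: "coequaliser C u v q" using assms(1) by (auto simp: regular_epi_def)
  show ?thesis
    using coequaliser_fill[OF uv assms(2)] coequaliserD[OF uv] assms that by metis
qed

definition monic :: "'m \<Rightarrow> bool" where
  "monic m \<longleftrightarrow> m \<in> Arr C \<and> (\<forall>x\<in>Arr C. \<forall>y\<in>Arr C. Dom C x = Dom C y \<and> Cod C x = Dom C m \<and>
     Cod C y = Dom C m \<and> m \<odot> x = m \<odot> y \<longrightarrow> x = y)"

lemma monicD:
  assumes "monic m" "x \<in> Arr C" "y \<in> Arr C" "Dom C x = Dom C y" "Cod C x = Dom C m"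
    "Cod C y = Dom C m" "m \<odot> x = m \<odot> y"
  shows "x = y"
  using assms by (auto simp: monic_def)

text \<open>Orthogonality of regular epimorphisms and monomorphisms. A pair identified by
  \<open>e\<close> is identified by \<open>m \<odot> a\<close>, hence by \<open>a\<close> since
  \<open>m\<close> is monic; so \<open>a\<close> factors through \<open>e\<close>.\<close>

lemma regular_epi_monic_fill:
  assumes "regular_epi C e" "monic m" "a \<in> Arr C" "b \<in> Arr C" "Dom C a = Dom C e"
    "Cod C a = Dom C m" "Dom C b = Cod C e" "Cod C b = Cod C m" "m \<odot> a = b \<odot> e"
  obtains k where "k \<in> Arr C" "Dom C k = Cod C e" "Cod C k = Dom C m" "k \<odot> e = a" "m \<odot> k = b"
proof -
  have m: "m \<in> Arr C" using assms(2) by (simp add: monic_def)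
  have e: "e \<in> Arr C" using assms(1) by simp
  obtain k where k: "k \<in> Arr C" "Dom C k = Cod C e" "Cod C k = Cod C a" "k \<odot> e = a"
  proof (rule regular_epi_fill[OF assms(1,3,5)])
    fix u v assume uv: "u \<in> Arr C" "v \<in> Arr C" "Dom C u = Dom C v" "Cod C u = Dom C e"
      "Cod C v = Dom C e" "e \<odot> u = e \<odot> v"
    have "m \<odot> (a \<odot> u) = m \<odot> (a \<odot> v)"
      using Comp_extend[OF assms(9), of u] Comp_extend[OF assms(9), of v] uv assms(3-) m e by simp
    then show "a \<odot> u = a \<odot> v"
    by - (rule monicD[OF assms(2)], use uv assms(3-) m in auto)
  qed
  have "m \<odot> k = b"
    by (rule regular_epi_cancel[OF assms(1)]) (use k assms m e in auto)
  then show ?thesis using k assms that by metis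
qed

lemma regular_epi_Comp_iso:
  assumes "regular_epi C e" "m \<in> Arr C" "k \<in> Arr C" "Dom C m = Cod C e" "Dom C k = Cod C m"
    "Cod C k = Dom C m" "m \<odot> k = Ident C (Cod C m)" "k \<odot> m = Ident C (Dom C m)"
  shows "regular_epi C (m \<odot> e)"
proof -
  obtain u v where uv: "coequaliser C u v e" using assms(1) by (auto simp: regular_epi_def)
  note cq = coequaliserD[OF uv]
  have "\<exists>!l. l \<in> homset C (Cod C (m \<odot> e)) Z \<and> l \<odot> (m \<odot> e) = h"
    if h: "h \<in> homset C (Cod C u) Z" "h \<odot> u = h \<odot> v" for h Z
  proof -
    obtain l where l: "l \<in> Arr C" "Dom C l = Cod C e" "Cod C l = Z" "l \<odot> e = h"
      using coequaliser_fill[OF uv, of h] h by (metis homset_iff)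
    have "k \<odot> (m \<odot> e) = e" using Comp_extend1[OF assms(8), of e] assms cq by simp
    then have ex: "l \<odot> k \<in> homset C (Cod C (m \<odot> e)) Z \<and> (l \<odot> k) \<odot> (m \<odot> e) = h"
      using l assms cq by (simp add: homset_iff)
    show ?thesis
    proof (rule ex1I[of _ "l \<odot> k"])
      fix l' assume l': "l' \<in> homset C (Cod C (m \<odot> e)) Z \<and> l' \<odot> (m \<odot> e) = h"
      have "l' \<odot> m = l"
        by (rule regular_epi_cancel[OF assms(1)]) (use l' l assms cq in \<open>auto simp: homset_iff\<close>)
      then have "(l' \<odot> m) \<odot> k = l \<odot> k" by simp
      then show "l' = l \<odot> k" using l' assms cq by (simp add: homset_iff)
    qed (rule ex)
  qed
  moreover have "(m \<odot> e) \<odot> u = (m \<odot> e) \<odot> v" using cq assms by simp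
  ultimately have "coequaliser C u v (m \<odot> e)"
    unfolding coequaliser_def using cq assms
    by (intro conjI ballI impI) (assumption | simp add: homset_iff)+
  then show ?thesis by (auto simp: regular_epi_def)
qed

lemma regular_epi_Ident: "A \<in> Obj C \<Longrightarrow> regular_epi C (Ident C A)"
  unfolding regular_epi_def coequaliser_def
  by (rule exI[of _ "Ident C A"], rule exI[of _ "Ident C A"])
     (auto simp: homset_iff)

end

section \<open>Image factorisation and closure properties of regular epimorphisms\<close>

context regular_category
begin

text \<open>The form in which stability is used: a regular epimorphism is locally surjective on
  generalised elements, the cover \<open>e\<close> being its pullback along
  \<open>x\<close>.\<close>

lemma regular_epi_pullback:
  assumes "regular_epi C f" "x \<in> Arr C" "Cod C x = Cod C f"
  obtains e y where "regular_epi C e" "Cod C e = Dom C x" "y \<in> Arr C" "Dom C y = Dom C e"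
    "Cod C y = Dom C f" "f \<odot> y = x \<odot> e"
proof -
  obtain p q where pb: "pullback C f x p q" using has_pullbacks[of f x] assms by auto
  show ?thesis using that[of q p] regular_epi_stable[OF pb assms(1)] pullbackD[OF pb] by auto
qed

text \<open>\<open>c\<close> is the coequaliser of the kernel pair of \<open>f\<close>. That the
  induced \<open>m\<close> is monic is proved locally: after two covers, elements equalised by
  \<open>m\<close> lift along \<open>c\<close> to elements equalised by \<open>f\<close>; these form
  a point of the kernel pair, so \<open>c\<close> identifies them.\<close>

lemma image_factorisation:
  assumes f: "f \<in> Arr C"
  obtains m c where "regular_epi C c" "monic m" "f = m \<odot> c" "Dom C c = Dom C f"
    "Dom C m = Cod C c" "Cod C m = Cod C f"
proof -
  obtain p q where pb: "pullback C f f p q" using has_pullbacks[of f f] f by auto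
  note pbD = pullbackD[OF pb]
  obtain c where coeq: "coequaliser C p q c" using kernel_pair_coequaliser[OF pb] by auto
  note cq = coequaliserD[OF coeq]
  have c: "regular_epi C c" using coeq by (auto simp: regular_epi_def)
  obtain m where m: "m \<in> Arr C" "Dom C m = Cod C c" "Cod C m = Cod C f" "m \<odot> c = f"
    using coequaliser_fill[OF coeq f] pbD by metis
  have "x = y" if xy: "x \<in> Arr C" "y \<in> Arr C" "Dom C x = Dom C y" "Cod C x = Dom C m"
     "Cod C y = Dom C m" "m \<odot> x = m \<odot> y" for x y
  proof -
    obtain e a where e: "regular_epi C e" "Cod C e = Dom C x" "a \<in> Arr C" "Dom C a = Dom C e"
      "Cod C a = Dom C c" "c \<odot> a = x \<odot> e"
      using regular_epi_pullback[OF c, of x] xy m by metis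
    obtain e' b where e': "regular_epi C e'" "Cod C e' = Dom C (y \<odot> e)" "b \<in> Arr C" "Dom C b = Dom C e'"
      "Cod C b = Dom C c" "c \<odot> b = (y \<odot> e) \<odot> e'"
      using regular_epi_pullback[OF c, of "y \<odot> e"] xy m e by (metis Arr_Comp Cod_Comp regular_epi_Arr)
    have arr: "e \<in> Arr C" "e' \<in> Arr C" using e e' by auto
    have 1: "c \<odot> (a \<odot> e') = x \<odot> (e \<odot> e')"
      using Comp_extend[OF e(6), of e'] e e' cq xy arr by simp
    have 2: "c \<odot> b = y \<odot> (e \<odot> e')" using e e' xy arr by simp
    have "f \<odot> (a \<odot> e') = m \<odot> (c \<odot> (a \<odot> e'))"
      using m Comp_extend1[OF m(4), of "a \<odot> e'"] e e' arr cq xy by simp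
    also have "\<dots> = m \<odot> (c \<odot> b)"
      unfolding 1 2 using Comp_extend[OF xy(6), of "e \<odot> e'"] xy e e' arr m by simp
    also have "\<dots> = f \<odot> b" using Comp_extend1[OF m(4), of b] m e' cq by simp
    finally have eq: "f \<odot> (a \<odot> e') = f \<odot> b" .
    obtain h where h: "h \<in> Arr C" "Dom C h = Dom C b" "Cod C h = Dom C p" "p \<odot> h = a \<odot> e'" "q \<odot> h = b"
      using pullback_fill[OF pb, of "a \<odot> e'" b] eq e e' arr pbD cq xy by (metis Arr_Comp Cod_Comp Dom_Comp)
    have "x \<odot> (e \<odot> e') = y \<odot> (e \<odot> e')"
      using Comp_extend[OF cq(7), of h] h cq pbD 1 2 by simp
    then have "(x \<odot> e) \<odot> e' = (y \<odot> e) \<odot> e'" using xy e e' arr by simp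
    then have "x \<odot> e = y \<odot> e"
    by - (rule regular_epi_cancel[OF e'(1)], use xy e e' arr in auto)
    then show ?thesis
    by - (rule regular_epi_cancel[OF e(1)], use xy e arr in auto)
  qed
  then have "monic m" using m by (auto simp: monic_def)
  then show ?thesis using that[OF c] m cq pbD by auto
qed

text \<open>With \<open>f = m \<odot> c\<close> the image factorisation, orthogonality of
  \<open>e\<close> and \<open>m\<close> against an identity yields a section of \<open>m\<close>. A
  monomorphism with a section is invertible, so \<open>f\<close> is \<open>c\<close> up to
  isomorphism.\<close>

lemma regular_epi_right_factor:
  assumes "regular_epi C e" "f \<in> Arr C" "a \<in> Arr C" "Cod C a = Dom C f" "f \<odot> a = e"
  shows "regular_epi C f"
proof -
  obtain m c where mc: "regular_epi C c" "monic m" "f = m \<odot> c" "Dom C c = Dom C f"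
    "Dom C m = Cod C c" "Cod C m = Cod C f"
    by (rule image_factorisation[OF assms(2)])
  have arr: "m \<in> Arr C" "c \<in> Arr C" "e \<in> Arr C" using mc assms by (auto simp: monic_def)
  have de: "Dom C e = Dom C a" "Cod C e = Cod C f" using assms by auto
  have "(m \<odot> c) \<odot> a = Ident C (Cod C e) \<odot> e"
    using assms(5) arr(3) unfolding mc(3) by simp
  then have eq: "m \<odot> (c \<odot> a) = Ident C (Cod C e) \<odot> e"
    using assms(3,4) mc(4-6) arr by simp
  obtain k where k: "k \<in> Arr C" "Dom C k = Cod C e" "Cod C k = Dom C m" "m \<odot> k = Ident C (Cod C e)"
    by (rule regular_epi_monic_fill[OF assms(1) mc(2) _ _ _ _ _ _ eq])
       (use assms(2-4) mc(4-6) arr de in auto)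
  have "m \<odot> (k \<odot> m) = m \<odot> Ident C (Dom C m)"
    using Comp_extend1[OF k(4), of m] k arr mc(4-6) de by simp
  then have "k \<odot> m = Ident C (Dom C m)"
    by - (rule monicD[OF mc(2)], use k arr mc(4-6) de in auto)
  then show ?thesis
    unfolding mc(3) using k arr mc(1,4-6) de by (intro regular_epi_Comp_iso[of c m k]) auto
qed

text \<open>Orthogonality to the monic part \<open>m\<close> of the composite is applied to
  \<open>f\<close> and then to \<open>g\<close>; the second filler is a section of \<open>m\<close>,
  which is thus invertible.\<close>

lemma regular_epi_Comp:
  assumes "regular_epi C f" "regular_epi C g" "Cod C f = Dom C g"
  shows "regular_epi C (g \<odot> f)"
proof -
  have arr: "f \<in> Arr C" "g \<in> Arr C" using assms by auto
  obtain m c where mc: "regular_epi C c" "monic m" "g \<odot> f = m \<odot> c" "Dom C c = Dom C (g \<odot> f)"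
    "Dom C m = Cod C c" "Cod C m = Cod C (g \<odot> f)"
    by (rule image_factorisation[of "g \<odot> f"]) (use assms arr in auto)
  have de: "Dom C c = Dom C f" "Cod C m = Cod C g" using mc(4,6) arr assms by simp_all
  have arr': "m \<in> Arr C" "c \<in> Arr C" using mc by (auto simp: monic_def)
  obtain k where k: "k \<in> Arr C" "Dom C k = Cod C f" "Cod C k = Dom C m" "m \<odot> k = g" "k \<odot> f = c"
    by (rule regular_epi_monic_fill[OF assms(1) mc(2), of c g]) (use mc(3,5) de arr arr' assms in auto)
  obtain l where l: "l \<in> Arr C" "Dom C l = Cod C g" "Cod C l = Dom C m" "m \<odot> l = Ident C (Cod C g)"
    by (rule regular_epi_monic_fill[OF assms(2) mc(2), of k "Ident C (Cod C g)"])
       (use k mc(5) de arr arr' assms in auto)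
  have "m \<odot> (l \<odot> m) = m \<odot> Ident C (Dom C m)"
    using Comp_extend1[OF l(4), of m] l arr arr' mc(1,5) de assms by simp
  then have "l \<odot> m = Ident C (Dom C m)"
    by - (rule monicD[OF mc(2)], use l arr arr' mc(1,5) de assms in auto)
  then show ?thesis
    unfolding mc(3) using l arr arr' mc(1,5) de assms by (intro regular_epi_Comp_iso[of c m l]) auto
qed

end

section \<open>Arrow categories\<close>

locale category_with_pullbacks = category C for C :: "('o, 'm) cat" (structure) +
  assumes pullbacks: "f \<in> Arr C \<Longrightarrow> g \<in> Arr C \<Longrightarrow> Cod C f = Cod C g \<Longrightarrow> \<exists>p q. pullback C f g p q"

sublocale regular_category \<subseteq> category_with_pullbacks
  by unfold_locales (rule has_pullbacks)

lemma base_cat_simps [simp]: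
  "Obj (base_cat C) = Vertex ` Obj C" "Arr (base_cat C) = Edge ` Arr C"
  "Dom (base_cat C) f = Vertex (Dom C (the_Edge f))" "Cod (base_cat C) f = Vertex (Cod C (the_Edge f))"
  "Ident (base_cat C) A = Edge (Ident C (the_Vertex A))"
  "g \<odot>\<^bsub>base_cat C\<^esub> f = Edge (the_Edge g \<odot>\<^bsub>C\<^esub> the_Edge f)"
  by (simp_all add: base_cat_def)

lemma Arr_cat_simps [simp]:
  "Obj (Arr_cat K) = Arr K" "Dom (Arr_cat K) = sq_source" "Cod (Arr_cat K) = sq_target"
  "Ident (Arr_cat K) f = Square f f (Ident K (Dom K f)) (Ident K (Cod K f))"
  "G \<odot>\<^bsub>Arr_cat K\<^esub> F = Square (sq_source F) (sq_target G)
    (sq_dom G \<odot>\<^bsub>K\<^esub> sq_dom F) (sq_cod G \<odot>\<^bsub>K\<^esub> sq_cod F)"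
  by (simp_all add: Arr_cat_def)

lemma Square_in_Arr_cat [simp]:
  "Square f g a b \<in> Arr (Arr_cat K) \<longleftrightarrow>
    f \<in> Arr K \<and> g \<in> Arr K \<and> a \<in> Arr K \<and> b \<in> Arr K \<and>
    Dom K a = Dom K f \<and> Cod K a = Dom K g \<and> Dom K b = Cod K f \<and> Cod K b = Cod K g \<and>
    g \<odot>\<^bsub>K\<^esub> a = b \<odot>\<^bsub>K\<^esub> f"
  by (auto simp: Arr_cat_def homset_iff)

lemma Arr_cat_cases:
  assumes "F \<in> Arr (Arr_cat K)"
  obtains f g a b where "F = Square f g a b"
  using assms by (auto simp: Arr_cat_def)

lemma Arr_catE:
  assumes "F \<in> Arr (Arr_cat K)"
  obtains f g a b where "F = Square f g a b"
    "f \<in> Arr K" "g \<in> Arr K" "a \<in> Arr K" "b \<in> Arr K" "Dom K a = Dom K f" "Cod K a = Dom K g"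
    "Dom K b = Cod K f" "Cod K b = Cod K g" "g \<odot>\<^bsub>K\<^esub> a = b \<odot>\<^bsub>K\<^esub> f"
  using assms by (auto simp: Arr_cat_def homset_iff)

lemma category_base_cat:
  assumes "category C"
  shows "category (base_cat C)"
proof -
  interpret category C by (rule assms)
  show ?thesis by unfold_locales (auto simp: homset_iff)
qed

lemma category_Arr_cat:
  fixes K (structure)
  assumes "category K"
  shows "category (Arr_cat K)"
proof -
  interpret category K by (rule assms)
  show ?thesis
  proof
    fix F A B G D assume F: "F \<in> homset (Arr_cat K) A B" and G: "G \<in> homset (Arr_cat K) B D"
    obtain a b where F': "F = Square A B a b" using F by (auto simp: homset_iff elim: Arr_cat_cases)
    obtain a' b' where G': "G = Square B D a' b'" using G by (auto simp: homset_iff elim: Arr_cat_cases)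
    show "G \<odot>\<^bsub>Arr_cat K\<^esub> F \<in> homset (Arr_cat K) A D"
      using F G Comp_extend[of D a' b' B a] Comp_extend[of B a b A] unfolding F' G'
      by (simp add: homset_iff)
  qed (auto simp: homset_iff elim!: Arr_catE)
qed

lemma pullback_base_cat:
  "pullback (base_cat C) (Edge f) (Edge g) (Edge p) (Edge q) \<longleftrightarrow> pullback C f g p q"
proof -
  have hom: "homset (base_cat C) (Vertex A) (Vertex B) = Edge ` homset C A B" for A B
    by (auto simp: homset_iff)
  have mem: "Edge x \<in> Edge ` S \<longleftrightarrow> x \<in> S" for x and S :: "'b set" by auto
  have ex1: "(\<exists>!h. h \<in> Edge ` S \<and> P h) \<longleftrightarrow> (\<exists>!x. x \<in> S \<and> P (Edge x))" for P and S :: "'b set"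
    by blast
  show ?thesis by (simp add: pullback_def hom mem ex1)
qed

lemma pullbacks_base_cat:
  assumes "category_with_pullbacks C"
  shows "category_with_pullbacks (base_cat C)"
proof -
  interpret category_with_pullbacks C by (rule assms)
  interpret B: category "base_cat C" by (rule category_base_cat) (rule category_axioms)
  show ?thesis
  proof
    fix F G assume "F \<in> Arr (base_cat C)" "G \<in> Arr (base_cat C)" "Cod (base_cat C) F = Cod (base_cat C) G"
    then obtain f g where fg: "F = Edge f" "G = Edge g" "f \<in> Arr C" "g \<in> Arr C" "Cod C f = Cod C g" by auto
    obtain p q where "pullback C f g p q" using pullbacks[OF fg(3-5)] by blast
    then have "pullback (base_cat C) F G (Edge p) (Edge q)" using fg by (simp add: pullback_base_cat)
    then show "\<exists>p q. pullback (base_cat C) F G p q" by blast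
  qed
qed

lemma base_cat_pullbackD:
  assumes "pullback (base_cat C) F G P Q"
  shows "pullback C (the_Edge F) (the_Edge G) (the_Edge P) (the_Edge Q)"
proof -
  obtain f g p q where "F = Edge f" "G = Edge g" "P = Edge p" "Q = Edge q"
    using assms by (auto simp: pullback_def homset_iff)
  then show ?thesis using assms by (simp add: pullback_base_cat)
qed

text \<open>Pullbacks in an arrow category are computed separately on domains and on codomains. The
  arrow \<open>w\<close> connecting the two component pullbacks is induced by the universal property
  of the second one.\<close>

lemma Arr_cat_pullback_ex:
  fixes K (structure)
  assumes "category_with_pullbacks K" "F \<in> Arr (Arr_cat K)" "G \<in> Arr (Arr_cat K)" "sq_target F = sq_target G"
  obtains P Q where "pullback (Arr_cat K) F G P Q"
    "pullback K (sq_dom F) (sq_dom G) (sq_dom P) (sq_dom Q)"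
    "pullback K (sq_cod F) (sq_cod G) (sq_cod P) (sq_cod Q)"
proof -
  interpret category_with_pullbacks K by (rule assms)
  interpret A: category "Arr_cat K" by (rule category_Arr_cat) (rule category_axioms)
  obtain f h a b where F: "F = Square f h a b" using assms(2) by (rule Arr_cat_cases)
  obtain g a' b' where G: "G = Square g h a' b'" using assms(3,4) F by (auto elim: Arr_cat_cases)
  have F': "f \<in> Arr K" "h \<in> Arr K" "a \<in> Arr K" "b \<in> Arr K" "Dom K a = Dom K f" "Cod K a = Dom K h"
    "Dom K b = Cod K f" "Cod K b = Cod K h" "h \<odot> a = b \<odot> f"
    using assms(2) F by auto
  have G': "g \<in> Arr K" "a' \<in> Arr K" "b' \<in> Arr K" "Dom K a' = Dom K g" "Cod K a' = Dom K h"
    "Dom K b' = Cod K g" "Cod K b' = Cod K h" "h \<odot> a' = b' \<odot> g"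
    using assms(3) G by auto
  obtain p1 q1 where pb1: "pullback K a a' p1 q1" using pullbacks[of a a'] F' G' by auto
  obtain p2 q2 where pb2: "pullback K b b' p2 q2" using pullbacks[of b b'] F' G' by auto
  note 1 = pullbackD[OF pb1] and 2 = pullbackD[OF pb2]
  have "b \<odot> (f \<odot> p1) = h \<odot> (a \<odot> p1)" using Comp_extend[OF F'(9), of p1] F' 1 by simp
  also have "\<dots> = h \<odot> (a' \<odot> q1)" using 1 by simp
  also have "\<dots> = b' \<odot> (g \<odot> q1)" using Comp_extend[OF G'(8), of q1] F' G' 1 by simp
  finally have eq: "b \<odot> (f \<odot> p1) = b' \<odot> (g \<odot> q1)" .
  obtain w where w: "w \<in> Arr K" "Dom K w = Dom K p1" "Cod K w = Dom K p2"
    "p2 \<odot> w = f \<odot> p1" "q2 \<odot> w = g \<odot> q1"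
    by (rule pullback_fill[OF pb2 _ _ _ _ _ eq]) (use F' G' 1 2 in auto)
  let ?P = "Square w f p1 p2" and ?Q = "Square w g q1 q2"
  have "pullback (Arr_cat K) F G ?P ?Q"
  proof (rule A.pullbackI)
    fix X Y assume X: "X \<in> Arr (Arr_cat K)" and Y: "Y \<in> Arr (Arr_cat K)"
      and XY: "Dom (Arr_cat K) X = Dom (Arr_cat K) Y" "Cod (Arr_cat K) X = Dom (Arr_cat K) F"
        "Cod (Arr_cat K) Y = Dom (Arr_cat K) G" "F \<odot>\<^bsub>Arr_cat K\<^esub> X = G \<odot>\<^bsub>Arr_cat K\<^esub> Y"
    obtain t x1 x2 where Xe: "X = Square t f x1 x2" using X XY F by (auto elim: Arr_cat_cases)
    obtain y1 y2 where Ye: "Y = Square t g y1 y2" using Y XY G Xe by (auto elim: Arr_cat_cases)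
    have X': "t \<in> Arr K" "x1 \<in> Arr K" "x2 \<in> Arr K" "Dom K x1 = Dom K t" "Cod K x1 = Dom K f"
      "Dom K x2 = Cod K t" "Cod K x2 = Cod K f" "f \<odot> x1 = x2 \<odot> t" using X Xe by auto
    have Y': "y1 \<in> Arr K" "y2 \<in> Arr K" "Dom K y1 = Dom K t" "Cod K y1 = Dom K g"
      "Dom K y2 = Cod K t" "Cod K y2 = Cod K g" "g \<odot> y1 = y2 \<odot> t" using Y Ye by auto
    have e: "a \<odot> x1 = a' \<odot> y1" "b \<odot> x2 = b' \<odot> y2" using XY(4) F G Xe Ye by auto
    obtain h1 where h1: "h1 \<in> Arr K" "Dom K h1 = Dom K x1" "Cod K h1 = Dom K p1"
      "p1 \<odot> h1 = x1" "q1 \<odot> h1 = y1"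
      by (rule pullback_fill[OF pb1 _ _ _ _ _ e(1)]) (use X' Y' F' G' in auto)
    obtain h2 where h2: "h2 \<in> Arr K" "Dom K h2 = Dom K x2" "Cod K h2 = Dom K p2"
      "p2 \<odot> h2 = x2" "q2 \<odot> h2 = y2"
      by (rule pullback_fill[OF pb2 _ _ _ _ _ e(2)]) (use X' Y' F' G' in auto)
    have "w \<odot> h1 = h2 \<odot> t"
    proof (rule pullback_cancel[OF pb2])
      show "p2 \<odot> (w \<odot> h1) = p2 \<odot> (h2 \<odot> t)"
        using Comp_extend[OF w(4), of h1] Comp_extend1[OF h2(4), of t] w h1 h2 X' F' 1 2 by simp
      show "q2 \<odot> (w \<odot> h1) = q2 \<odot> (h2 \<odot> t)"
        using Comp_extend[OF w(5), of h1] Comp_extend1[OF h2(5), of t] w h1 h2 X' Y' F' G' 1 2 by simp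
    qed (use w h1 h2 X' in auto)
    then show "\<exists>H\<in>Arr (Arr_cat K). Dom (Arr_cat K) H = Dom (Arr_cat K) X \<and>
        Cod (Arr_cat K) H = Dom (Arr_cat K) ?P \<and> ?P \<odot>\<^bsub>Arr_cat K\<^esub> H = X \<and> ?Q \<odot>\<^bsub>Arr_cat K\<^esub> H = Y"
      using w h1 h2 X' Xe Ye by (intro bexI[of _ "Square t w h1 h2"]) auto
  next
    fix H L assume H: "H \<in> Arr (Arr_cat K)" and L: "L \<in> Arr (Arr_cat K)"
      and HL: "Dom (Arr_cat K) H = Dom (Arr_cat K) L" "Cod (Arr_cat K) H = Dom (Arr_cat K) ?P"
        "Cod (Arr_cat K) L = Dom (Arr_cat K) ?P" "?P \<odot>\<^bsub>Arr_cat K\<^esub> H = ?P \<odot>\<^bsub>Arr_cat K\<^esub> L"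
        "?Q \<odot>\<^bsub>Arr_cat K\<^esub> H = ?Q \<odot>\<^bsub>Arr_cat K\<^esub> L"
    obtain t h1 h2 where He: "H = Square t w h1 h2" using H HL by (auto elim: Arr_cat_cases)
    obtain l1 l2 where Le: "L = Square t w l1 l2" using L HL He by (auto elim: Arr_cat_cases)
    have "h1 = l1"
      by (rule pullback_cancel[OF pb1]) (use H L HL He Le w in auto)
    moreover have "h2 = l2"
      by (rule pullback_cancel[OF pb2]) (use H L HL He Le w in auto)
    ultimately show "H = L" using He Le by simp
  qed (use F G F' G' 1 2 w in auto)
  then show ?thesis using that pb1 pb2 F G by auto
qed

lemma pullbacks_Arr_cat:
  assumes "category_with_pullbacks K"
  shows "category_with_pullbacks (Arr_cat K)"
proof -
  interpret category_with_pullbacks K by (rule assms)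
  interpret A: category "Arr_cat K" by (rule category_Arr_cat) (rule category_axioms)
  show ?thesis
    by unfold_locales (metis Arr_cat_pullback_ex[OF assms] Arr_cat_simps(3))
qed

text \<open>An arbitrary pullback differs from the componentwise one by an isomorphism, and an
  isomorphism of squares is an isomorphism on each component.\<close>

lemma Arr_cat_pullbackD:
  fixes K (structure)
  assumes "category_with_pullbacks K" "pullback (Arr_cat K) F G P Q"
  shows "pullback K (sq_dom F) (sq_dom G) (sq_dom P) (sq_dom Q)"
    and "pullback K (sq_cod F) (sq_cod G) (sq_cod P) (sq_cod Q)"
proof -
  interpret category_with_pullbacks K by (rule assms)
  interpret A: category "Arr_cat K" by (rule category_Arr_cat) (rule category_axioms)
  note pb = A.pullbackD[OF assms(2)]
  obtain P' Q' where P'Q': "pullback (Arr_cat K) F G P' Q'"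
    "pullback K (sq_dom F) (sq_dom G) (sq_dom P') (sq_dom Q')"
    "pullback K (sq_cod F) (sq_cod G) (sq_cod P') (sq_cod Q')"
    using Arr_cat_pullback_ex[OF assms(1) pb(1,2)] pb(5) by (metis Arr_cat_simps(3))
  obtain H L where HL: "H \<in> Arr (Arr_cat K)" "L \<in> Arr (Arr_cat K)" "sq_source L = sq_source P'"
    "sq_target H = sq_source P'" "sq_source H = sq_source P" "sq_target L = sq_source P"
    "H \<odot>\<^bsub>Arr_cat K\<^esub> L = Ident (Arr_cat K) (sq_source P')" "L \<odot>\<^bsub>Arr_cat K\<^esub> H = Ident (Arr_cat K) (sq_source P)"
    "P = P' \<odot>\<^bsub>Arr_cat K\<^esub> H" "Q = Q' \<odot>\<^bsub>Arr_cat K\<^esub> H"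
    by (rule A.pullback_iso_unique[OF P'Q'(1) assms(2)]) auto
  have P': "P' \<in> Arr (Arr_cat K)" using A.pullbackD[OF P'Q'(1)] by simp
  obtain w v p1 p2 where P'e: "P' = Square w v p1 p2" using P' by (rule Arr_cat_cases)
  obtain u h1 h2 where He: "H = Square u w h1 h2" using HL P'e by (auto elim: Arr_cat_cases)
  obtain l1 l2 where Le: "L = Square w u l1 l2" using HL P'e He by (auto elim!: Arr_cat_cases)
  have "pullback K (sq_dom F) (sq_dom G) (sq_dom P' \<odot> h1) (sq_dom Q' \<odot> h1)"
    by (rule pullback_Comp_iso[OF P'Q'(2), of h1 l1]) (use P' HL He Le P'e in auto)
  moreover have "pullback K (sq_cod F) (sq_cod G) (sq_cod P' \<odot> h2) (sq_cod Q' \<odot> h2)"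
    by (rule pullback_Comp_iso[OF P'Q'(3), of h2 l2]) (use P' HL He Le P'e in auto)
  ultimately show "pullback K (sq_dom F) (sq_dom G) (sq_dom P) (sq_dom Q)"
    and "pullback K (sq_cod F) (sq_cod G) (sq_cod P) (sq_cod Q)"
    using HL(9,10) He by auto
qed

lemma category_Arr_pow: "category C \<Longrightarrow> category (Arr_pow n C)"
  by (induction n) (auto intro: category_base_cat category_Arr_cat)

lemma pullbacks_Arr_pow: "category_with_pullbacks C \<Longrightarrow> category_with_pullbacks (Arr_pow n C)"
  by (induction n) (auto intro: pullbacks_base_cat pullbacks_Arr_cat)

section \<open>Cubic extensions as a lifting property\<close>

primrec component :: "nat \<Rightarrow> ('o, 'm) narr \<Rightarrow> nat set \<Rightarrow> 'm" where
  "component 0 F I = the_Edge F"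
| "component (Suc n) F I = component n (if n \<in> I then sq_cod F else sq_dom F) I"

primrec vertex :: "('o, 'm) cat \<Rightarrow> nat \<Rightarrow> ('o, 'm) narr \<Rightarrow> nat set \<Rightarrow> 'o" where
  "vertex C 0 A I = the_Vertex A"
| "vertex C (Suc n) A I =
     vertex C n (if n \<in> I then Cod (Arr_pow n C) A else Dom (Arr_pow n C) A) I"

text \<open>An \<open>(n + 1)\<close>-fold arrow is an arrow of \<open>Arr_pow n C\<close>: its
  edges in the outermost direction \<open>n\<close> are its components, while those in the other
  directions belong to its source or its target. The value in dimension \<open>0\<close> is
  junk.\<close>

primrec cube_edge :: "('o, 'm) cat \<Rightarrow> nat \<Rightarrow> ('o, 'm) narr \<Rightarrow> nat \<Rightarrow> nat set \<Rightarrow> 'm" where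
  "cube_edge C 0 A i I = undefined"
| "cube_edge C (Suc n) A i I =
     (if i = n then component n A I
      else cube_edge C n (if n \<in> I then Cod (Arr_pow n C) A else Dom (Arr_pow n C) A) i I)"

definition cube_of :: "('o, 'm) cat \<Rightarrow> nat \<Rightarrow> ('o, 'm) narr \<Rightarrow> ('o, 'm) cube" where
  "cube_of C n A = \<lparr>cvert = vertex C n A, cedge = cube_edge C n A\<rparr>"

lemma cube_of_simps [simp]:
  "cvert (cube_of C n A) = vertex C n A" "cedge (cube_of C n A) = cube_edge C n A"
  by (simp_all add: cube_of_def)

text \<open>Limits of punctured subcubes are replaced by compatible families of generalised
  elements, so that no choice of limit objects is involved.\<close>

definition compatible ::
    "('o, 'm) cat \<Rightarrow> ('o, 'm) cube \<Rightarrow> nat set \<Rightarrow> nat set \<Rightarrow> 'o \<Rightarrow> (nat \<Rightarrow> 'm) \<Rightarrow> bool" where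
  "compatible C F I J T x \<longleftrightarrow>
     (\<forall>j\<in>J. x j \<in> homset C T (cvert F (insert j I))) \<and>
     (\<forall>j\<in>J. \<forall>k\<in>J. j \<noteq> k \<longrightarrow>
        cedge F k (insert j I) \<odot>\<^bsub>C\<^esub> x j = cedge F j (insert k I) \<odot>\<^bsub>C\<^esub> x k)"

text \<open>Expresses that vertex \<open>I\<close> maps onto the limit of the punctured subcube in
  the directions \<open>J\<close>: a morphism is a regular epimorphism iff every generalised element
  of its codomain lifts along it after a cover.\<close>

definition lifting :: "('o, 'm) cat \<Rightarrow> ('o, 'm) cube \<Rightarrow> nat set \<Rightarrow> nat set \<Rightarrow> bool" where
  "lifting C F I J \<longleftrightarrow>
     (\<forall>T\<in>Obj C. \<forall>x. compatible C F I J T x \<longrightarrow>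
        (\<exists>e z. regular_epi C e \<and> Cod C e = T \<and> z \<in> homset C (Dom C e) (cvert F I) \<and>
           (\<forall>j\<in>J. cedge F j I \<odot>\<^bsub>C\<^esub> z = x j \<odot>\<^bsub>C\<^esub> e)))"

text \<open>The empty \<open>J\<close> is excluded because its limit is the terminal object; lifting
  would then require the vertex to have full support.\<close>

definition all_lifting :: "('o, 'm) cat \<Rightarrow> nat \<Rightarrow> ('o, 'm) cube \<Rightarrow> bool" where
  "all_lifting C n F \<longleftrightarrow>
     (\<forall>I J. I \<subseteq> {..<n} \<longrightarrow> J \<subseteq> {..<n} \<longrightarrow> I \<inter> J = {} \<longrightarrow> J \<noteq> {} \<longrightarrow> lifting C F I J)"

lemma compatible_cong:
  assumes "\<And>j. j \<in> J \<Longrightarrow> cvert F (insert j I) = cvert F' (insert j I')"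
    and "\<And>j k. j \<in> J \<Longrightarrow> k \<in> J \<Longrightarrow> j \<noteq> k \<Longrightarrow> cedge F k (insert j I) = cedge F' k (insert j I')"
  shows "compatible C F I J T x \<longleftrightarrow> compatible C F' I' J T x"
  unfolding compatible_def using assms by (intro conj_cong ball_cong refl imp_cong) auto

lemma lifting_cong:
  assumes "cvert F I = cvert F' I'"
    and "\<And>j. j \<in> J \<Longrightarrow> cvert F (insert j I) = cvert F' (insert j I') \<and> cedge F j I = cedge F' j I'"
    and "\<And>j k. j \<in> J \<Longrightarrow> k \<in> J \<Longrightarrow> j \<noteq> k \<Longrightarrow> cedge F k (insert j I) = cedge F' k (insert j I')"
  shows "lifting C F I J \<longleftrightarrow> lifting C F' I' J"
  unfolding lifting_def using assms compatible_cong[of J F I F' I'] by simp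

lemma component_insert [simp]: "n \<le> m \<Longrightarrow> component n F (insert m I) = component n F I"
  by (induction n arbitrary: F) auto

lemma vertex_insert [simp]: "n \<le> m \<Longrightarrow> vertex C n A (insert m I) = vertex C n A I"
  by (induction n arbitrary: A) auto

lemma cube_edge_insert [simp]: "n \<le> m \<Longrightarrow> cube_edge C n A i (insert m I) = cube_edge C n A i I"
  by (induction n arbitrary: A) auto

context category
begin

lemma component_homset:
  "F \<in> homset (Arr_pow n C) A B \<Longrightarrow> component n F I \<in> homset C (vertex C n A I) (vertex C n B I)"
proof (induction n arbitrary: F A B)
  case 0
  then show ?case by (auto simp: homset_iff)
next
  case (Suc n)
  then obtain a b where "F = Square A B a b"
    "a \<in> homset (Arr_pow n C) (Dom (Arr_pow n C) A) (Dom (Arr_pow n C) B)"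
    "b \<in> homset (Arr_pow n C) (Cod (Arr_pow n C) A) (Cod (Arr_pow n C) B)"
    by (auto simp: homset_iff elim!: Arr_catE)
  then show ?case using Suc.IH by auto
qed

lemma component_Arr:
  assumes "F \<in> Arr (Arr_pow n C)"
  shows "component n F I \<in> Arr C"
    and "Dom C (component n F I) = vertex C n (Dom (Arr_pow n C) F) I"
    and "Cod C (component n F I) = vertex C n (Cod (Arr_pow n C) F) I"
  using component_homset[of F n] assms by (auto simp: homset_iff)

lemma component_Comp:
  assumes "F \<in> Arr (Arr_pow n C)" "G \<in> Arr (Arr_pow n C)"
    "Cod (Arr_pow n C) F = Dom (Arr_pow n C) G"
  shows "component n (G \<odot>\<^bsub>Arr_pow n C\<^esub> F) I = component n G I \<odot> component n F I"
  using assms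
proof (induction n arbitrary: F G)
  case 0
  then show ?case by auto
next
  case (Suc n)
  then show ?case by (auto elim!: Arr_catE)
qed

lemma cube_edge_Arr:
  assumes "A \<in> Obj (Arr_pow n C)" "i < n" "i \<notin> I"
  shows "cube_edge C n A i I \<in> Arr C"
    and "Dom C (cube_edge C n A i I) = vertex C n A I"
    and "Cod C (cube_edge C n A i I) = vertex C n A (insert i I)"
proof -
  have "cube_edge C n A i I \<in> homset C (vertex C n A I) (vertex C n A (insert i I))"
    using assms
  proof (induction n arbitrary: A)
    case 0
    then show ?case by simp
  next
    case (Suc n)
    interpret P: category "Arr_pow n C" by (rule category_Arr_pow) (rule category_axioms)
    show ?case
      using Suc component_Arr[of A n] by (cases "i = n") (auto simp: homset_iff)
  qed
  then show "cube_edge C n A i I \<in> Arr C" "Dom C (cube_edge C n A i I) = vertex C n A I"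
    "Cod C (cube_edge C n A i I) = vertex C n A (insert i I)" by (simp_all add: homset_iff)
qed

text \<open>An arrow of \<open>Arr_pow n C\<close> amounts to a natural transformation between
  cubes.\<close>

lemma component_natural:
  assumes "F \<in> Arr (Arr_pow n C)" "i < n" "i \<notin> I"
  shows "component n F (insert i I) \<odot> cube_edge C n (Dom (Arr_pow n C) F) i I =
    cube_edge C n (Cod (Arr_pow n C) F) i I \<odot> component n F I"
  using assms
proof (induction n arbitrary: F)
  case 0
  then show ?case by simp
next
  case (Suc n)
  then obtain f g a b where F: "F = Square f g a b"
    "f \<in> Arr (Arr_pow n C)" "g \<in> Arr (Arr_pow n C)" "a \<in> Arr (Arr_pow n C)" "b \<in> Arr (Arr_pow n C)"
    "Dom (Arr_pow n C) a = Dom (Arr_pow n C) f" "Cod (Arr_pow n C) a = Dom (Arr_pow n C) g"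
    "Dom (Arr_pow n C) b = Cod (Arr_pow n C) f" "Cod (Arr_pow n C) b = Cod (Arr_pow n C) g"
    "g \<odot>\<^bsub>Arr_pow n C\<^esub> a = b \<odot>\<^bsub>Arr_pow n C\<^esub> f"
    by (auto elim!: Arr_catE)
  show ?case
  proof (cases "i = n")
    case True
    then show ?thesis using F Suc.prems(3) component_Comp[of a n g I] component_Comp[of f n b I] by simp
  next
    case False
    then show ?thesis using F Suc.IH[of a] Suc.IH[of b] Suc.prems by auto
  qed
qed

end

text \<open>Evaluation at a vertex preserves pullbacks, since they are computed componentwise at
  each level of arrows.\<close>

lemma (in category_with_pullbacks) component_pullback:
  "pullback (Arr_pow n C) F G P Q \<Longrightarrow>
    pullback C (component n F I) (component n G I) (component n P I) (component n Q I)"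
proof (induction n arbitrary: F G P Q)
  case 0
  then show ?case using base_cat_pullbackD by simp
next
  case (Suc n)
  have pb: "category_with_pullbacks (Arr_pow n C)"
    by (rule pullbacks_Arr_pow) (rule category_with_pullbacks_axioms)
  show ?case
    using Suc.IH Arr_cat_pullbackD[OF pb, of F G P Q] Suc.prems by simp
qed

context category
begin

lemma compatible_insert_top:
  assumes "F \<in> Arr (Arr_pow n C)" "I \<subseteq> {..<n}" "J \<subseteq> {..<n}"
  shows "compatible C (cube_of C (Suc n) F) I (insert n J) T x \<longleftrightarrow>
    compatible C (cube_of C n (Dom (Arr_pow n C) F)) I J T x \<and>
    x n \<in> homset C T (vertex C n (Cod (Arr_pow n C) F) I) \<and>
    (\<forall>j\<in>J. component n F (insert j I) \<odot> x j = cube_edge C n (Cod (Arr_pow n C) F) j I \<odot> x n)"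
proof -
  have n: "n \<notin> I" "n \<notin> J" "\<And>j. j \<in> J \<Longrightarrow> j \<noteq> n" using assms by auto
  show ?thesis
    unfolding compatible_def using n by (auto; metis)
qed

text \<open>The cube is regarded as a morphism \<open>F\<close> of \<open>n\<close>-cubes. A lifting
  problem involving direction \<open>n\<close> consists of one for the source cube together with an
  element \<open>y\<close> of the target vertex \<open>I\<close> lying under it; a solution must map
  to \<open>y\<close>.\<close>

lemma lifting_insert_top:
  assumes "F \<in> Arr (Arr_pow n C)" "I \<subseteq> {..<n}" "J \<subseteq> {..<n}"
  shows "lifting C (cube_of C (Suc n) F) I (insert n J) \<longleftrightarrow>
    (\<forall>T\<in>Obj C. \<forall>x y. compatible C (cube_of C n (Dom (Arr_pow n C) F)) I J T x \<longrightarrow>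
       y \<in> homset C T (vertex C n (Cod (Arr_pow n C) F) I) \<longrightarrow>
       (\<forall>j\<in>J. component n F (insert j I) \<odot> x j = cube_edge C n (Cod (Arr_pow n C) F) j I \<odot> y) \<longrightarrow>
       (\<exists>e z. regular_epi C e \<and> Cod C e = T \<and> z \<in> homset C (Dom C e) (vertex C n (Dom (Arr_pow n C) F) I) \<and>
          (\<forall>j\<in>J. cube_edge C n (Dom (Arr_pow n C) F) j I \<odot> z = x j \<odot> e) \<and>
          component n F I \<odot> z = y \<odot> e))"
    (is "?L \<longleftrightarrow> (\<forall>T\<in>Obj C. \<forall>x y. ?compat T x \<longrightarrow> ?y T y \<longrightarrow> ?xy x y \<longrightarrow> ?lift T x y)" is "_ \<longleftrightarrow> ?R")
proof -
  have n: "n \<notin> I" "n \<notin> J" "\<And>j. j \<in> J \<Longrightarrow> j \<noteq> n" using assms by auto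
  note ci = compatible_insert_top[OF assms]
  show ?thesis
  proof
    assume L: ?L
    show ?R
    proof (intro ballI allI impI)
      fix T x y assume T: "T \<in> Obj C" and *: "?compat T x" "?y T y" "?xy x y"
      have "compatible C (cube_of C (Suc n) F) I (insert n J) T (x(n := y))"
        unfolding ci using * n by (simp add: compatible_def)
      then obtain e z where "regular_epi C e" "Cod C e = T" "z \<in> homset C (Dom C e) (vertex C (Suc n) F I)"
        "\<forall>j\<in>insert n J. cube_edge C (Suc n) F j I \<odot> z = (x(n := y)) j \<odot> e"
        using L T unfolding lifting_def cube_of_simps by blast
      then show "?lift T x y"
        using n by (intro exI[of _ e] exI[of _ z]) auto
    qed
  next
    assume R: ?R
    show ?L
      unfolding lifting_def
    proof (intro ballI allI impI)
      fix T x assume T: "T \<in> Obj C" and "compatible C (cube_of C (Suc n) F) I (insert n J) T x"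
      then obtain e z where "regular_epi C e" "Cod C e = T"
        "z \<in> homset C (Dom C e) (vertex C n (Dom (Arr_pow n C) F) I)"
        "\<forall>j\<in>J. cube_edge C n (Dom (Arr_pow n C) F) j I \<odot> z = x j \<odot> e" "component n F I \<odot> z = x n \<odot> e"
        using R unfolding ci by blast
      then show "\<exists>e z. regular_epi C e \<and> Cod C e = T \<and> z \<in> homset C (Dom C e) (cvert (cube_of C (Suc n) F) I) \<and>
          (\<forall>j\<in>insert n J. cedge (cube_of C (Suc n) F) j I \<odot> z = x j \<odot> e)"
        using n by (intro exI[of _ e] exI[of _ z]) auto
    qed
  qed
qed

text \<open>The index \<open>n\<close> lies in neither set, in \<open>I\<close>, or in
  \<open>J\<close>. For lifting problems, these cases are the source face, the target face, and the
  problems across direction \<open>n\<close>.\<close>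

lemma disjoint_subsets_Suc:
  "(\<forall>I J. I \<subseteq> {..<Suc n} \<longrightarrow> J \<subseteq> {..<Suc n} \<longrightarrow> I \<inter> J = {} \<longrightarrow> P I J) \<longleftrightarrow>
   (\<forall>I J. I \<subseteq> {..<n} \<longrightarrow> J \<subseteq> {..<n} \<longrightarrow> I \<inter> J = {} \<longrightarrow>
      P I J \<and> P (insert n I) J \<and> P I (insert n J))" (is "?l \<longleftrightarrow> ?r")
proof
  assume l: ?l
  show ?r
  proof (intro allI impI)
    fix I J assume *: "I \<subseteq> {..<n}" "J \<subseteq> {..<n}" "I \<inter> J = {}"
    then have "I \<subseteq> {..<Suc n}" "J \<subseteq> {..<Suc n}" "insert n I \<subseteq> {..<Suc n}" "insert n J \<subseteq> {..<Suc n}"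
      "insert n I \<inter> J = {}" "I \<inter> insert n J = {}" by auto
    then show "P I J \<and> P (insert n I) J \<and> P I (insert n J)"
      using l *(3) by blast
  qed
next
  assume r: ?r
  show ?l
  proof (intro allI impI)
    fix I J assume *: "I \<subseteq> {..<Suc n}" "J \<subseteq> {..<Suc n}" "I \<inter> J = {}"
    then have "I - {n} \<subseteq> {..<n}" "J - {n} \<subseteq> {..<n}" "(I - {n}) \<inter> (J - {n}) = {}" by auto
    then have "P (I - {n}) (J - {n})" "P (insert n (I - {n})) (J - {n})" "P (I - {n}) (insert n (J - {n}))"
      using r by blast+
    then show "P I J"
      using *(3) by (cases "n \<in> I"; cases "n \<in> J") (auto simp: insert_absorb)
  qed
qed

text \<open>In the last clause \<open>J\<close> may be empty, since \<open>insert n J\<close> is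
  not.\<close>

lemma all_lifting_Suc:
  "all_lifting C (Suc n) (cube_of C (Suc n) F) \<longleftrightarrow>
    all_lifting C n (cube_of C n (Dom (Arr_pow n C) F)) \<and>
    all_lifting C n (cube_of C n (Cod (Arr_pow n C) F)) \<and>
    (\<forall>I J. I \<subseteq> {..<n} \<longrightarrow> J \<subseteq> {..<n} \<longrightarrow> I \<inter> J = {} \<longrightarrow> lifting C (cube_of C (Suc n) F) I (insert n J))"
proof -
  have dom: "lifting C (cube_of C (Suc n) F) I J \<longleftrightarrow> lifting C (cube_of C n (Dom (Arr_pow n C) F)) I J"
    and cod: "lifting C (cube_of C (Suc n) F) (insert n I) J \<longleftrightarrow> lifting C (cube_of C n (Cod (Arr_pow n C) F)) I J"
    if "I \<subseteq> {..<n}" "J \<subseteq> {..<n}" for I J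
    using that by (intro lifting_cong; auto simp: insert_commute[of _ n])+
  show ?thesis
    unfolding all_lifting_def disjoint_subsets_Suc
    by (simp only: dom cod insert_not_empty not_False_eq_True simp_thms imp_conjR all_conj_distrib cong: imp_cong)
qed

end

context regular_category
begin

text \<open>The identity of the codomain is the generic element to lift; a lift of it after a cover
  \<open>e\<close> shows that \<open>e\<close> factors through \<open>f\<close>.\<close>

lemma lifting_Suc_0:
  assumes "f \<in> Arr C"
  shows "all_lifting C (Suc 0) (cube_of C (Suc 0) (Edge f)) \<longleftrightarrow> regular_epi C f"
proof -
  have "all_lifting C (Suc 0) (cube_of C (Suc 0) (Edge f)) \<longleftrightarrow>
    (\<forall>T\<in>Obj C. \<forall>y. y \<in> homset C T (Cod C f) \<longrightarrow>
       (\<exists>e z. regular_epi C e \<and> Cod C e = T \<and> z \<in> homset C (Dom C e) (Dom C f) \<and> f \<odot> z = y \<odot> e))"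
    (is "_ \<longleftrightarrow> ?lifts")
    using lifting_insert_top[of "Edge f" 0 "{}" "{}"] assms
    by (simp add: all_lifting_Suc compatible_def) (simp add: all_lifting_def)
  also have "\<dots> \<longleftrightarrow> regular_epi C f"
  proof
    assume *: ?lifts
    obtain e z where "regular_epi C e" "Cod C e = Cod C f" "z \<in> homset C (Dom C e) (Dom C f)"
      "f \<odot> z = Ident C (Cod C f) \<odot> e"
      using *[rule_format, of "Cod C f" "Ident C (Cod C f)"] assms by (auto simp: homset_iff)
    then show "regular_epi C f"
      using assms by (intro regular_epi_right_factor[of e f z]) (auto simp: homset_iff)
  next
    assume "regular_epi C f"
    then show ?lifts
      by (metis homset_iff regular_epi_pullback)
  qed
  finally show ?thesis .
qed

end

section \<open>The comparison from a square to its pullback\<close>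

locale comparison_square = regular_category C for C :: "('o, 'm) cat" (structure) +
  fixes n :: nat and f g a b p q c :: "('o, 'm) narr"
  assumes square: "Square f g a b \<in> Arr (Arr_pow (Suc n) C)"
    and pb: "pullback (Arr_pow n C) g b p q"
    and c: "c \<in> homset (Arr_pow n C) (Dom (Arr_pow n C) f) (Dom (Arr_pow n C) p)"
      "p \<odot>\<^bsub>Arr_pow n C\<^esub> c = a" "q \<odot>\<^bsub>Arr_pow n C\<^esub> c = f"
begin

abbreviation "N \<equiv> Arr_pow n C"
abbreviation "cmp \<equiv> component n"
abbreviation "edg \<equiv> cube_edge C n"
abbreviation "vtx \<equiv> vertex C n"

sublocale N: category N
  by (rule category_Arr_pow) (rule category_axioms)

lemma square_simps [simp]:
  "f \<in> Arr N" "g \<in> Arr N" "a \<in> Arr N" "b \<in> Arr N" "Dom N a = Dom N f" "Cod N a = Dom N g"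
  "Dom N b = Cod N f" "Cod N b = Cod N g" "p \<in> Arr N" "q \<in> Arr N" "Dom N q = Dom N p"
  "Cod N p = Dom N g" "Cod N q = Cod N f" "c \<in> Arr N" "Dom N c = Dom N f" "Cod N c = Dom N p"
  using square N.pullbackD[OF pb] c by (auto simp: homset_iff)

lemma c_eq: "cmp p I \<odot> cmp c I = cmp a I" "cmp q I \<odot> cmp c I = cmp f I"
  using c component_Comp[of c n p I] component_Comp[of c n q I] by simp_all

lemmas cmp_pb = component_pullback[OF pb]
lemmas [simp] = component_Arr

text \<open>An element of the pullback corner is a pair of elements, one of the source of
  \<open>g\<close> and one of the target of \<open>f\<close>, that agree in the target of
  \<open>g\<close>. These are the data that the directions \<open>Suc n\<close> and \<open>n\<close>
  of the square add to a family indexed by \<open>J\<close>, so both sides pose the same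
  problem.\<close>

lemma lifting_comparison:
  assumes "I \<subseteq> {..<n}" "J \<subseteq> {..<n}" "I \<inter> J = {}"
  shows "lifting C (cube_of C (Suc n) c) I (insert n J) \<longleftrightarrow>
    lifting C (cube_of C (Suc (Suc n)) (Square f g a b)) I (insert (Suc n) (insert n J))"
proof -
  let ?sq = "Square f g a b"
  have n: "n \<notin> I" "n \<notin> J" "\<And>j. j \<in> J \<Longrightarrow> j \<noteq> n" using assms by auto
  have sub: "I \<subseteq> {..<Suc n}" "insert n J \<subseteq> {..<Suc n}" using assms by auto
  have j: "j < n" "j \<notin> I" if "j \<in> J" for j using that assms by auto
  note edge = cube_edge_Arr[of _ n]
  have sq: "lifting C (cube_of C (Suc (Suc n)) ?sq) I (insert (Suc n) (insert n J)) \<longleftrightarrow>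
    (\<forall>T\<in>Obj C. \<forall>x w. compatible C (cube_of C n (Dom N f)) I J T x \<longrightarrow>
       x n \<in> homset C T (vtx (Cod N f) I) \<longrightarrow>
       (\<forall>j\<in>J. cmp f (insert j I) \<odot> x j = edg (Cod N f) j I \<odot> x n) \<longrightarrow>
       w \<in> homset C T (vtx (Dom N g) I) \<longrightarrow>
       (\<forall>j\<in>J. cmp a (insert j I) \<odot> x j = edg (Dom N g) j I \<odot> w) \<longrightarrow> cmp b I \<odot> x n = cmp g I \<odot> w \<longrightarrow>
       (\<exists>e z. regular_epi C e \<and> Cod C e = T \<and> z \<in> homset C (Dom C e) (vtx (Dom N f) I) \<and>
          (\<forall>j\<in>J. edg (Dom N f) j I \<odot> z = x j \<odot> e) \<and> cmp f I \<odot> z = x n \<odot> e \<and> cmp a I \<odot> z = w \<odot> e))"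
    (is "_ \<longleftrightarrow> (\<forall>T\<in>Obj C. \<forall>x w. _ x T \<longrightarrow> _ x T \<longrightarrow> _ x \<longrightarrow> _ w T \<longrightarrow> _ x w \<longrightarrow> _ x w \<longrightarrow> ?lift T x w)")
    unfolding lifting_insert_top[OF square sub] using n
    by (simp add: compatible_insert_top[OF _ assms(1,2)]) (smt (verit))
  have x_hom: "x j \<in> Arr C" "Dom C (x j) = T" "Cod C (x j) = vtx (Dom N f) (insert j I)"
    if "compatible C (cube_of C n (Dom N f)) I J T x" "j \<in> J" for x j T
    using that by (auto simp: compatible_def homset_iff)
  note comp = lifting_insert_top[OF square_simps(14) assms(1,2), unfolded square_simps]
  show ?thesis
  proof (intro iffI)
    assume "lifting C (cube_of C (Suc n) c) I (insert n J)"
    note L = this[unfolded comp]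
    show "lifting C (cube_of C (Suc (Suc n)) ?sq) I (insert (Suc n) (insert n J))"
      unfolding sq
    proof (intro ballI allI impI)
    fix T x w
    assume T: "T \<in> Obj C" and x: "compatible C (cube_of C n (Dom N f)) I J T x"
      and y: "x n \<in> homset C T (vtx (Cod N f) I)" "\<forall>j\<in>J. cmp f (insert j I) \<odot> x j = edg (Cod N f) j I \<odot> x n"
      and w: "w \<in> homset C T (vtx (Dom N g) I)" "\<forall>j\<in>J. cmp a (insert j I) \<odot> x j = edg (Dom N g) j I \<odot> w"
      and yw: "cmp b I \<odot> x n = cmp g I \<odot> w"
    \<comment> \<open>\<open>v\<close> pairs the given elements \<open>w\<close> and
      \<open>x n\<close> into an element of the pullback corner.\<close>
    obtain v where v: "v \<in> Arr C" "Dom C v = Dom C w" "Cod C v = Dom C (cmp p I)" "cmp p I \<odot> v = w" "cmp q I \<odot> v = x n"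
      by (rule pullback_fill[OF cmp_pb _ _ _ _ _ yw[symmetric]]) (use w y in \<open>auto simp: homset_iff\<close>)
    have "cmp c (insert j I) \<odot> x j = edg (Dom N p) j I \<odot> v" if "j \<in> J" for j
    proof (rule pullback_cancel[OF cmp_pb[of "insert j I"]])
      note jj = j[OF that] and xj = x_hom[OF x that]
      show "cmp p (insert j I) \<odot> (cmp c (insert j I) \<odot> x j) = cmp p (insert j I) \<odot> (edg (Dom N p) j I \<odot> v)"
        using component_natural[of p n j I] Comp_extend1[OF c_eq(1), of "insert j I" "x j"] w(2) that v jj xj
          Comp_extend[OF component_natural[of p n j I], of v] by (simp add: edge)
      show "cmp q (insert j I) \<odot> (cmp c (insert j I) \<odot> x j) = cmp q (insert j I) \<odot> (edg (Dom N p) j I \<odot> v)"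
        using component_natural[of q n j I] Comp_extend1[OF c_eq(2), of "insert j I" "x j"] y(2) that v jj xj
          Comp_extend[OF component_natural[of q n j I], of v] by (simp add: edge)
    qed (use v w that j x_hom[OF x that] in \<open>auto simp: edge homset_iff\<close>)
    moreover have "v \<in> homset C T (vtx (Dom N p) I)" using v w by (simp add: homset_iff)
    ultimately obtain e z where ez: "regular_epi C e" "Cod C e = T" "z \<in> homset C (Dom C e) (vtx (Dom N f) I)"
      "\<forall>j\<in>J. edg (Dom N f) j I \<odot> z = x j \<odot> e" "cmp c I \<odot> z = v \<odot> e"
      using L T x by blast
    have "cmp f I \<odot> z = x n \<odot> e" "cmp a I \<odot> z = w \<odot> e"
      using ez v w Comp_extend[OF ez(5), of e] Comp_extend1[OF c_eq(1), of I z] Comp_extend1[OF c_eq(2), of I z]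
        Comp_extend1[OF v(4), of e] Comp_extend1[OF v(5), of e] by (simp_all add: homset_iff)
    then show "?lift T x w"
      using ez by blast
    qed
  next
    assume "lifting C (cube_of C (Suc (Suc n)) ?sq) I (insert (Suc n) (insert n J))"
    note R = this[unfolded sq]
    show "lifting C (cube_of C (Suc n) c) I (insert n J)"
      unfolding comp
    proof (intro ballI allI impI)
    fix T x v
    assume T: "T \<in> Obj C" and x: "compatible C (cube_of C n (Dom N f)) I J T x"
      and v: "v \<in> homset C T (vtx (Dom N p) I)" "\<forall>j\<in>J. cmp c (insert j I) \<odot> x j = edg (Dom N p) j I \<odot> v"
    let ?y = "cmp q I \<odot> v" and ?w = "cmp p I \<odot> v"
    have v': "v \<in> Arr C" "Dom C v = T" "Cod C v = vtx (Dom N p) I" using v by (auto simp: homset_iff)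
    \<comment> \<open>Slot \<open>n\<close> is free because \<open>n \<notin> J\<close>; it receives
      the component of \<open>v\<close> in the target of \<open>f\<close>.\<close>
    have "compatible C (cube_of C n (Dom N f)) I J T (x(n := ?y))"
      using x n(2,3) by (auto simp: compatible_def)
    moreover have "cmp f (insert j I) \<odot> x j = edg (Cod N f) j I \<odot> ?y"
      "cmp a (insert j I) \<odot> x j = edg (Dom N g) j I \<odot> ?w" if "j \<in> J" for j
    proof -
      note jj = j[OF that] and xj = x_hom[OF x that]
      show "cmp f (insert j I) \<odot> x j = edg (Cod N f) j I \<odot> ?y"
        using Comp_extend[OF component_natural[of q n j I], of v] Comp_extend1[OF c_eq(2), of "insert j I" "x j"]
          v(2) that v' jj xj by (simp add: edge)
      show "cmp a (insert j I) \<odot> x j = edg (Dom N g) j I \<odot> ?w"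
        using Comp_extend[OF component_natural[of p n j I], of v] Comp_extend1[OF c_eq(1), of "insert j I" "x j"]
          v(2) that v' jj xj by (simp add: edge)
    qed
    moreover have "cmp b I \<odot> ?y = cmp g I \<odot> ?w"
      using Comp_extend[OF pullbackD(9)[OF cmp_pb[of I]], of v] v' by simp
    moreover have "?y \<in> homset C T (vtx (Cod N f) I)" "?w \<in> homset C T (vtx (Dom N g) I)"
      using v' by (simp_all add: homset_iff)
    ultimately have "?lift T (x(n := ?y)) ?w"
      using R[rule_format, OF T, of "x(n := ?y)" ?w] n(3) by simp
    then obtain e z where ez: "regular_epi C e" "Cod C e = T" "z \<in> homset C (Dom C e) (vtx (Dom N f) I)"
      "\<forall>j\<in>J. edg (Dom N f) j I \<odot> z = x j \<odot> e" "cmp f I \<odot> z = ?y \<odot> e" "cmp a I \<odot> z = ?w \<odot> e"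
      using n(3) by auto
    have "cmp c I \<odot> z = v \<odot> e"
      by (rule pullback_cancel[OF cmp_pb[of I]])
         (use ez v' Comp_extend1[OF c_eq(1), of I z] Comp_extend1[OF c_eq(2), of I z] in \<open>auto simp: homset_iff\<close>)
    then show "\<exists>e z. regular_epi C e \<and> Cod C e = T \<and> z \<in> homset C (Dom C e) (vtx (Dom N f) I) \<and>
          (\<forall>j\<in>J. edg (Dom N f) j I \<odot> z = x j \<odot> e) \<and> cmp c I \<odot> z = v \<odot> e"
      using ez by blast
    qed
  qed
qed

lemma compatible_Comp:
  assumes "F \<in> Arr N" "compatible C (cube_of C n (Dom N F)) I J T x" "J \<subseteq> {..<n}" "I \<inter> J = {}"
  shows "compatible C (cube_of C n (Cod N F)) I J T (\<lambda>j. cmp F (insert j I) \<odot> x j)"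
  unfolding compatible_def
proof (intro conjI ballI impI)
  fix j assume "j \<in> J"
  then show "cmp F (insert j I) \<odot> x j \<in> homset C T (cvert (cube_of C n (Cod N F)) (insert j I))"
    using assms by (auto simp: compatible_def homset_iff)
next
  fix j k assume jk: "j \<in> J" "k \<in> J" "j \<noteq> k"
  have x: "x j \<in> Arr C" "Dom C (x j) = T" "Cod C (x j) = vtx (Dom N F) (insert j I)" if "j \<in> J" for j
    using assms(2) that by (auto simp: compatible_def homset_iff)
  have lt: "j < n" "k < n" "j \<notin> I" "k \<notin> I" using jk assms by auto
  have eq: "edg (Dom N F) k (insert j I) \<odot> x j = edg (Dom N F) j (insert k I) \<odot> x k"
    using assms(2) jk by (simp add: compatible_def)
  have "edg (Cod N F) k (insert j I) \<odot> (cmp F (insert j I) \<odot> x j) =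
      cmp F (insert k (insert j I)) \<odot> (edg (Dom N F) k (insert j I) \<odot> x j)"
    using Comp_extend[OF component_natural[of F n k "insert j I"], of "x j"] assms(1) lt jk x
    by (simp add: cube_edge_Arr)
  also have "\<dots> = cmp F (insert j (insert k I)) \<odot> (edg (Dom N F) j (insert k I) \<odot> x k)"
    unfolding eq by (simp add: insert_commute)
  also have "\<dots> = edg (Cod N F) j (insert k I) \<odot> (cmp F (insert k I) \<odot> x k)"
    using Comp_extend[OF component_natural[of F n j "insert k I"], of "x k"] assms(1) lt jk x
    by (simp add: cube_edge_Arr)
  finally show "cedge (cube_of C n (Cod N F)) k (insert j I) \<odot> (cmp F (insert j I) \<odot> x j) =
    cedge (cube_of C n (Cod N F)) j (insert k I) \<odot> (cmp F (insert k I) \<odot> x k)" by simp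
qed

lemma compatible_precomp:
  assumes "compatible C (cube_of C n A) I J T x" "A \<in> Obj N" "J \<subseteq> {..<n}" "I \<inter> J = {}"
    and e: "e \<in> Arr C" "Cod C e = T"
  shows "compatible C (cube_of C n A) I J (Dom C e) (\<lambda>j. x j \<odot> e)"
  unfolding compatible_def
proof (intro conjI ballI impI)
  fix j assume "j \<in> J"
  then show "x j \<odot> e \<in> homset C (Dom C e) (cvert (cube_of C n A) (insert j I))"
    using assms by (auto simp: compatible_def homset_iff)
next
  fix j k assume jk: "j \<in> J" "k \<in> J" "j \<noteq> k"
  have x: "x j \<in> Arr C" "Dom C (x j) = T" "Cod C (x j) = vtx A (insert j I)" if "j \<in> J" for j
    using assms(1) that by (auto simp: compatible_def homset_iff)
  have lt: "j < n" "k < n" "j \<notin> I" "k \<notin> I" using jk assms by auto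
  have eq: "edg A k (insert j I) \<odot> x j = edg A j (insert k I) \<odot> x k"
    using assms(1) jk by (simp add: compatible_def)
  show "cedge (cube_of C n A) k (insert j I) \<odot> (x j \<odot> e) = cedge (cube_of C n A) j (insert k I) \<odot> (x k \<odot> e)"
    using Comp_extend[OF eq, of e] x lt jk assms(2) e by (simp add: cube_edge_Arr)
qed

text \<open>The target of the comparison is the cube of pullback corners, which is not a face of the
  square. An element of it is found in two stages: a lift \<open>y\<close> in the target of
  \<open>f\<close>, then a lift \<open>w\<close> along \<open>g\<close> of the image of
  \<open>y\<close> under \<open>b\<close>.\<close>

lemma all_lifting_pullback:
  assumes B: "all_lifting C n (cube_of C n (Cod N f))"
    and g: "\<And>I J. I \<subseteq> {..<n} \<Longrightarrow> J \<subseteq> {..<n} \<Longrightarrow> I \<inter> J = {} \<Longrightarrow>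
      lifting C (cube_of C (Suc n) g) I (insert n J)"
  shows "all_lifting C n (cube_of C n (Dom N p))"
  unfolding all_lifting_def lifting_def cube_of_simps
proof (intro allI impI ballI)
  fix I J T x assume IJ: "I \<subseteq> {..<n}" "J \<subseteq> {..<n}" "I \<inter> J = {}" "J \<noteq> {}"
    and T: "T \<in> Obj C" and x: "compatible C (cube_of C n (Dom N p)) I J T x"
  have j: "j < n" "j \<notin> I" if "j \<in> J" for j using that IJ by auto
  have x_hom: "x j \<in> Arr C" "Dom C (x j) = T" "Cod C (x j) = vtx (Dom N p) (insert j I)"
    if "j \<in> J" for j using x that by (auto simp: compatible_def homset_iff)
  have "compatible C (cube_of C n (Cod N f)) I J T (\<lambda>j. cmp q (insert j I) \<odot> x j)"
    using compatible_Comp[of q I J T x] x IJ by simp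
  moreover have "lifting C (cube_of C n (Cod N f)) I J"
    using B IJ by (simp add: all_lifting_def)
  ultimately obtain e y where ey: "regular_epi C e" "Cod C e = T" "y \<in> homset C (Dom C e) (vtx (Cod N f) I)"
    "\<forall>j\<in>J. edg (Cod N f) j I \<odot> y = (cmp q (insert j I) \<odot> x j) \<odot> e"
    using T unfolding lifting_def cube_of_simps by blast
  have e: "e \<in> Arr C" using ey by simp
  have y: "y \<in> Arr C" "Dom C y = Dom C e" "Cod C y = vtx (Cod N f) I" using ey by (auto simp: homset_iff)
  have px: "compatible C (cube_of C n (Dom N g)) I J T (\<lambda>j. cmp p (insert j I) \<odot> x j)"
    using compatible_Comp[of p I J T x] x IJ by simp
  have "compatible C (cube_of C n (Dom N g)) I J (Dom C e) (\<lambda>j. (cmp p (insert j I) \<odot> x j) \<odot> e)"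
    using px IJ ey e by (intro compatible_precomp) auto
  moreover have "cmp b I \<odot> y \<in> homset C (Dom C e) (vtx (Cod N g) I)" using y by (simp add: homset_iff)
  moreover have "cmp g (insert j I) \<odot> ((cmp p (insert j I) \<odot> x j) \<odot> e) = edg (Cod N g) j I \<odot> (cmp b I \<odot> y)"
    if "j \<in> J" for j
  proof -
    note jj = j[OF that] and xj = x_hom[OF that]
    have "edg (Cod N g) j I \<odot> (cmp b I \<odot> y) = cmp b (insert j I) \<odot> (edg (Cod N f) j I \<odot> y)"
      using Comp_extend[OF component_natural[of b n j I], of y] jj y by (simp add: cube_edge_Arr)
    also have "\<dots> = cmp b (insert j I) \<odot> (cmp q (insert j I) \<odot> (x j \<odot> e))"
      using ey(4) that xj e ey(2) by simp
    also have "\<dots> = cmp g (insert j I) \<odot> (cmp p (insert j I) \<odot> (x j \<odot> e))"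
      using Comp_extend[OF pullbackD(9)[OF cmp_pb[of "insert j I"]], of "x j \<odot> e"] xj e ey(2) by simp
    finally show ?thesis using xj e ey(2) by simp
  qed
  moreover have "Dom C e \<in> Obj C" using e by simp
  ultimately obtain e' w where ew: "regular_epi C e'" "Cod C e' = Dom C e" "w \<in> homset C (Dom C e') (vtx (Dom N g) I)"
    "\<forall>j\<in>J. edg (Dom N g) j I \<odot> w = ((cmp p (insert j I) \<odot> x j) \<odot> e) \<odot> e'" "cmp g I \<odot> w = (cmp b I \<odot> y) \<odot> e'"
    using g[OF IJ(1-3)] unfolding lifting_insert_top[OF square_simps(2) IJ(1,2)] by blast
  have e': "e' \<in> Arr C" using ew by simp
  have w: "w \<in> Arr C" "Dom C w = Dom C e'" "Cod C w = vtx (Dom N g) I" using ew by (auto simp: homset_iff)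
  have gw: "cmp g I \<odot> w = cmp b I \<odot> (y \<odot> e')" using ew y e' by simp
  \<comment> \<open>The two lifts agree in the target of \<open>g\<close> over the second cover, so
    they pair to an element of the pullback corner.\<close>
  obtain v where v: "v \<in> Arr C" "Dom C v = Dom C w" "Cod C v = Dom C (cmp p I)" "cmp p I \<odot> v = w" "cmp q I \<odot> v = y \<odot> e'"
    by (rule pullback_fill[OF cmp_pb _ _ _ _ _ gw]) (use w y e' ew in auto)
  have "edg (Dom N p) j I \<odot> v = x j \<odot> (e \<odot> e')" if "j \<in> J" for j
  proof (rule pullback_cancel[OF cmp_pb[of "insert j I"]])
    note jj = j[OF that] and xj = x_hom[OF that]
    show "cmp p (insert j I) \<odot> (edg (Dom N p) j I \<odot> v) = cmp p (insert j I) \<odot> (x j \<odot> (e \<odot> e'))"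
      using Comp_extend[OF component_natural[of p n j I], of v] jj xj v e e' ew(2,4) ey(2) that w
      by (simp add: cube_edge_Arr)
    have "edg (Cod N f) j I \<odot> (y \<odot> e') = (cmp q (insert j I) \<odot> (x j \<odot> e)) \<odot> e'"
      using Comp_extend1[OF ey(4)[rule_format, OF that], of e'] jj xj e e' ew(2) ey(2) y
      by (simp add: cube_edge_Arr)
    then show "cmp q (insert j I) \<odot> (edg (Dom N p) j I \<odot> v) = cmp q (insert j I) \<odot> (x j \<odot> (e \<odot> e'))"
      using Comp_extend[OF component_natural[of q n j I], of v] jj xj v e e' ew(2) ey(2) that
      by (simp add: cube_edge_Arr)
  qed (use v w e e' ew(2) ey(2) x_hom[OF that] j[OF that] in \<open>auto simp: cube_edge_Arr\<close>)
  moreover have "regular_epi C (e \<odot> e')" using ey(1) ew(1,2) by (intro regular_epi_Comp) auto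
  ultimately show "\<exists>e z. regular_epi C e \<and> Cod C e = T \<and> z \<in> homset C (Dom C e) (vtx (Dom N p) I) \<and>
      (\<forall>j\<in>J. edg (Dom N p) j I \<odot> z = x j \<odot> e)"
    using v w e e' ew(2) ey(2) by (intro exI[of _ "e \<odot> e'"] exI[of _ v]) (simp add: homset_iff)
qed

end

context regular_category
begin

text \<open>\<open>a\<close> and \<open>b\<close> are the opposite faces of the square in direction
  \<open>n\<close>. A problem that does not use direction \<open>n\<close> stays within one of
  them.\<close>

lemma lifting_side_dom:
  assumes "Square f g a b \<in> Arr (Arr_pow (Suc n) C)" "I \<subseteq> {..<n}" "J \<subseteq> {..<n}"
  shows "lifting C (cube_of C (Suc (Suc n)) (Square f g a b)) I (insert (Suc n) J) \<longleftrightarrow>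
    lifting C (cube_of C (Suc n) a) I (insert n J)"
proof -
  have n: "n \<notin> I" "n \<notin> J" "\<And>j. j \<in> J \<Longrightarrow> j \<noteq> n" "\<And>j. j \<in> J \<Longrightarrow> n \<noteq> j" using assms by auto
  have sub: "I \<subseteq> {..<Suc n}" "J \<subseteq> {..<Suc n}" using assms by auto
  have a: "a \<in> Arr (Arr_pow n C)" "Dom (Arr_pow n C) a = Dom (Arr_pow n C) f"
    "Cod (Arr_pow n C) a = Dom (Arr_pow n C) g" using assms(1) by auto
  have "compatible C (cube_of C (Suc n) f) I J T x \<longleftrightarrow>
      compatible C (cube_of C n (Dom (Arr_pow n C) f)) I J T x" for T x
    using n by (intro compatible_cong) auto
  then show ?thesis
    unfolding lifting_insert_top[OF assms(1) sub] lifting_insert_top[OF a(1) assms(2,3)]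
    using n a by (simp cong: ball_cong)
qed

lemma lifting_side_cod:
  assumes "Square f g a b \<in> Arr (Arr_pow (Suc n) C)" "I \<subseteq> {..<n}" "J \<subseteq> {..<n}"
  shows "lifting C (cube_of C (Suc (Suc n)) (Square f g a b)) (insert n I) (insert (Suc n) J) \<longleftrightarrow>
    lifting C (cube_of C (Suc n) b) I (insert n J)"
proof -
  have n: "n \<notin> I" "n \<notin> J" "\<And>j. j \<in> J \<Longrightarrow> j \<noteq> n" "\<And>j. j \<in> J \<Longrightarrow> n \<noteq> j" using assms by auto
  have sub: "insert n I \<subseteq> {..<Suc n}" "J \<subseteq> {..<Suc n}" using assms by auto
  have b: "b \<in> Arr (Arr_pow n C)" "Dom (Arr_pow n C) b = Cod (Arr_pow n C) f"
    "Cod (Arr_pow n C) b = Cod (Arr_pow n C) g" using assms(1) by auto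
  have "compatible C (cube_of C (Suc n) f) (insert n I) J T x \<longleftrightarrow>
      compatible C (cube_of C n (Cod (Arr_pow n C) f)) I J T x" for T x
    using n by (intro compatible_cong) (auto simp: insert_commute[of _ n])
  then show ?thesis
    unfolding lifting_insert_top[OF assms(1) sub] lifting_insert_top[OF b(1) assms(2,3)]
    using n b by (simp add: insert_commute[of _ n] cong: ball_cong)
qed

text \<open>Problems that use at most one of the directions \<open>n\<close> and
  \<open>Suc n\<close> live in one of the four sides; what remains are the problems using
  both.\<close>

lemma all_lifting_Square:
  assumes "Square f g a b \<in> Arr (Arr_pow (Suc n) C)"
  shows "all_lifting C (Suc (Suc n)) (cube_of C (Suc (Suc n)) (Square f g a b)) \<longleftrightarrow>
    all_lifting C (Suc n) (cube_of C (Suc n) f) \<and> all_lifting C (Suc n) (cube_of C (Suc n) g) \<and>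
    all_lifting C (Suc n) (cube_of C (Suc n) a) \<and> all_lifting C (Suc n) (cube_of C (Suc n) b) \<and>
    (\<forall>I J. I \<subseteq> {..<n} \<longrightarrow> J \<subseteq> {..<n} \<longrightarrow> I \<inter> J = {} \<longrightarrow>
      lifting C (cube_of C (Suc (Suc n)) (Square f g a b)) I (insert (Suc n) (insert n J)))"
proof -
  have ab: "Dom (Arr_pow n C) a = Dom (Arr_pow n C) f" "Cod (Arr_pow n C) a = Dom (Arr_pow n C) g"
    "Dom (Arr_pow n C) b = Cod (Arr_pow n C) f" "Cod (Arr_pow n C) b = Cod (Arr_pow n C) g"
    using assms by auto
  show ?thesis
    unfolding all_lifting_Suc[of "Suc n"] disjoint_subsets_Suc[of n]
    using lifting_side_dom[OF assms] lifting_side_cod[OF assms]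
    by (simp add: all_lifting_Suc ab) (smt (verit, ccfv_threshold))
qed

text \<open>By \<open>lifting_comparison\<close>, the condition on the comparison \<open>c\<close>
  is the part of the lifting property that uses both outer directions. It therefore does not depend
  on the chosen pullback, and the quantifier over \<open>p\<close>, \<open>q\<close> and
  \<open>c\<close> can be removed.\<close>

theorem cubic_extension_iff_all_lifting:
  assumes "F \<in> Obj (Arr_pow (Suc n) C)"
  shows "cubic_extension C (Suc n) F \<longleftrightarrow> all_lifting C (Suc n) (cube_of C (Suc n) F)"
  using assms
proof (induction n arbitrary: F)
  case 0
  then obtain f where "F = Edge f" "f \<in> Arr C" by auto
  then show ?case using lifting_Suc_0 by auto
next
  case (Suc n)
  interpret N: category_with_pullbacks "Arr_pow n C"
    by (rule pullbacks_Arr_pow) (rule category_with_pullbacks_axioms)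
  have F_Obj: "F \<in> Obj (Arr_pow (Suc (Suc n)) C)" by (rule Suc.prems)
  have F_Arr: "F \<in> Arr (Arr_pow (Suc n) C)" using Suc.prems by simp
  then obtain f g a b where F: "F = Square f g a b"
    "f \<in> Arr (Arr_pow n C)" "g \<in> Arr (Arr_pow n C)" "a \<in> Arr (Arr_pow n C)" "b \<in> Arr (Arr_pow n C)"
    "Dom (Arr_pow n C) a = Dom (Arr_pow n C) f" "Cod (Arr_pow n C) a = Dom (Arr_pow n C) g"
    "Dom (Arr_pow n C) b = Cod (Arr_pow n C) f" "Cod (Arr_pow n C) b = Cod (Arr_pow n C) g"
    "g \<odot>\<^bsub>Arr_pow n C\<^esub> a = b \<odot>\<^bsub>Arr_pow n C\<^esub> f"
    by (auto elim!: Arr_catE)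
  note sq = F_Arr[unfolded F(1)]
  have IH: "cubic_extension C (Suc n) G \<longleftrightarrow> all_lifting C (Suc n) (cube_of C (Suc n) G)"
    if "G \<in> Arr (Arr_pow n C)" for G using Suc.IH that by simp
  let ?top = "\<forall>I J. I \<subseteq> {..<n} \<longrightarrow> J \<subseteq> {..<n} \<longrightarrow> I \<inter> J = {} \<longrightarrow>
      lifting C (cube_of C (Suc (Suc n)) (Square f g a b)) I (insert (Suc n) (insert n J))"
  have c: "cubic_extension C (Suc n) c \<longleftrightarrow> ?top"
    if pb: "pullback (Arr_pow n C) g b p q"
      and c: "c \<in> homset (Arr_pow n C) (Dom (Arr_pow n C) f) (Dom (Arr_pow n C) p)"
        "p \<odot>\<^bsub>Arr_pow n C\<^esub> c = a" "q \<odot>\<^bsub>Arr_pow n C\<^esub> c = f"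
      and f: "all_lifting C (Suc n) (cube_of C (Suc n) f)" and g: "all_lifting C (Suc n) (cube_of C (Suc n) g)"
    for p q c
  proof -
    interpret comparison_square C n f g a b p q c
      by unfold_locales (use sq pb c in simp_all)
    \<comment> \<open>This settles the target face of \<open>c\<close>; its source face is that of
      \<open>f\<close>.\<close>
    have "all_lifting C n (cube_of C n (Dom (Arr_pow n C) p))"
      using f g by (intro all_lifting_pullback) (auto simp: all_lifting_Suc)
    then show ?thesis
      using f lifting_comparison by (simp add: IH all_lifting_Suc)
  qed
  \<comment> \<open>The definition asks for some comparison, so the converse direction needs one to
    exist.\<close>
  have ex: "\<exists>p q c. pullback (Arr_pow n C) g b p q \<and>
      c \<in> homset (Arr_pow n C) (Dom (Arr_pow n C) f) (Dom (Arr_pow n C) p) \<and>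
      p \<odot>\<^bsub>Arr_pow n C\<^esub> c = a \<and> q \<odot>\<^bsub>Arr_pow n C\<^esub> c = f"
  proof -
    obtain p q where pb: "pullback (Arr_pow n C) g b p q" using N.pullbacks[of g b] F by auto
    obtain c where "c \<in> Arr (Arr_pow n C)" "Dom (Arr_pow n C) c = Dom (Arr_pow n C) a"
      "Cod (Arr_pow n C) c = Dom (Arr_pow n C) p" "p \<odot>\<^bsub>Arr_pow n C\<^esub> c = a" "q \<odot>\<^bsub>Arr_pow n C\<^esub> c = f"
      by (rule N.pullback_fill[OF pb _ _ _ _ _ F(10)]) (use F in auto)
    then show ?thesis using pb F(6) by (auto simp: homset_iff)
  qed
  let ?cmp = "\<lambda>p q c. pullback (Arr_pow n C) g b p q \<and>
      c \<in> homset (Arr_pow n C) (Dom (Arr_pow n C) f) (Dom (Arr_pow n C) p) \<and>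
      p \<odot>\<^bsub>Arr_pow n C\<^esub> c = a \<and> q \<odot>\<^bsub>Arr_pow n C\<^esub> c = f"
  have c': "(\<exists>p q c. ?cmp p q c \<and> cubic_extension C (Suc n) c) \<longleftrightarrow> ?top"
    if "all_lifting C (Suc n) (cube_of C (Suc n) f)" "all_lifting C (Suc n) (cube_of C (Suc n) g)"
  proof
    assume "\<exists>p q c. ?cmp p q c \<and> cubic_extension C (Suc n) c"
    then obtain p q c where *: "?cmp p q c" "cubic_extension C (Suc n) c" by (elim exE conjE) simp
    have "cubic_extension C (Suc n) c \<longleftrightarrow> ?top" using *(1) by (intro c[of p q c] that) simp_all
    with *(2) show ?top by simp
  next
    assume top: ?top
    obtain p q c where *: "?cmp p q c" using ex by (elim exE)
    have "cubic_extension C (Suc n) c \<longleftrightarrow> ?top" using * by (intro c[of p q c] that) simp_all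
    with top have "?cmp p q c \<and> cubic_extension C (Suc n) c" using * by simp
    then show "\<exists>p q c. ?cmp p q c \<and> cubic_extension C (Suc n) c" by (intro exI)
  qed
  have "cubic_extension C (Suc (Suc n)) F \<longleftrightarrow>
    cubic_extension C (Suc n) f \<and> cubic_extension C (Suc n) g \<and>
    cubic_extension C (Suc n) a \<and> cubic_extension C (Suc n) b \<and>
    (\<exists>p q c. ?cmp p q c \<and> cubic_extension C (Suc n) c)"
    using F_Obj unfolding cubic_extension.simps F(1) by simp
  also have "\<dots> \<longleftrightarrow> all_lifting C (Suc n) (cube_of C (Suc n) f) \<and> all_lifting C (Suc n) (cube_of C (Suc n) g) \<and>
    all_lifting C (Suc n) (cube_of C (Suc n) a) \<and> all_lifting C (Suc n) (cube_of C (Suc n) b) \<and> ?top"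
    unfolding IH[OF F(2)] IH[OF F(3)] IH[OF F(4)] IH[OF F(5)] using c' by argo
  also have "\<dots> \<longleftrightarrow> all_lifting C (Suc (Suc n)) (cube_of C (Suc (Suc n)) F)"
    unfolding F(1) by (rule all_lifting_Square[OF sq, symmetric])
  finally show ?case .
qed

end

section \<open>From cubes in functorial form to n-fold arrows\<close>

definition commutative_cube :: "('o, 'm) cat \<Rightarrow> nat \<Rightarrow> ('o, 'm) cube \<Rightarrow> bool" where
  "commutative_cube C n F \<longleftrightarrow>
     (\<forall>I\<subseteq>{..<n}. cvert F I \<in> Obj C) \<and>
     (\<forall>I\<subseteq>{..<n}. \<forall>i\<in>{..<n} - I. cedge F i I \<in> homset C (cvert F I) (cvert F (insert i I))) \<and>
     (\<forall>I\<subseteq>{..<n}. \<forall>i\<in>{..<n} - I. \<forall>j\<in>{..<n} - I. i \<noteq> j \<longrightarrow>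
        cedge F j (insert i I) \<odot>\<^bsub>C\<^esub> cedge F i I = cedge F i (insert j I) \<odot>\<^bsub>C\<^esub> cedge F j I)"

text \<open>The face with initial vertex \<open>I\<close> in all directions below \<open>k\<close>,
  as an object of \<open>Arr_pow k C\<close>. Since \<open>face_arrow\<close> produces arrows, a
  face of positive dimension is obtained as the arrow in its highest direction.\<close>

definition face_object :: "('o, 'm) cube \<Rightarrow> nat \<Rightarrow> nat set \<Rightarrow> ('o, 'm) narr" where
  "face_object F k I = (case k of 0 \<Rightarrow> Vertex (cvert F I) | Suc l \<Rightarrow> face_arrow F l l I)"

lemma nfold_arrow_face_object: "nfold_arrow n F = face_object F n {}"
  by (simp add: nfold_arrow_def face_object_def)

lemma face_arrow_commute:
  assumes "commutative_cube C n F" "I \<subseteq> {k..<n}" "i \<in> {k..<n} - I" "j \<in> {k..<n} - I" "i \<noteq> j"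
  shows "face_arrow F k i (insert j I) \<odot>\<^bsub>Arr_pow k C\<^esub> face_arrow F k j I =
    face_arrow F k j (insert i I) \<odot>\<^bsub>Arr_pow k C\<^esub> face_arrow F k i I"
  using assms(2-)
proof (induction k arbitrary: I)
  case 0
  have "I \<subseteq> {..<n}" "i \<in> {..<n} - I" "j \<in> {..<n} - I" using 0 by auto
  then show ?case using assms(1) 0(4) by (simp add: commutative_cube_def)
next
  case (Suc k)
  have "I \<subseteq> {k..<n}" "insert k I \<subseteq> {k..<n}" "i \<in> {k..<n} - I" "j \<in> {k..<n} - I"
    "i \<in> {k..<n} - insert k I" "j \<in> {k..<n} - insert k I" using Suc.prems by auto
  then show ?case
    using Suc.IH[of I] Suc.IH[of "insert k I"] Suc.prems(4) by (simp add: insert_commute)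
qed

lemma face_arrow_homset:
  assumes "category C" "commutative_cube C n F" "I \<subseteq> {k..<n}" "j \<in> {k..<n} - I"
  shows "face_arrow F k j I \<in> homset (Arr_pow k C) (face_object F k I) (face_object F k (insert j I))"
  using assms(3-)
proof (induction k arbitrary: I j)
  case 0
  have "I \<subseteq> {..<n}" "j \<in> {..<n} - I" using 0 by auto
  then have "cedge F j I \<in> homset C (cvert F I) (cvert F (insert j I))"
    using assms(2) by (simp add: commutative_cube_def)
  then show ?case by (simp add: face_object_def homset_iff)
next
  case (Suc k)
  have sub: "I \<subseteq> {k..<n}" "insert j I \<subseteq> {k..<n}" "insert k I \<subseteq> {k..<n}" "k \<in> {k..<n} - I"
    "j \<in> {k..<n} - I" "k \<in> {k..<n} - insert j I" "j \<in> {k..<n} - insert k I" "k \<noteq> j"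
    using Suc.prems by auto
  have "face_arrow F k k (insert j I) \<odot>\<^bsub>Arr_pow k C\<^esub> face_arrow F k j I =
    face_arrow F k j (insert k I) \<odot>\<^bsub>Arr_pow k C\<^esub> face_arrow F k k I"
    by (rule face_arrow_commute[OF assms(2)]) (use sub in auto)
  then show ?case
    using Suc.IH[of I k] Suc.IH[of I j] Suc.IH[of "insert j I" k] Suc.IH[of "insert k I" j] sub
    by (simp add: face_object_def homset_iff insert_commute)
qed

text \<open>Components are indexed by the directions below \<open>k\<close> only, hence the cut-off
  of \<open>S\<close>; \<open>I\<close> is the initial vertex of the face.\<close>

lemma component_face_arrow:
  "component k (face_arrow F k j I) S = cedge F j (I \<union> (S \<inter> {..<k}))"
proof (induction k arbitrary: I)
  case (Suc k)
  have "insert k I \<union> (S \<inter> {..<k}) = I \<union> (S \<inter> {..<Suc k})" if "k \<in> S" using that by (auto simp: less_Suc_eq)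
  moreover have "S \<inter> {..<k} = S \<inter> {..<Suc k}" if "k \<notin> S" using that by (auto simp: less_Suc_eq)
  ultimately show ?case using Suc by simp
qed simp

lemma
  assumes "category C" "commutative_cube C n F" "k \<le> n" "I \<subseteq> {k..<n}"
  shows vertex_face_object: "vertex C k (face_object F k I) S = cvert F (I \<union> (S \<inter> {..<k}))"
    and cube_edge_face_object: "i < k \<Longrightarrow> i \<notin> S \<Longrightarrow>
      cube_edge C k (face_object F k I) i S = cedge F i (I \<union> (S \<inter> {..<k}))"
proof -
  have face: "Dom (Arr_pow k C) (face_object F (Suc k) I) = face_object F k I"
    "Cod (Arr_pow k C) (face_object F (Suc k) I) = face_object F k (insert k I)"
    if "Suc k \<le> n" "I \<subseteq> {Suc k..<n}" for k I
  proof -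
    have "I \<subseteq> {k..<n}" "k \<in> {k..<n} - I" using that by auto
    from face_arrow_homset[OF assms(1,2) this]
    show "Dom (Arr_pow k C) (face_object F (Suc k) I) = face_object F k I"
      "Cod (Arr_pow k C) (face_object F (Suc k) I) = face_object F k (insert k I)"
      by (simp_all add: homset_iff face_object_def[of _ "Suc k"])
  qed
  have ins: "insert k I \<union> (S \<inter> {..<k}) = I \<union> (S \<inter> {..<Suc k})" if "k \<in> S" for I and k :: nat
    using that by (auto simp: less_Suc_eq)
  have not: "S \<inter> {..<k} = S \<inter> {..<Suc k}" if "k \<notin> S" for k :: nat
    using that by (auto simp: less_Suc_eq)
  show "vertex C k (face_object F k I) S = cvert F (I \<union> (S \<inter> {..<k}))"
    using assms(3,4)
  proof (induction k arbitrary: I)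
    case 0
    then show ?case by (simp add: face_object_def)
  next
    case (Suc k)
    then have "I \<subseteq> {k..<n}" "insert k I \<subseteq> {k..<n}" by auto
    then show ?case
      using Suc.IH[of I] Suc.IH[of "insert k I"] face[OF Suc.prems] Suc.prems ins[of k I] not[of k] by auto
  qed
  show "cube_edge C k (face_object F k I) i S = cedge F i (I \<union> (S \<inter> {..<k}))" if "i < k" "i \<notin> S"
    using assms(3,4) that
  proof (induction k arbitrary: I)
    case (Suc k)
    then have "I \<subseteq> {k..<n}" "insert k I \<subseteq> {k..<n}" by auto
    then show ?case
      using Suc.IH[of I] Suc.IH[of "insert k I"] face[OF Suc.prems(1,2)] Suc.prems ins[of k I] not[of k]
      by (auto simp: component_face_arrow face_object_def[of _ "Suc k"])
  qed simp
qed

text \<open>The two cubes need to agree only at subsets of \<open>{..<n}\<close>, which is all that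
  the lifting conditions inspect.\<close>

theorem (in regular_category) cubic_extension_nfold_arrow:
  assumes "commutative_cube C n F" "n > 0"
  shows "cubic_extension C n (nfold_arrow n F) \<longleftrightarrow> all_lifting C n F"
proof -
  obtain k where n: "n = Suc k" using assms(2) by (cases n) auto
  have "face_arrow F k k {} \<in> Arr (Arr_pow k C)"
    using face_arrow_homset[OF category_axioms assms(1), of "{}" k k] n by (auto simp: homset_iff)
  then have obj: "nfold_arrow n F \<in> Obj (Arr_pow (Suc k) C)"
    by (simp add: nfold_arrow_def n)
  have "lifting C (cube_of C n (nfold_arrow n F)) I J \<longleftrightarrow> lifting C F I J"
    if "I \<subseteq> {..<n}" "J \<subseteq> {..<n}" "I \<inter> J = {}" for I J
  proof -
    have "K \<inter> {..<n} = K" if "K \<subseteq> {..<n}" for K using that by auto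
    moreover have "insert j I \<subseteq> {..<n}" "j < n" "j \<notin> I" if "j \<in> J" for j
      using that \<open>I \<subseteq> {..<n}\<close> \<open>J \<subseteq> {..<n}\<close> \<open>I \<inter> J = {}\<close> by auto
    ultimately show ?thesis
      using that(1)
      by (intro lifting_cong)
        (simp_all add: nfold_arrow_face_object vertex_face_object[OF category_axioms assms(1)]
          cube_edge_face_object[OF category_axioms assms(1)])
  qed
  then have "all_lifting C n (cube_of C n (nfold_arrow n F)) \<longleftrightarrow> all_lifting C n F"
    by (simp add: all_lifting_def)
  then show ?thesis
    using cubic_extension_iff_all_lifting[OF obj] n by simp
qed

section \<open>Distributivity in modular lattices of sets\<close>

text \<open>Congruences will be sets of pairs of generalised elements: their meet is the
  intersection, but their join is not the union. Hence the abstract \<open>join\<close> next to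
  concrete meets. The modular law is stated in its nontrivial direction.\<close>

locale modular_set_lattice =
  fixes K :: "'a set set" and top :: "'a set" and join :: "'a set \<Rightarrow> 'a set \<Rightarrow> 'a set" (infixl "\<curlyvee>" 65)
  assumes top_closed: "top \<in> K"
    and le_top: "A \<in> K \<Longrightarrow> A \<subseteq> top"
    and Int_closed: "A \<in> K \<Longrightarrow> B \<in> K \<Longrightarrow> A \<inter> B \<in> K"
    and has_bot: "\<exists>B\<in>K. \<forall>A\<in>K. B \<subseteq> A"
    and join_closed: "A \<in> K \<Longrightarrow> B \<in> K \<Longrightarrow> A \<curlyvee> B \<in> K"
    and join_upper1: "A \<in> K \<Longrightarrow> B \<in> K \<Longrightarrow> A \<subseteq> A \<curlyvee> B"
    and join_upper2: "A \<in> K \<Longrightarrow> B \<in> K \<Longrightarrow> B \<subseteq> A \<curlyvee> B"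
    and join_least: "A \<in> K \<Longrightarrow> B \<in> K \<Longrightarrow> E \<in> K \<Longrightarrow> A \<subseteq> E \<Longrightarrow> B \<subseteq> E \<Longrightarrow> A \<curlyvee> B \<subseteq> E"
    and modular: "A \<in> K \<Longrightarrow> B \<in> K \<Longrightarrow> E \<in> K \<Longrightarrow> A \<subseteq> E \<Longrightarrow> (A \<curlyvee> B) \<inter> E \<subseteq> A \<curlyvee> (B \<inter> E)"
begin

lemma join_commute: "A \<in> K \<Longrightarrow> B \<in> K \<Longrightarrow> A \<curlyvee> B = B \<curlyvee> A"
  by (intro equalityI join_least join_closed join_upper1 join_upper2)

lemma join_mono:
  "A \<in> K \<Longrightarrow> B \<in> K \<Longrightarrow> A' \<in> K \<Longrightarrow> B' \<in> K \<Longrightarrow> A \<subseteq> A' \<Longrightarrow> B \<subseteq> B' \<Longrightarrow> A \<curlyvee> B \<subseteq> A' \<curlyvee> B'"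
  using join_upper1[of A' B'] join_upper2[of A' B'] by (intro join_least join_closed) auto

text \<open>\<open>K\<close> is closed under binary intersections only, so an intersection of upper
  bounds need not lie in \<open>K\<close>. For finite subsets of \<open>K\<close> it does, as it
  then reduces to iterated binary joins.\<close>

definition Join :: "'a set set \<Rightarrow> 'a set" where
  "Join S = \<Inter>{E \<in> K. \<forall>A\<in>S. A \<subseteq> E}"

lemma Join_upper: "A \<in> S \<Longrightarrow> A \<subseteq> Join S"
  by (auto simp: Join_def)

lemma Join_least: "E \<in> K \<Longrightarrow> (\<And>A. A \<in> S \<Longrightarrow> A \<subseteq> E) \<Longrightarrow> Join S \<subseteq> E"
  by (auto simp: Join_def)

lemma Join_empty: "Join {} \<in> K"
proof -
  obtain B where "B \<in> K" "\<forall>A\<in>K. B \<subseteq> A" using has_bot by blast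
  then have "Join {} = B" by (auto simp: Join_def)
  then show ?thesis using \<open>B \<in> K\<close> by simp
qed

lemma Join_insert: "A \<in> K \<Longrightarrow> Join S \<in> K \<Longrightarrow> Join (insert A S) = A \<curlyvee> Join S"
proof (rule equalityI)
  assume A: "A \<in> K" "Join S \<in> K"
  show "Join (insert A S) \<subseteq> A \<curlyvee> Join S"
    using A join_upper1[OF A] join_upper2[OF A] Join_upper[of _ S] join_closed[OF A]
    by (intro Join_least) blast+
  show "A \<curlyvee> Join S \<subseteq> Join (insert A S)"
    unfolding Join_def[of "insert A S"]
  proof (rule Inter_greatest)
    fix E assume E: "E \<in> {E \<in> K. \<forall>B\<in>insert A S. B \<subseteq> E}"
    then have "Join S \<subseteq> E" by (intro Join_least) auto
    then show "A \<curlyvee> Join S \<subseteq> E"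
      using A E by (intro join_least) auto
  qed
qed

lemma Join_closed: "finite S \<Longrightarrow> S \<subseteq> K \<Longrightarrow> Join S \<in> K"
  by (induction S rule: finite_induct) (simp_all add: Join_empty Join_insert join_closed)

lemma Join_mono:
  assumes "finite S'" "S' \<subseteq> K" "\<And>A. A \<in> S \<Longrightarrow> \<exists>B\<in>S'. A \<subseteq> B"
  shows "Join S \<subseteq> Join S'"
  using assms Join_upper[of _ S'] Join_closed by (intro Join_least) blast+

end

locale modular_family = modular_set_lattice +
  fixes r :: "nat \<Rightarrow> 'a set" and n :: nat
  assumes r_closed: "i < n \<Longrightarrow> r i \<in> K"
begin

text \<open>Intersecting with \<open>top\<close> makes the empty meet the largest element of
  \<open>K\<close> instead of the universal set.\<close>

definition meet :: "nat set \<Rightarrow> 'a set" where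
  "meet J = top \<inter> (\<Inter>j\<in>J. r j)"

definition sup_of :: "nat set \<Rightarrow> 'a set" where
  "sup_of I = Join (r ` I)"

definition meet_of_sups :: "nat set \<Rightarrow> nat set \<Rightarrow> 'a set" where
  "meet_of_sups I J = top \<inter> (\<Inter>j\<in>J. sup_of (insert j I))"

lemma fin: "I \<subseteq> {..<n} \<Longrightarrow> finite I"
  by (rule finite_subset) auto

lemma Inter_closed: "finite J \<Longrightarrow> (\<And>j. j \<in> J \<Longrightarrow> f j \<in> K) \<Longrightarrow> top \<inter> (\<Inter>j\<in>J. f j) \<in> K"
proof (induction J rule: finite_induct)
  case (insert j J)
  have "top \<inter> (\<Inter>j\<in>insert j J. f j) = f j \<inter> (top \<inter> (\<Inter>j\<in>J. f j))" by auto
  then show ?case using insert by (simp add: Int_closed)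
qed (simp add: top_closed)

lemma meet_closed: "J \<subseteq> {..<n} \<Longrightarrow> meet J \<in> K"
  unfolding meet_def using fin r_closed by (intro Inter_closed) auto

lemma sup_of_closed: "I \<subseteq> {..<n} \<Longrightarrow> sup_of I \<in> K"
  unfolding sup_of_def using fin r_closed by (intro Join_closed) auto

lemma meet_of_sups_closed: "I \<subseteq> {..<n} \<Longrightarrow> J \<subseteq> {..<n} \<Longrightarrow> meet_of_sups I J \<in> K"
  unfolding meet_of_sups_def using fin by (intro Inter_closed sup_of_closed) auto

lemma meet_antimono: "J \<subseteq> J' \<Longrightarrow> meet J' \<subseteq> meet J"
  by (auto simp: meet_def)

lemma meet_le: "j \<in> J \<Longrightarrow> meet J \<subseteq> r j"
  by (auto simp: meet_def)

lemma meet_Un: "meet (J \<union> J') = meet J \<inter> meet J'"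
  by (auto simp: meet_def)

lemma meet_single: "j < n \<Longrightarrow> meet {j} = r j"
  using le_top[OF r_closed] by (auto simp: meet_def)

lemma le_sup_of: "i \<in> I \<Longrightarrow> r i \<subseteq> sup_of I"
  unfolding sup_of_def by (rule Join_upper) simp

lemma sup_of_mono: "I \<subseteq> I' \<Longrightarrow> I' \<subseteq> {..<n} \<Longrightarrow> sup_of I \<subseteq> sup_of I'"
  unfolding sup_of_def using fin r_closed by (intro Join_mono) auto

lemma sup_of_insert: "i < n \<Longrightarrow> I \<subseteq> {..<n} \<Longrightarrow> sup_of (insert i I) = r i \<curlyvee> sup_of I"
  using r_closed[of i] sup_of_closed[of I] by (simp add: sup_of_def Join_insert)

lemma sup_of_single: "i < n \<Longrightarrow> sup_of {i} = r i"
  using r_closed[of i] Join_least[of "r i" "{}"] Join_upper[of "r i" "{r i}"]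
  by (auto simp: sup_of_def intro: Join_least[THEN subsetD])

text \<open>This notion and the next two state only the inclusion that does not hold in every
  lattice.\<close>

definition join_distributive :: bool where
  "join_distributive \<longleftrightarrow> (\<forall>I J. I \<subseteq> {..<n} \<longrightarrow> J \<subseteq> {..<n} \<longrightarrow> I \<inter> J = {} \<longrightarrow>
     meet_of_sups I J \<subseteq> sup_of I \<curlyvee> meet J)"

definition meet_distributive :: bool where
  "meet_distributive \<longleftrightarrow> (\<forall>I J. I \<subseteq> {..<n} \<longrightarrow> J \<subseteq> {..<n} \<longrightarrow> I \<inter> J = {} \<longrightarrow>
     meet J \<inter> sup_of I \<subseteq> Join ((\<lambda>i. meet (insert i J)) ` I))"

text \<open>An indexed disjoint family becomes a set \<open>P\<close> of blocks: joins ignore order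
  and repetition, and in a disjoint family only the empty block can be repeated.\<close>

definition fully_distributive :: bool where
  "fully_distributive \<longleftrightarrow> (\<forall>J P. J \<subseteq> {..<n} \<longrightarrow> \<Union>P \<subseteq> {..<n} \<longrightarrow> J \<inter> \<Union>P = {} \<longrightarrow> disjoint P \<longrightarrow>
     meet J \<inter> Join (meet ` P) \<subseteq> Join ((\<lambda>B. meet (J \<union> B)) ` P))"

text \<open>Induction on \<open>J\<close>. Adding \<open>j\<close> intersects the join of
  \<open>sup_of I\<close> and \<open>meet J\<close> with \<open>sup_of (insert j I)\<close>, which
  lies above \<open>sup_of I\<close>. The modular law moves this intersection onto
  \<open>meet J\<close>, where meet distributivity over \<open>insert j I\<close> applies.\<close>

lemma join_distributive_if_meet_distributive:
  assumes meet_distributive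
  shows join_distributive
  unfolding join_distributive_def
proof (intro allI impI)
  fix I J assume I: "I \<subseteq> {..<n}" and "J \<subseteq> {..<n}" "I \<inter> J = {}"
  then have "finite J" using fin by simp
  then show "meet_of_sups I J \<subseteq> sup_of I \<curlyvee> meet J"
    using \<open>J \<subseteq> {..<n}\<close> \<open>I \<inter> J = {}\<close>
  proof (induction J rule: finite_induct)
    case empty
    then show ?case
      using join_upper2[of "sup_of I" top] I by (simp add: meet_of_sups_def meet_def sup_of_closed top_closed)
  next
    case (insert j J)
    have sub: "insert j I \<subseteq> {..<n}" "J \<subseteq> {..<n}" "insert j I \<inter> J = {}" "insert j J \<subseteq> {..<n}"
      using insert I by auto
    have "meet_of_sups I (insert j J) \<subseteq> (sup_of I \<curlyvee> meet J) \<inter> sup_of (insert j I)"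
      using insert.IH insert.prems by (auto simp: meet_of_sups_def)
    also have "\<dots> \<subseteq> sup_of I \<curlyvee> (meet J \<inter> sup_of (insert j I))"
      using sub I by (intro modular sup_of_closed meet_closed sup_of_mono) auto
    also have "\<dots> \<subseteq> sup_of I \<curlyvee> meet (insert j J)"
    proof (rule join_least)
      have *: "meet J \<inter> sup_of (insert j I) \<subseteq> Join ((\<lambda>i. meet (insert i J)) ` insert j I)"
        using assms sub unfolding meet_distributive_def by blast
      \<comment> \<open>Only the joinand for \<open>j\<close> is new; every other one lies below
        some \<open>r i\<close> with \<open>i \<in> I\<close>.\<close>
      also have "\<dots> \<subseteq> sup_of I \<curlyvee> meet (insert j J)"
      proof (rule Join_least)
        fix A assume "A \<in> (\<lambda>i. meet (insert i J)) ` insert j I"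
        then consider "A = meet (insert j J)" | i where "i \<in> I" "A = meet (insert i J)" by auto
        then show "A \<subseteq> sup_of I \<curlyvee> meet (insert j J)"
        proof cases
          case 1
          then show ?thesis using I sub by (simp add: join_upper2 sup_of_closed meet_closed)
        next
          case 2
          then have "A \<subseteq> sup_of I" using meet_le[of i "insert i J"] le_sup_of[of i I] by auto
          also have "\<dots> \<subseteq> sup_of I \<curlyvee> meet (insert j J)"
            using I sub by (intro join_upper1 sup_of_closed meet_closed)
          finally show ?thesis .
        qed
      qed (intro join_closed sup_of_closed meet_closed I sub)
      finally show "meet J \<inter> sup_of (insert j I) \<subseteq> sup_of I \<curlyvee> meet (insert j J)" .
    qed (intro join_closed sup_of_closed meet_closed join_upper1 Int_closed I sub)+
    finally show ?case .
  qed
qed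

text \<open>The dual induction, on \<open>I\<close>. Join distributivity becomes applicable because
  \<open>r j\<close> lies below \<open>sup_of (insert j I)\<close> for \<open>j \<in> J\<close>, so
  that the left-hand side lies below a meet of joins over \<open>insert i J\<close>. The modular law
  then applies since \<open>meet (insert i J)\<close> lies below \<open>meet J\<close>.\<close>

lemma meet_distributive_if_join_distributive:
  assumes join_distributive
  shows meet_distributive
  unfolding meet_distributive_def
proof (intro allI impI)
  fix I J assume "I \<subseteq> {..<n}" and J: "J \<subseteq> {..<n}" and "I \<inter> J = {}"
  then have "finite I" using fin by simp
  then show "meet J \<inter> sup_of I \<subseteq> Join ((\<lambda>i. meet (insert i J)) ` I)"
    using \<open>I \<subseteq> {..<n}\<close> \<open>I \<inter> J = {}\<close>
  proof (induction I rule: finite_induct)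
    case empty
    then show ?case by (simp add: sup_of_def)
  next
    case (insert i I)
    have sub: "I \<subseteq> {..<n}" "i < n" "insert i J \<subseteq> {..<n}" "I \<inter> insert i J = {}"
      using insert J by auto
    have closed: "meet J \<in> K" "meet (insert i J) \<in> K" "sup_of I \<in> K"
      using J sub meet_closed[of "insert i J"] by (auto intro: meet_closed sup_of_closed)
    let ?S = "Join ((\<lambda>i. meet (insert i J)) ` I)"
    have S: "?S \<in> K"
      using sub J fin[of I] by (intro Join_closed) (auto intro!: meet_closed)
    have "r j \<subseteq> sup_of (insert j I)" if "j \<in> J" for j by (rule le_sup_of) simp
    then have "meet J \<inter> sup_of (insert i I) \<subseteq> meet_of_sups I (insert i J)"
      by (auto simp: meet_of_sups_def meet_def)
    also have "\<dots> \<subseteq> sup_of I \<curlyvee> meet (insert i J)"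
      using assms sub unfolding join_distributive_def by blast
    finally have "meet J \<inter> sup_of (insert i I) \<subseteq> (meet (insert i J) \<curlyvee> sup_of I) \<inter> meet J"
      using closed by (auto simp: join_commute)
    also have "\<dots> \<subseteq> meet (insert i J) \<curlyvee> (sup_of I \<inter> meet J)"
      using closed by (intro modular meet_antimono) auto
    also have "\<dots> \<subseteq> meet (insert i J) \<curlyvee> ?S"
      using closed S insert.IH sub by (intro join_mono Int_closed) auto
    also have "\<dots> = Join ((\<lambda>i. meet (insert i J)) ` insert i I)"
      using closed S by (simp add: Join_insert)
    finally show ?case .
  qed
qed

lemma meet_distributive_iff_singletons:
  "meet_distributive \<longleftrightarrow> (\<forall>I J. I \<subseteq> {..<n} \<longrightarrow> J \<subseteq> {..<n} \<longrightarrow> I \<inter> J = {} \<longrightarrow>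
    meet J \<inter> Join (meet ` (\<lambda>i. {i}) ` I) \<subseteq> Join ((\<lambda>B. meet (J \<union> B)) ` (\<lambda>i. {i}) ` I))"
proof -
  have "meet ` (\<lambda>i. {i}) ` I = r ` I" if "I \<subseteq> {..<n}" for I
    using that meet_single by (auto simp: image_image intro!: image_cong)
  then show ?thesis
    unfolding meet_distributive_def sup_of_def by (simp add: image_image)
qed

text \<open>Induction on the number of indices in the blocks. A block \<open>B\<close> with at least
  two elements is split into \<open>{j}\<close> and the rest \<open>B'\<close>. The law holds with
  \<open>B'\<close> in place of \<open>B\<close> and, once \<open>B'\<close> has been added to
  \<open>J\<close>, with \<open>{j}\<close> in place of \<open>B\<close>; the modular law combines
  the two. If all blocks are singletons, the law is the hypothesis.\<close>

lemma fully_distributive_if_meet_distributive: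
  assumes meet_distributive
  shows fully_distributive
proof -
  have "meet J \<inter> Join (meet ` P) \<subseteq> Join ((\<lambda>B. meet (J \<union> B)) ` P)"
    if "J \<subseteq> {..<n}" "\<Union>P \<subseteq> {..<n}" "J \<inter> \<Union>P = {}" "disjoint P" for J P
    using that
  proof (induction "card (\<Union>P)" arbitrary: J P rule: less_induct)
    case less
    have P_fin: "finite (\<Union>P)" "finite P" using less.prems(2) fin finite_UnionD by auto
    let ?R = "Join ((\<lambda>B. meet (J \<union> B)) ` P)"
    have closed_Join: "Join ((\<lambda>B. meet (J \<union> B)) ` Q) \<in> K" "Join (meet ` Q) \<in> K"
      if "finite Q" "\<Union>Q \<subseteq> {..<n}" "J \<subseteq> {..<n}" for J Q
      using that by (auto intro!: Join_closed meet_closed)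
    have R: "?R \<in> K" using less.prems P_fin by (intro closed_Join)
    consider "{} \<in> P" | B i j where "B \<in> P" "i \<in> B" "j \<in> B" "i \<noteq> j"
      | "{} \<notin> P" "\<And>B i j. B \<in> P \<Longrightarrow> i \<in> B \<Longrightarrow> j \<in> B \<Longrightarrow> i = j" by blast
    then show ?case
    proof cases
      case 1
      \<comment> \<open>The empty block contributes \<open>meet J\<close> itself to the right-hand
        side.\<close>
      then have "meet J \<subseteq> ?R" using Join_upper[of "meet J" "(\<lambda>B. meet (J \<union> B)) ` P"] by force
      then show ?thesis by blast
    next
      case 2
      define B' Q where "B' = B - {j}" and "Q = P - {B}"
      have P: "P = insert B Q" and B: "B = insert j B'" "j \<notin> B'" "B' \<noteq> {}"
        using 2 by (auto simp: B'_def Q_def)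
      have dj: "disjoint Q" "B \<inter> \<Union>Q = {}"
        using less.prems(4) 2(1) by (auto simp: Q_def disjoint_def)
      have Q_fin: "finite Q" using P_fin by (simp add: Q_def)
      have sub: "J \<subseteq> {..<n}" "B \<subseteq> {..<n}" "\<Union>Q \<subseteq> {..<n}" "J \<inter> B = {}" "J \<inter> \<Union>Q = {}"
        using less.prems unfolding P by auto
      obtain i' where i': "i' \<in> B'" "i' \<noteq> j" using B by blast
      have UP: "\<Union>P = insert j (B' \<union> \<Union>Q)" "j \<notin> \<Union>Q" "i' \<notin> \<Union>Q"
        using dj(2) i' B(1) by (auto simp: P)
      have disj: "disjnt B' A" "disjnt {j} A" if "A \<in> Q" for A
        using that dj(2) B(1) by (auto simp: disjnt_def)
      \<comment> \<open>The union of the blocks loses \<open>j\<close>.\<close>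
      have IH1: "meet J \<inter> Join (meet ` insert B' Q) \<subseteq> Join ((\<lambda>A. meet (J \<union> A)) ` insert B' Q)"
      proof (rule less.hyps)
        have "\<Union>(insert B' Q) \<subset> \<Union>P" using UP B(2) by auto
        then show "card (\<Union>(insert B' Q)) < card (\<Union>P)" by (rule psubset_card_mono[OF P_fin(1)])
        show "disjoint (insert B' Q)"
          using dj(1) disj by (auto simp: pairwise_insert disjnt_sym)
      qed (use sub B in auto)
      \<comment> \<open>Here the nonempty \<open>B'\<close> moves from the blocks into
        \<open>J\<close>, so the union shrinks as well.\<close>
      have IH2: "meet (J \<union> B') \<inter> Join (meet ` insert {j} Q) \<subseteq> Join ((\<lambda>A. meet (J \<union> B' \<union> A)) ` insert {j} Q)"
      proof (rule less.hyps)
        have "\<Union>(insert {j} Q) \<subset> \<Union>P" using UP i' by auto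
        then show "card (\<Union>(insert {j} Q)) < card (\<Union>P)" by (rule psubset_card_mono[OF P_fin(1)])
        show "disjoint (insert {j} Q)"
          using dj(1) disj by (auto simp: pairwise_insert disjnt_sym)
      qed (use sub B dj in auto)
      let ?b = "Join ((\<lambda>A. meet (J \<union> A)) ` Q)" and ?c = "Join (meet ` insert {j} Q)"
      \<comment> \<open>\<open>?E\<close> lies above the left-hand side and above the joinands from
        \<open>Q\<close>, as the modular law requires, and it keeps the information about
        \<open>{j}\<close> that \<open>IH2\<close> needs.\<close>
      let ?E = "meet J \<inter> ?c"
      have b: "?b \<in> K" using sub Q_fin by (intro closed_Join)
      have mJ: "meet J \<in> K" "meet (J \<union> B') \<in> K" using sub B by (auto intro!: meet_closed)
      have jn: "j < n" and B'n: "B' \<subseteq> {..<n}" using sub B by auto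
      have c: "?c \<in> K" using sub Q_fin jn by (intro closed_Join(2)[of _ J]) auto
      have E: "?E \<in> K" using mJ c by (intro Int_closed)
      have PB': "Join (meet ` P) \<subseteq> Join (meet ` insert B' Q)"
        using P B Q_fin sub B'n by (intro Join_mono) (auto intro!: meet_closed intro: meet_antimono[THEN subsetD])
      have Pj: "Join (meet ` P) \<subseteq> ?c"
        using P B Q_fin sub jn by (intro Join_mono) (auto intro!: meet_closed intro: meet_antimono[THEN subsetD])
      have bE: "?b \<subseteq> ?E"
      proof (rule Join_least[OF E])
        fix A assume "A \<in> (\<lambda>A. meet (J \<union> A)) ` Q"
        then obtain A' where A': "A' \<in> Q" "A = meet (J \<union> A')" by auto
        then have "meet A' \<subseteq> ?c" by (intro Join_upper) auto
        then show "A \<subseteq> ?E" using A' by (auto simp: meet_Un)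
      qed
      have "meet J \<inter> Join (meet ` P) \<subseteq> Join ((\<lambda>A. meet (J \<union> A)) ` insert B' Q) \<inter> ?E"
        using IH1 PB' Pj by blast
      also have "\<dots> = (?b \<curlyvee> meet (J \<union> B')) \<inter> ?E"
        using mJ b by (simp add: Join_insert join_commute)
      also have "\<dots> \<subseteq> ?b \<curlyvee> (meet (J \<union> B') \<inter> ?E)"
        using mJ b E bE by (intro modular)
      also have "\<dots> \<subseteq> ?R"
      proof (rule join_least)
        show "?b \<subseteq> ?R"
          using P_fin less.prems by (intro Join_mono) (auto simp: P intro!: meet_closed)
        have "meet (J \<union> B') \<inter> ?E \<subseteq> Join ((\<lambda>A. meet (J \<union> B' \<union> A)) ` insert {j} Q)"
          using IH2 by blast
        also have "\<dots> \<subseteq> ?R"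
        proof (rule Join_least[OF R])
          fix A assume "A \<in> (\<lambda>A. meet (J \<union> B' \<union> A)) ` insert {j} Q"
          then consider "A = meet (J \<union> B)" | A' where "A' \<in> Q" "A = meet (J \<union> B' \<union> A')"
            using B by auto
          then show "A \<subseteq> ?R"
          proof cases
            case 1
            then show ?thesis unfolding P by (intro Join_upper) auto
          next
            case 2
            then have "A \<subseteq> meet (J \<union> A')" by (auto intro: meet_antimono[THEN subsetD, rotated])
            also have "\<dots> \<subseteq> ?R" unfolding P using 2 by (intro Join_upper) auto
            finally show ?thesis .
          qed
        qed
        finally show "meet (J \<union> B') \<inter> ?E \<subseteq> ?R" .
      qed (use b mJ E R in \<open>auto intro: Int_closed\<close>)
      finally show ?thesis .
    next
      case 3
      have "P = (\<lambda>i. {i}) ` \<Union>P"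
      proof (intro equalityI subsetI)
        fix B assume B: "B \<in> P"
        then obtain i where "i \<in> B" using 3(1) by (cases "B = {}") auto
        then have "B = {i}" using 3(2)[OF B] by auto
        then show "B \<in> (\<lambda>i. {i}) ` \<Union>P" using B by blast
      next
        fix B assume "B \<in> (\<lambda>i. {i}) ` \<Union>P"
        then obtain i A where i: "B = {i}" "i \<in> A" "A \<in> P" by auto
        then have "A = {i}" using 3(2)[of A] by auto
        then show "B \<in> P" using i by simp
      qed
      then show ?thesis
        using assms less.prems unfolding meet_distributive_iff_singletons by (metis Int_commute)
    qed
  qed
  then show ?thesis unfolding fully_distributive_def by blast
qed

lemma meet_distributive_if_fully_distributive:
  assumes fully_distributive
  shows meet_distributive
  unfolding meet_distributive_iff_singletons
proof (intro allI impI)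
  fix I J assume "I \<subseteq> {..<n}" "J \<subseteq> {..<n}" "I \<inter> J = {}"
  moreover have "\<Union>((\<lambda>i. {i}) ` I) = I" "disjoint ((\<lambda>i. {i}) ` I)"
    by (auto simp: disjoint_def)
  ultimately show "meet J \<inter> Join (meet ` (\<lambda>i. {i}) ` I) \<subseteq> Join ((\<lambda>B. meet (J \<union> B)) ` (\<lambda>i. {i}) ` I)"
    using assms unfolding fully_distributive_def by (metis Int_commute)
qed

theorem fully_distributive_iff_join_distributive: "fully_distributive \<longleftrightarrow> join_distributive"
  using join_distributive_if_meet_distributive meet_distributive_if_join_distributive
    fully_distributive_if_meet_distributive meet_distributive_if_fully_distributive by blast

text \<open>The inclusion that \<open>fully_distributive\<close> leaves out, needed to obtain an
  equality.\<close>

lemma Join_meet_Un_le: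
  assumes "J \<subseteq> {..<n}" "\<Union>P \<subseteq> {..<n}"
  shows "Join ((\<lambda>B. meet (J \<union> B)) ` P) \<subseteq> meet J \<inter> Join (meet ` P)"
proof (rule Join_least)
  have "finite P" using assms(2) fin finite_UnionD by blast
  then show "meet J \<inter> Join (meet ` P) \<in> K"
    using assms by (intro Int_closed meet_closed Join_closed) (auto intro!: meet_closed)
  fix A assume "A \<in> (\<lambda>B. meet (J \<union> B)) ` P"
  then obtain B where "B \<in> P" "A = meet (J \<union> B)" by auto
  then show "A \<subseteq> meet J \<inter> Join (meet ` P)"
    using Join_upper[of "meet B" "meet ` P"] by (auto simp: meet_Un)
qed

end

section \<open>The lattice of congruences\<close>

context category
begin

definition pairs :: "'o \<Rightarrow> ('m \<times> 'm) set" where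
  "pairs X = {(x, y). x \<in> Arr C \<and> y \<in> Arr C \<and> Dom C x = Dom C y \<and> Cod C x = X \<and> Cod C y = X}"

definition kernel_rel :: "'m \<Rightarrow> ('m \<times> 'm) set" where
  "kernel_rel f = {(x, y) \<in> pairs (Dom C f). f \<odot> x = f \<odot> y}"

definition rel_points :: "'m \<times> 'm \<Rightarrow> ('m \<times> 'm) set" where
  "rel_points R = {(x, y). related C R x y}"

text \<open>Effective equivalence relations, as sets of pairs of parallel elements with all domains
  at once. Being kernels, they are stable under precomposition and can be tested on covers. In an
  exact category they are exactly the sets of points of internal equivalence relations.\<close>

definition congruences :: "'o \<Rightarrow> ('m \<times> 'm) set set" where
  "congruences X = {kernel_rel f | f. f \<in> Arr C \<and> Dom C f = X}"

text \<open>Composition of relations in the internal logic: the middle element exists only after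
  passing to a regular epimorphic cover.\<close>

definition local_join :: "'o \<Rightarrow> ('m \<times> 'm) set \<Rightarrow> ('m \<times> 'm) set \<Rightarrow> ('m \<times> 'm) set" where
  "local_join X A B = {(x, y) \<in> pairs X. \<exists>e z. regular_epi C e \<and> Cod C e = Dom C x \<and>
     (x \<odot> e, z) \<in> A \<and> (z, y \<odot> e) \<in> B}"

lemma in_pairs [simp]:
  "(x, y) \<in> pairs X \<longleftrightarrow> x \<in> Arr C \<and> y \<in> Arr C \<and> Dom C x = Dom C y \<and> Cod C x = X \<and> Cod C y = X"
  by (simp add: pairs_def)

lemma in_kernel_rel:
  "(x, y) \<in> kernel_rel f \<longleftrightarrow> (x, y) \<in> pairs (Dom C f) \<and> f \<odot> x = f \<odot> y"
  by (simp add: kernel_rel_def)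

lemma in_rel_points: "(x, y) \<in> rel_points R \<longleftrightarrow> related C R x y"
  by (simp add: rel_points_def)

lemma congruencesE:
  assumes "A \<in> congruences X"
  obtains f where "f \<in> Arr C" "Dom C f = X" "A = kernel_rel f"
  using assms by (auto simp: congruences_def)

lemma kernel_rel_congruence: "f \<in> Arr C \<Longrightarrow> kernel_rel f \<in> congruences (Dom C f)"
  by (auto simp: congruences_def)

lemma congruence_pairs: "A \<in> congruences X \<Longrightarrow> A \<subseteq> pairs X"
  by (auto simp: congruences_def kernel_rel_def)

lemma congruence_refl: "A \<in> congruences X \<Longrightarrow> x \<in> Arr C \<Longrightarrow> Cod C x = X \<Longrightarrow> (x, x) \<in> A"
  by (auto simp: congruences_def in_kernel_rel)

lemma congruence_sym: "A \<in> congruences X \<Longrightarrow> (x, y) \<in> A \<Longrightarrow> (y, x) \<in> A"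
  by (auto simp: congruences_def in_kernel_rel)

lemma congruence_trans: "A \<in> congruences X \<Longrightarrow> (x, y) \<in> A \<Longrightarrow> (y, z) \<in> A \<Longrightarrow> (x, z) \<in> A"
  by (auto simp: congruences_def in_kernel_rel)

lemma congruence_precomp:
  assumes "A \<in> congruences X" "(x, y) \<in> A" "e \<in> Arr C" "Cod C e = Dom C x"
  shows "(x \<odot> e, y \<odot> e) \<in> A"
proof -
  obtain f where f: "f \<in> Arr C" "Dom C f = X" "A = kernel_rel f"
    using assms(1) by (rule congruencesE)
  then have xy: "(x, y) \<in> pairs X" "f \<odot> x = f \<odot> y" using assms(2) by (auto simp: in_kernel_rel)
  then show ?thesis
    using Comp_extend[OF xy(2), of e] f assms(3,4) by (simp add: in_kernel_rel)
qed

text \<open>Regular epimorphisms are epic, so the equation that defines a kernel may be checked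
  after a cover. This is what removes covers from the conclusions of local arguments.\<close>

lemma congruence_descend:
  assumes "A \<in> congruences X" "regular_epi C e" "(x, y) \<in> pairs X" "Cod C e = Dom C x"
    "(x \<odot> e, y \<odot> e) \<in> A"
  shows "(x, y) \<in> A"
proof -
  obtain f where f: "f \<in> Arr C" "Dom C f = X" "A = kernel_rel f"
    using assms(1) by (rule congruencesE)
  have e: "e \<in> Arr C" using assms(2) by simp
  have "f \<odot> x = f \<odot> y"
    by (rule regular_epi_cancel[OF assms(2)]) (use assms(3-5) f e in \<open>auto simp: in_kernel_rel\<close>)
  then show ?thesis using assms(3) f by (simp add: in_kernel_rel)
qed

lemma kernel_pair_points:
  assumes "pullback C f f p q"
  shows "rel_points (p, q) = kernel_rel f"
proof -
  note pb = pullbackD[OF assms]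
  have "(x, y) \<in> rel_points (p, q) \<longleftrightarrow> (x, y) \<in> kernel_rel f" for x y
  proof
    assume "(x, y) \<in> rel_points (p, q)"
    then obtain h where "h \<in> Arr C" "Dom C h = Dom C x" "Cod C h = Dom C p" "p \<odot> h = x" "q \<odot> h = y"
      by (auto simp: in_rel_points related_def homset_iff)
    then show "(x, y) \<in> kernel_rel f"
      using pb Comp_extend[OF pb(9), of h] by (auto simp: in_kernel_rel)
  next
    assume xy: "(x, y) \<in> kernel_rel f"
    obtain h where "h \<in> Arr C" "Dom C h = Dom C x" "Cod C h = Dom C p" "p \<odot> h = x" "q \<odot> h = y"
      by (rule pullback_fill[OF assms, of x y]) (use xy pb in \<open>auto simp: in_kernel_rel\<close>)
    then show "(x, y) \<in> rel_points (p, q)"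
      by (auto simp: in_rel_points related_def homset_iff)
  qed
  then show ?thesis by auto
qed

lemma int_relD:
  assumes "int_rel C X R"
  shows "fst R \<in> Arr C" "snd R \<in> Arr C" "Dom C (snd R) = Dom C (fst R)" "Cod C (fst R) = X" "Cod C (snd R) = X"
  using assms by (auto simp: int_rel_def homset_iff)

lemma int_rel_related:
  assumes "int_rel C X R"
  shows "related C R (fst R) (snd R)"
  unfolding related_def
  by (rule bexI[of _ "Ident C (Dom C (fst R))"]) (use int_relD[OF assms] in \<open>auto simp: homset_iff\<close>)

lemma terminal_unique:
  assumes "terminal C T" "f \<in> homset C A T" "g \<in> homset C A T"
  shows "f = g"
proof -
  have "A \<in> Obj C" using homset_Obj[OF assms(2)] by simp
  then have "\<exists>!f. f \<in> homset C A T" using assms(1) by (simp add: terminal_def)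
  then show ?thesis using assms(2,3) by blast
qed

text \<open>A Yoneda argument: the pair of projections of \<open>R\<close> is its generic
  point.\<close>

lemma rel_le_iff:
  assumes "int_rel C X R" "int_rel C X S"
  shows "rel_le C R S \<longleftrightarrow> rel_points R \<subseteq> rel_points S"
proof
  note S = int_relD[OF assms(2)]
  assume "rel_le C R S"
  then obtain h where h: "h \<in> Arr C" "Dom C h = Dom C (fst R)" "Cod C h = Dom C (fst S)"
    "fst S \<odot> h = fst R" "snd S \<odot> h = snd R" by (auto simp: rel_le_def homset_iff)
  have "(x, y) \<in> rel_points S" if xy: "(x, y) \<in> rel_points R" for x y
  proof -
    obtain k where k: "k \<in> Arr C" "Dom C k = Dom C x" "Cod C k = Dom C (fst R)" "fst R \<odot> k = x" "snd R \<odot> k = y"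
      using xy by (auto simp: in_rel_points related_def homset_iff)
    have "fst S \<odot> (h \<odot> k) = x" "snd S \<odot> (h \<odot> k) = y"
      using Comp_extend1[OF h(4), of k] Comp_extend1[OF h(5), of k] h k S by simp_all
    then show ?thesis
      unfolding in_rel_points related_def
      by (intro bexI[of _ "h \<odot> k"]) (use h k in \<open>auto simp: homset_iff\<close>)
  qed
  then show "rel_points R \<subseteq> rel_points S" by auto
next
  assume "rel_points R \<subseteq> rel_points S"
  then have "related C S (fst R) (snd R)"
    using int_rel_related[OF assms(1)] by (metis in_rel_points subsetD)
  then show "rel_le C R S" by (auto simp: related_def rel_le_def)
qed

end

section \<open>Bounds and meets of congruences\<close>

context regular_category
begin

definition product_cone :: "'o \<Rightarrow> 'o \<Rightarrow> 'm \<Rightarrow> 'm \<Rightarrow> bool" where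
  "product_cone A B s t \<longleftrightarrow> s \<in> Arr C \<and> t \<in> Arr C \<and> Dom C t = Dom C s \<and> Cod C s = A \<and> Cod C t = B \<and>
     (\<forall>x y. x \<in> Arr C \<longrightarrow> y \<in> Arr C \<longrightarrow> Dom C x = Dom C y \<longrightarrow> Cod C x = A \<longrightarrow> Cod C y = B \<longrightarrow>
       (\<exists>h\<in>Arr C. Dom C h = Dom C x \<and> Cod C h = Dom C s \<and> s \<odot> h = x \<and> t \<odot> h = y)) \<and>
     (\<forall>h k. h \<in> Arr C \<longrightarrow> k \<in> Arr C \<longrightarrow> Dom C h = Dom C k \<longrightarrow> Cod C h = Dom C s \<longrightarrow> Cod C k = Dom C s \<longrightarrow>
       s \<odot> h = s \<odot> k \<longrightarrow> t \<odot> h = t \<odot> k \<longrightarrow> h = k)"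

lemma product_coneD:
  assumes "product_cone A B s t"
  shows "s \<in> Arr C" "t \<in> Arr C" "Dom C t = Dom C s" "Cod C s = A" "Cod C t = B"
    and "x \<in> Arr C \<Longrightarrow> y \<in> Arr C \<Longrightarrow> Dom C x = Dom C y \<Longrightarrow> Cod C x = A \<Longrightarrow> Cod C y = B \<Longrightarrow>
      \<exists>h\<in>Arr C. Dom C h = Dom C x \<and> Cod C h = Dom C s \<and> s \<odot> h = x \<and> t \<odot> h = y"
    and "h \<in> Arr C \<Longrightarrow> k \<in> Arr C \<Longrightarrow> Dom C h = Dom C k \<Longrightarrow> Cod C h = Dom C s \<Longrightarrow> Cod C k = Dom C s \<Longrightarrow>
      s \<odot> h = s \<odot> k \<Longrightarrow> t \<odot> h = t \<odot> k \<Longrightarrow> h = k"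
  using assms unfolding product_cone_def by blast+

lemma product_ex:
  assumes "A \<in> Obj C" "B \<in> Obj C"
  obtains s t where "product_cone A B s t"
proof -
  obtain T where T: "terminal C T" using has_terminal by blast
  then have ex: "\<exists>!f. f \<in> homset C D T" if "D \<in> Obj C" for D
    using that by (auto simp: terminal_def)
  obtain f g where fg: "f \<in> homset C A T" "g \<in> homset C B T" using ex assms by blast
  obtain s t where pb: "pullback C f g s t" using has_pullbacks[of f g] fg by (auto simp: homset_iff)
  note pbD = pullbackD[OF pb]
  have "product_cone A B s t"
    unfolding product_cone_def
  proof (intro conjI allI impI)
    show "s \<in> Arr C" "t \<in> Arr C" "Dom C t = Dom C s" "Cod C s = A" "Cod C t = B"
      using pbD fg by (auto simp: homset_iff)
    fix x y assume xy: "x \<in> Arr C" "y \<in> Arr C" "Dom C x = Dom C y" "Cod C x = A" "Cod C y = B"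
    have "f \<odot> x \<in> homset C (Dom C x) T" "g \<odot> y \<in> homset C (Dom C x) T"
      using xy fg by (auto simp: homset_iff)
    then have "f \<odot> x = g \<odot> y" by (rule terminal_unique[OF T])
    then obtain h where "h \<in> Arr C" "Dom C h = Dom C x" "Cod C h = Dom C s" "s \<odot> h = x" "t \<odot> h = y"
      using pullback_fill[OF pb, of x y] xy fg by (metis homset_iff)
    then show "\<exists>h\<in>Arr C. Dom C h = Dom C x \<and> Cod C h = Dom C s \<and> s \<odot> h = x \<and> t \<odot> h = y" by blast
  qed (rule pullback_cancel[OF pb])
  then show ?thesis by (rule that)
qed

text \<open>The kernel of the morphism to the terminal object.\<close>

lemma pairs_congruence:
  assumes "X \<in> Obj C"
  shows "pairs X \<in> congruences X"
proof -
  obtain T where T: "terminal C T" using has_terminal by blast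
  then have ex: "\<exists>!f. f \<in> homset C D T" if "D \<in> Obj C" for D
    using that by (auto simp: terminal_def)
  obtain f where f: "f \<in> Arr C" "Dom C f = X" "Cod C f = T" using ex[OF assms] by (auto simp: homset_iff)
  have eq: "f \<odot> x = f \<odot> y" if "(x, y) \<in> pairs X" for x y
  proof -
    have "f \<odot> x \<in> homset C (Dom C x) T" "f \<odot> y \<in> homset C (Dom C x) T"
      using that f by (auto simp: homset_iff)
    then show ?thesis by (rule terminal_unique[OF T])
  qed
  have "(x, y) \<in> pairs X \<longleftrightarrow> (x, y) \<in> kernel_rel f" for x y
    unfolding in_kernel_rel f(2) using eq by blast
  then have "pairs X = kernel_rel f" by auto
  then show ?thesis using kernel_rel_congruence[OF f(1)] f by simp
qed

text \<open>The kernel of the pairing of \<open>f\<close> and \<open>g\<close> into the product of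
  their codomains.\<close>

lemma Int_congruence:
  assumes "A \<in> congruences X" "B \<in> congruences X"
  shows "A \<inter> B \<in> congruences X"
proof -
  obtain f where f: "f \<in> Arr C" "Dom C f = X" "A = kernel_rel f" using assms(1) by (rule congruencesE)
  obtain g where g: "g \<in> Arr C" "Dom C g = X" "B = kernel_rel g" using assms(2) by (rule congruencesE)
  obtain s t where prod: "product_cone (Cod C f) (Cod C g) s t"
    by (rule product_ex[of "Cod C f" "Cod C g"]) (use f g in auto)
  note st = product_coneD[OF prod]
  obtain h where h: "h \<in> Arr C" "Dom C h = X" "Cod C h = Dom C s" "s \<odot> h = f" "t \<odot> h = g"
    using st(6)[of f g] f g by auto
  have "h \<odot> x = h \<odot> y \<longleftrightarrow> f \<odot> x = f \<odot> y \<and> g \<odot> x = g \<odot> y" if "(x, y) \<in> pairs X" for x y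
  proof -
    have sh: "s \<odot> (h \<odot> x) = f \<odot> x" "s \<odot> (h \<odot> y) = f \<odot> y" "t \<odot> (h \<odot> x) = g \<odot> x" "t \<odot> (h \<odot> y) = g \<odot> y"
      using that h st(1-5) Comp_extend1[OF h(4)] Comp_extend1[OF h(5)] by auto
    show ?thesis
    proof
      assume "h \<odot> x = h \<odot> y"
      then show "f \<odot> x = f \<odot> y \<and> g \<odot> x = g \<odot> y" using sh by metis
    next
      assume "f \<odot> x = f \<odot> y \<and> g \<odot> x = g \<odot> y"
      then show "h \<odot> x = h \<odot> y"
        using sh by - (rule st(7), use that h(1-3) in simp_all)
    qed
  qed
  then have "A \<inter> B = kernel_rel h" using f g h by (auto simp: kernel_rel_def)
  then show ?thesis using kernel_rel_congruence[OF h(1)] h by simp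
qed

lemma bot_congruence:
  assumes "X \<in> Obj C" "A \<in> congruences X"
  shows "kernel_rel (Ident C X) \<subseteq> A"
proof (rule subrelI)
  fix x y assume "(x, y) \<in> kernel_rel (Ident C X)"
  then have xy: "x \<in> Arr C" "y \<in> Arr C" "Cod C x = X" "Cod C y = X" "Ident C X \<odot> x = Ident C X \<odot> y"
    using assms(1) by (simp_all add: in_kernel_rel)
  then have "x = y" by simp
  with xy show "(x, y) \<in> A" using congruence_refl[OF assms(2)] by simp
qed

text \<open>The kernel pair represents \<open>A\<close>; this supplies elements of
  \<open>eq_lattice\<close> with prescribed points.\<close>

lemma kernel_equivalence:
  assumes "A \<in> congruences X"
  obtains R where "equivalence_rel C X R" "rel_points R = A"
proof -
  obtain f where f: "f \<in> Arr C" "Dom C f = X" "A = kernel_rel f" using assms by (rule congruencesE)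
  obtain p q where pb: "pullback C f f p q" using has_pullbacks f by blast
  note pbD = pullbackD[OF pb]
  have rel: "related C (p, q) x y \<longleftrightarrow> (x, y) \<in> A" for x y
    using kernel_pair_points[OF pb] f(3) by (metis in_rel_points)
  have "int_rel C X (p, q)"
    unfolding int_rel_def using pbD f by (auto simp: homset_iff intro: pullback_cancel[OF pb])
  then have "equivalence_rel C X (p, q)"
    unfolding equivalence_rel_def reflexive_rel_def rel
    by (intro conjI ballI impI)
      (auto simp: homset_iff intro: congruence_refl[OF assms] congruence_sym[OF assms] congruence_trans[OF assms])
  then show ?thesis using that kernel_pair_points[OF pb] f by simp
qed

end

lemma equivalence_rel_int_rel: "equivalence_rel C X R \<Longrightarrow> int_rel C X R"
  by (simp add: equivalence_rel_def reflexive_rel_def)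

lemma (in exact_category) rel_points_congruence:
  assumes "equivalence_rel C X R"
  shows "rel_points R \<in> congruences X"
proof -
  obtain f where pb: "pullback C f f (fst R) (snd R)" using effective[OF assms] by blast
  note pbD = pullbackD[OF pb]
  have "Dom C f = X"
    using int_relD(4)[OF equivalence_rel_int_rel[OF assms]] pbD(7) by simp
  then show ?thesis
    using kernel_pair_points[OF pb] kernel_rel_congruence[OF pbD(1)] by simp
qed

section \<open>Composites of congruences as joins\<close>

context exact_maltsev_category
begin

text \<open>The image of the composite of two equivalence relations is reflexive, hence an
  equivalence relation by the Mal'tsev property.\<close>

lemma local_join_congruence:
  assumes X: "X \<in> Obj C" and A: "A \<in> congruences X" and B: "B \<in> congruences X"
  shows "local_join X A B \<in> congruences X"
proof -
  obtain f where f: "f \<in> Arr C" "Dom C f = X" "A = kernel_rel f" using A by (rule congruencesE)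
  obtain g where g: "g \<in> Arr C" "Dom C g = X" "B = kernel_rel g" using B by (rule congruencesE)
  obtain p1 q1 where pb1: "pullback C f f p1 q1" using has_pullbacks f by blast
  obtain p2 q2 where pb2: "pullback C g g p2 q2" using has_pullbacks g by blast
  note 1 = pullbackD[OF pb1] and 2 = pullbackD[OF pb2]
  have cod: "Cod C p1 = X" "Cod C q1 = X" "Cod C p2 = X" "Cod C q2 = X" using 1 2 f g by simp_all
  \<comment> \<open>The points of this pullback are the triples \<open>x\<close>, \<open>z\<close>,
    \<open>y\<close> with \<open>(x, z) \<in> A\<close> and \<open>(z, y) \<in> B\<close>.\<close>
  obtain u v where pb3: "pullback C q1 p2 u v" using has_pullbacks[of q1 p2] 1 2 cod by auto
  note 3 = pullbackD[OF pb3]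
  obtain s t where prod: "product_cone X X s t" by (rule product_ex[OF X X])
  note st = product_coneD[OF prod]
  obtain w where w: "w \<in> Arr C" "Dom C w = Dom C u" "Cod C w = Dom C s" "s \<odot> w = p1 \<odot> u" "t \<odot> w = q2 \<odot> v"
    using st(6)[of "p1 \<odot> u" "q2 \<odot> v"] 1 2 3 cod by auto
  \<comment> \<open>The span of outer legs is in general not jointly monic; its image in the product
    of \<open>X\<close> with itself is.\<close>
  obtain m c where mc: "regular_epi C c" "monic m" "w = m \<odot> c" "Dom C c = Dom C w"
    "Dom C m = Cod C c" "Cod C m = Cod C w" by (rule image_factorisation[OF w(1)])
  have m: "m \<in> Arr C" and c: "c \<in> Arr C" using mc by (auto simp: monic_def)
  have dom_c: "Dom C c = Dom C u" and cod_m: "Cod C m = Dom C s" using mc(4,6) w by simp_all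
  have smc: "(s \<odot> m) \<odot> c = p1 \<odot> u" "(t \<odot> m) \<odot> c = q2 \<odot> v"
    using w(4,5) m c mc(5) cod_m st(1-5) unfolding mc(3) by simp_all
  let ?Q = "(s \<odot> m, t \<odot> m)"
  have sm: "s \<odot> m \<in> Arr C" "t \<odot> m \<in> Arr C" "Dom C (s \<odot> m) = Dom C m" "Dom C (t \<odot> m) = Dom C m"
    "Cod C (s \<odot> m) = X" "Cod C (t \<odot> m) = X" using m cod_m st by simp_all
  have composite: "related C ?Q x y" if "(x, z) \<in> A" "(z, y) \<in> B" for x y z
  proof -
    have "(x, z) \<in> rel_points (p1, q1)" "(z, y) \<in> rel_points (p2, q2)"
      using that f(3) g(3) kernel_pair_points[OF pb1] kernel_pair_points[OF pb2] by simp_all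
    then obtain h1 h2 where h: "h1 \<in> Arr C" "Dom C h1 = Dom C x" "Cod C h1 = Dom C p1" "p1 \<odot> h1 = x" "q1 \<odot> h1 = z"
      "h2 \<in> Arr C" "Dom C h2 = Dom C z" "Cod C h2 = Dom C p2" "p2 \<odot> h2 = z" "q2 \<odot> h2 = y"
      by (auto simp: in_rel_points related_def homset_iff)
    have "Dom C x = Dom C z" using that(1) f by (auto simp: in_kernel_rel)
    then obtain l where l: "l \<in> Arr C" "Dom C l = Dom C h1" "Cod C l = Dom C u" "u \<odot> l = h1" "v \<odot> l = h2"
      using pullback_fill[OF pb3, of h1 h2] h 1 2 by metis
    have "(s \<odot> m) \<odot> (c \<odot> l) = p1 \<odot> (u \<odot> l)"
      by (rule Comp_extend[OF smc(1)]) (use 1 3 l sm m c dom_c mc(5) in auto)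
    moreover have "(t \<odot> m) \<odot> (c \<odot> l) = q2 \<odot> (v \<odot> l)"
      by (rule Comp_extend[OF smc(2)]) (use 2 3 l sm m c dom_c mc(5) in auto)
    moreover have "c \<odot> l \<in> homset C (Dom C x) (Dom C (s \<odot> m))"
      using l h c dom_c sm mc(5) by (simp add: homset_iff)
    ultimately show ?thesis unfolding related_def fst_conv snd_conv l h by blast
  qed
  have "int_rel C X ?Q"
    unfolding int_rel_def fst_conv snd_conv sm
  proof (intro conjI ballI impI)
    fix T h k assume hk: "h \<in> homset C T (Dom C m)" "k \<in> homset C T (Dom C m)"
      "(s \<odot> m) \<odot> h = (s \<odot> m) \<odot> k \<and> (t \<odot> m) \<odot> h = (t \<odot> m) \<odot> k"
    have "m \<odot> h = m \<odot> k"
      by (rule st(7)) (use hk m cod_m st(1-5) in \<open>auto simp: homset_iff\<close>)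
    then show "h = k"
      using hk by - (rule monicD[OF mc(2)], auto simp: homset_iff)
  qed (use sm in \<open>auto simp: homset_iff\<close>)
  moreover have "related C ?Q x x" if "x \<in> homset C T X" for x T
    using that composite congruence_refl[OF A] congruence_refl[OF B] unfolding homset_iff by blast
  ultimately have "reflexive_rel C X ?Q" by (simp add: reflexive_rel_def)
  then have Q: "rel_points ?Q \<in> congruences X"
    by (intro rel_points_congruence maltsev)
  have "local_join X A B = rel_points ?Q"
  proof (intro equalityI subrelI)
    fix x y assume "(x, y) \<in> local_join X A B"
    then obtain e z where e: "(x, y) \<in> pairs X" "regular_epi C e" "Cod C e = Dom C x" "(x \<odot> e, z) \<in> A" "(z, y \<odot> e) \<in> B"
      by (auto simp: local_join_def)
    have "(x \<odot> e, y \<odot> e) \<in> rel_points ?Q" using composite[OF e(4,5)] by (simp add: in_rel_points)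
    then show "(x, y) \<in> rel_points ?Q" by (rule congruence_descend[OF Q e(2,1,3)])
  next
    fix x y assume xy: "(x, y) \<in> rel_points ?Q"
    then obtain h where h: "h \<in> Arr C" "Dom C h = Dom C x" "Cod C h = Dom C m"
      "(s \<odot> m) \<odot> h = x" "(t \<odot> m) \<odot> h = y"
      unfolding in_rel_points related_def fst_conv snd_conv sm by (metis homset_iff)
    \<comment> \<open>A point of the image lifts to the object of triples only after a cover; this
      is the cover in \<open>local_join\<close>.\<close>
    obtain e a where e: "regular_epi C e" "Cod C e = Dom C h" "a \<in> Arr C" "Dom C a = Dom C e"
      "Cod C a = Dom C c" "c \<odot> a = h \<odot> e"
      by (rule regular_epi_pullback[OF mc(1) h(1)]) (use h mc(5) in auto)
    have eA: "e \<in> Arr C" using e(1) by simp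
    have "x \<odot> e = (s \<odot> m) \<odot> (h \<odot> e)" "y \<odot> e = (t \<odot> m) \<odot> (h \<odot> e)"
      using Comp_extend1[OF h(4), of e] Comp_extend1[OF h(5), of e] h eA e(2) sm by auto
    moreover have "(s \<odot> m) \<odot> (c \<odot> a) = p1 \<odot> (u \<odot> a)"
      by (rule Comp_extend[OF smc(1)]) (use 1 3 e sm m c dom_c mc(5) in auto)
    moreover have "(t \<odot> m) \<odot> (c \<odot> a) = q2 \<odot> (v \<odot> a)"
      by (rule Comp_extend[OF smc(2)]) (use 2 3 e sm m c dom_c mc(5) in auto)
    ultimately have xe: "x \<odot> e = p1 \<odot> (u \<odot> a)" "y \<odot> e = q2 \<odot> (v \<odot> a)" using e(6) by simp_all
    have ua: "u \<odot> a \<in> Arr C" "Cod C (u \<odot> a) = Dom C p1" "v \<odot> a \<in> Arr C" "Cod C (v \<odot> a) = Dom C p2"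
      "Dom C (u \<odot> a) = Dom C (v \<odot> a)"
      using e dom_c 1 2 3 by simp_all
    have "q1 \<odot> (u \<odot> a) = p2 \<odot> (v \<odot> a)"
      by (rule Comp_extend[OF 3(9)]) (use 1 2 3 e dom_c in auto)
    moreover have "(x \<odot> e, q1 \<odot> (u \<odot> a)) \<in> A"
      unfolding xe f(3) kernel_pair_points[OF pb1, symmetric] in_rel_points related_def
      by (rule bexI[of _ "u \<odot> a"]) (use ua 1 in \<open>auto simp: homset_iff\<close>)
    moreover have "(p2 \<odot> (v \<odot> a), y \<odot> e) \<in> B"
      unfolding xe g(3) kernel_pair_points[OF pb2, symmetric] in_rel_points related_def
      by (rule bexI[of _ "v \<odot> a"]) (use ua 2 in \<open>auto simp: homset_iff\<close>)
    moreover have "(x, y) \<in> pairs X" using xy congruence_pairs[OF Q] by blast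
    ultimately show "(x, y) \<in> local_join X A B"
      unfolding local_join_def using e(1,2) h(2) by auto
  qed
  then show ?thesis using Q by simp
qed

text \<open>\<open>local_join\<close> is the join because it is itself a congruence: it contains
  both arguments by reflexivity, and any common upper bound contains it by transitivity and descent
  along the cover.\<close>

lemma modular_set_lattice_congruences:
  assumes X: "X \<in> Obj C"
  shows "modular_set_lattice (congruences X) (pairs X) (local_join X)"
proof
  show "pairs X \<in> congruences X" by (rule pairs_congruence[OF X])
  show "\<exists>B\<in>congruences X. \<forall>A\<in>congruences X. B \<subseteq> A"
    using bot_congruence[OF X] kernel_rel_congruence[of "Ident C X"] X by auto
next
  fix A B assume A: "A \<in> congruences X" and B: "B \<in> congruences X"
  show "A \<inter> B \<in> congruences X" by (rule Int_congruence[OF A B])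
  show "local_join X A B \<in> congruences X" by (rule local_join_congruence[OF X A B])
  have joinI: "(x, y) \<in> local_join X A B" if "(x, y) \<in> pairs X" "(x, z) \<in> A" "(z, y) \<in> B" for x y z
  proof -
    have "\<exists>e z. regular_epi C e \<and> Cod C e = Dom C x \<and> (x \<odot> e, z) \<in> A \<and> (z, y \<odot> e) \<in> B"
      by (rule exI[of _ "Ident C (Dom C x)"], rule exI[of _ z]) (use that in \<open>simp add: regular_epi_Ident\<close>)
    then show ?thesis using that(1) by (simp add: local_join_def)
  qed
  show "A \<subseteq> local_join X A B"
  proof (rule subrelI)
    fix x y assume "(x, y) \<in> A"
    then show "(x, y) \<in> local_join X A B"
      using congruence_pairs[OF A] congruence_refl[OF B, of y] by (intro joinI[of x y y]) auto
  qed
  show "B \<subseteq> local_join X A B"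
  proof (rule subrelI)
    fix x y assume "(x, y) \<in> B"
    then show "(x, y) \<in> local_join X A B"
      using congruence_pairs[OF B] congruence_refl[OF A, of x] by (intro joinI[of x y x]) auto
  qed
next
  fix A B E assume E: "E \<in> congruences X" and "A \<subseteq> E" "B \<subseteq> E"
  show "local_join X A B \<subseteq> E"
  proof (rule subrelI)
    fix x y assume "(x, y) \<in> local_join X A B"
    then obtain e z where e: "(x, y) \<in> pairs X" "regular_epi C e" "Cod C e = Dom C x" "(x \<odot> e, z) \<in> A" "(z, y \<odot> e) \<in> B"
      by (auto simp: local_join_def)
    then have "(x \<odot> e, y \<odot> e) \<in> E" using \<open>A \<subseteq> E\<close> \<open>B \<subseteq> E\<close> congruence_trans[OF E] by blast
    then show "(x, y) \<in> E" by (rule congruence_descend[OF E e(2,1,3)])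
  qed
next
  fix A B E assume E: "E \<in> congruences X" and "A \<subseteq> E"
  show "local_join X A B \<inter> E \<subseteq> local_join X A (B \<inter> E)"
  proof (rule subrelI)
    fix x y assume "(x, y) \<in> local_join X A B \<inter> E"
    then obtain e z where e: "(x, y) \<in> pairs X" "regular_epi C e" "Cod C e = Dom C x" "(x \<odot> e, z) \<in> A" "(z, y \<odot> e) \<in> B"
      and xy: "(x, y) \<in> E"
      by (auto simp: local_join_def)
    have "(x \<odot> e, y \<odot> e) \<in> E" using congruence_precomp[OF E xy] e(2,3) by simp
    \<comment> \<open>The heart of modularity: since \<open>A \<subseteq> E\<close>, the middle
      element is \<open>E\<close>-related to both ends, so the second half of the composite lies in
      \<open>B \<inter> E\<close>.\<close>
    moreover have "(z, x \<odot> e) \<in> E" using e(4) \<open>A \<subseteq> E\<close> congruence_sym[OF E] by blast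
    ultimately have "(z, y \<odot> e) \<in> E" using congruence_trans[OF E] by blast
    then show "(x, y) \<in> local_join X A (B \<inter> E)"
      using e unfolding local_join_def by blast
  qed
qed (rule congruence_pairs)

end

section \<open>The lattice of internal equivalence relations through its points\<close>

locale equivalence_tuple = exact_maltsev_category C for C :: "('o, 'm) cat" (structure) +
  fixes X :: 'o and n :: nat and R :: "nat \<Rightarrow> 'm \<times> 'm"
  assumes X: "X \<in> Obj C"
    and R: "i < n \<Longrightarrow> equivalence_rel C X (R i)"
begin

sublocale M: modular_family "congruences X" "pairs X" "local_join X" "\<lambda>i. rel_points (R i)" n
proof -
  interpret modular_set_lattice "congruences X" "pairs X" "local_join X"
    by (rule modular_set_lattice_congruences[OF X])
  show "modular_family (congruences X) (pairs X) (local_join X) (\<lambda>i. rel_points (R i)) n"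
    by unfold_locales (rule rel_points_congruence[OF R])
qed

abbreviation "L \<equiv> eq_lattice C X"

lemma eq_lattice_simps [simp]:
  "carrier L = {R. equivalence_rel C X R}" "le L = rel_le C"
  by (simp_all add: eq_lattice_def)

lemma rel_le_points:
  "S \<in> carrier L \<Longrightarrow> T \<in> carrier L \<Longrightarrow> rel_le C S T \<longleftrightarrow> rel_points S \<subseteq> rel_points T"
  by (rule rel_le_iff[OF equivalence_rel_int_rel equivalence_rel_int_rel]) simp_all

lemma eq_points:
  "S \<in> carrier L \<Longrightarrow> T \<in> carrier L \<Longrightarrow> S .=\<^bsub>L\<^esub> T \<longleftrightarrow> rel_points S = rel_points T"
  using rel_le_points[of S T] rel_le_points[of T S] by (auto simp: eq_lattice_def)

lemma carrier_points: "S \<in> carrier L \<Longrightarrow> rel_points S \<in> congruences X"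
  using rel_points_congruence by simp

lemma carrier_ex: "A \<in> congruences X \<Longrightarrow> \<exists>R\<in>carrier L. rel_points R = A"
  by (erule kernel_equivalence) auto

text \<open>\<open>\<Sqinter>\<close> is a choice among greatest lower bounds, which are determined
  only up to equivalence of spans. Their points are unique, however, and the universal property of
  \<open>E\<close> both pins them down and shows that a greatest lower bound exists.\<close>

lemma inf_points:
  assumes S: "S \<subseteq> carrier L" and E: "E \<in> congruences X"
    and glb: "\<And>A. A \<in> congruences X \<Longrightarrow> A \<subseteq> E \<longleftrightarrow> (\<forall>R\<in>S. A \<subseteq> rel_points R)"
  shows "\<Sqinter>\<^bsub>L\<^esub>S \<in> carrier L \<and> rel_points (\<Sqinter>\<^bsub>L\<^esub>S) = E"
proof -
  obtain G where G: "G \<in> carrier L" "rel_points G = E" using carrier_ex[OF E] by blast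
  have Lower: "T \<in> Lower L S \<longleftrightarrow> T \<in> carrier L \<and> rel_points T \<subseteq> E" for T
  proof -
    have "T \<in> Lower L S \<longleftrightarrow> T \<in> carrier L \<and> (\<forall>Q\<in>S. rel_le C T Q)"
      using S unfolding Lower_def eq_lattice_simps(2) by blast
    moreover have "(\<forall>Q\<in>S. rel_le C T Q) \<longleftrightarrow> rel_points T \<subseteq> E" if T: "T \<in> carrier L"
      unfolding glb[OF carrier_points[OF T]] using rel_le_points[OF T] S by blast
    ultimately show ?thesis by blast
  qed
  have "greatest L G (Lower L S)"
    unfolding greatest_def eq_lattice_simps(2) using G Lower rel_le_points by blast
  then have "greatest L (\<Sqinter>\<^bsub>L\<^esub>S) (Lower L S)"
    unfolding inf_def by (rule someI)
  then have *: "\<Sqinter>\<^bsub>L\<^esub>S \<in> Lower L S" "\<forall>T\<in>Lower L S. rel_le C T (\<Sqinter>\<^bsub>L\<^esub>S)"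
    unfolding greatest_def eq_lattice_simps(2) by (simp_all del: eq_lattice_simps(1))
  have "G \<in> Lower L S" using G Lower by (simp del: eq_lattice_simps(1))
  then have "rel_le C G (\<Sqinter>\<^bsub>L\<^esub>S)" using *(2) by (rule bspec[rotated])
  moreover have "\<Sqinter>\<^bsub>L\<^esub>S \<in> carrier L" using *(1) Lower by (simp del: eq_lattice_simps(1))
  ultimately show ?thesis using G *(1) Lower rel_le_points by (simp del: eq_lattice_simps(1))
qed

lemma sup_points:
  assumes S: "S \<subseteq> carrier L" and E: "E \<in> congruences X"
    and lub: "\<And>A. A \<in> congruences X \<Longrightarrow> E \<subseteq> A \<longleftrightarrow> (\<forall>R\<in>S. rel_points R \<subseteq> A)"
  shows "\<Squnion>\<^bsub>L\<^esub>S \<in> carrier L \<and> rel_points (\<Squnion>\<^bsub>L\<^esub>S) = E"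
proof -
  obtain G where G: "G \<in> carrier L" "rel_points G = E" using carrier_ex[OF E] by blast
  have Upper: "T \<in> Upper L S \<longleftrightarrow> T \<in> carrier L \<and> E \<subseteq> rel_points T" for T
  proof -
    have "T \<in> Upper L S \<longleftrightarrow> T \<in> carrier L \<and> (\<forall>Q\<in>S. rel_le C Q T)"
      using S unfolding Upper_def eq_lattice_simps(2) by blast
    moreover have "(\<forall>Q\<in>S. rel_le C Q T) \<longleftrightarrow> E \<subseteq> rel_points T" if T: "T \<in> carrier L"
      unfolding lub[OF carrier_points[OF T]] using rel_le_points[OF _ T] S by blast
    ultimately show ?thesis by blast
  qed
  have "least L G (Upper L S)"
    unfolding least_def eq_lattice_simps(2) using G Upper rel_le_points by blast
  then have "least L (\<Squnion>\<^bsub>L\<^esub>S) (Upper L S)"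
    unfolding sup_def by (rule someI)
  then have *: "\<Squnion>\<^bsub>L\<^esub>S \<in> Upper L S" "\<forall>T\<in>Upper L S. rel_le C (\<Squnion>\<^bsub>L\<^esub>S) T"
    unfolding least_def eq_lattice_simps(2) by (simp_all del: eq_lattice_simps(1))
  have "G \<in> Upper L S" using G Upper by (simp del: eq_lattice_simps(1))
  then have "rel_le C (\<Squnion>\<^bsub>L\<^esub>S) G" using *(2) by (rule bspec[rotated])
  moreover have "\<Squnion>\<^bsub>L\<^esub>S \<in> carrier L" using *(1) Upper by (simp del: eq_lattice_simps(1))
  ultimately show ?thesis using G *(1) Upper rel_le_points by (simp del: eq_lattice_simps(1))
qed

lemma inf_R:
  assumes "J \<subseteq> {..<n}"
  shows "\<Sqinter>\<^bsub>L\<^esub>(R ` J) \<in> carrier L \<and> rel_points (\<Sqinter>\<^bsub>L\<^esub>(R ` J)) = M.meet J"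
proof (rule inf_points)
  show "R ` J \<subseteq> carrier L" using assms R by auto
  show "M.meet J \<in> congruences X" by (rule M.meet_closed[OF assms])
  show "A \<subseteq> M.meet J \<longleftrightarrow> (\<forall>S\<in>R ` J. A \<subseteq> rel_points S)" if "A \<in> congruences X" for A
    using congruence_pairs[OF that] by (auto simp: M.meet_def simp del: in_pairs)
qed

lemma sup_family:
  assumes "finite I" "\<And>i. i \<in> I \<Longrightarrow> f i \<in> carrier L"
  shows "\<Squnion>\<^bsub>L\<^esub>(f ` I) \<in> carrier L \<and> rel_points (\<Squnion>\<^bsub>L\<^esub>(f ` I)) = M.Join ((\<lambda>i. rel_points (f i)) ` I)"
proof (rule sup_points)
  show "f ` I \<subseteq> carrier L" using assms by auto
  show "M.Join ((\<lambda>i. rel_points (f i)) ` I) \<in> congruences X"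
    using assms(1) carrier_points[OF assms(2)] by (intro M.Join_closed) auto
  show "M.Join ((\<lambda>i. rel_points (f i)) ` I) \<subseteq> A \<longleftrightarrow> (\<forall>R\<in>f ` I. rel_points R \<subseteq> A)"
    if "A \<in> congruences X" for A
  proof
    assume "M.Join ((\<lambda>i. rel_points (f i)) ` I) \<subseteq> A"
    then show "\<forall>R\<in>f ` I. rel_points R \<subseteq> A"
      using M.Join_upper[of _ "(\<lambda>i. rel_points (f i)) ` I"] by blast
  qed (intro M.Join_least that, blast)
qed

lemma meet_points:
  assumes "S \<in> carrier L" "T \<in> carrier L"
  shows "S \<sqinter>\<^bsub>L\<^esub> T \<in> carrier L \<and> rel_points (S \<sqinter>\<^bsub>L\<^esub> T) = rel_points S \<inter> rel_points T"
  unfolding meet_def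
  using assms carrier_points by (intro inf_points Int_congruence) auto

theorem distributive_iff_fully_distributive: "distributive C n X R \<longleftrightarrow> M.fully_distributive"
proof -
  let ?conds = "\<lambda>k (J :: nat \<Rightarrow> nat set). (\<forall>i\<le>k. J i \<subseteq> {..<n}) \<and> disjoint_family_on J {..k}"
  let ?eq = "\<lambda>A P. M.meet A \<inter> M.Join (M.meet ` P) = M.Join ((\<lambda>B. M.meet (A \<union> B)) ` P)"
  have "distributive C n X R \<longleftrightarrow> (\<forall>k\<ge>1. \<forall>J. ?conds k J \<longrightarrow> ?eq (J 0) (J ` {1..k}))"
    unfolding distributive_def Let_def
  proof (intro all_cong imp_cong refl)
    fix k :: nat and J :: "nat \<Rightarrow> nat set" assume J: "?conds k J"
    let ?m = "\<lambda>i. \<Sqinter>\<^bsub>L\<^esub>(R ` J i)" and ?l = "\<lambda>i. \<Sqinter>\<^bsub>L\<^esub>(R ` (J 0 \<union> J i))"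
    let ?s = "\<Squnion>\<^bsub>L\<^esub>(?m ` {1..k})" and ?t = "\<Squnion>\<^bsub>L\<^esub>(?l ` {1..k})"
    have 1: "?m i \<in> carrier L" "rel_points (?m i) = M.meet (J i)"
      "?l i \<in> carrier L" "rel_points (?l i) = M.meet (J 0 \<union> J i)"
      if "i \<le> k" for i
      using inf_R[of "J i"] inf_R[of "J 0 \<union> J i"] J that by auto
    have 2: "?s \<in> carrier L" "rel_points ?s = M.Join (M.meet ` J ` {1..k})"
      using sup_family[of "{1..k}" "?m"] 1 by (auto simp: image_image cong: image_cong_simp)
    have 3: "?t \<in> carrier L" "rel_points ?t = M.Join ((\<lambda>B. M.meet (J 0 \<union> B)) ` J ` {1..k})"
      using sup_family[of "{1..k}" "?l"] 1 by (auto simp: image_image cong: image_cong_simp)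
    have 4: "?m 0 \<sqinter>\<^bsub>L\<^esub> ?s \<in> carrier L"
      "rel_points (?m 0 \<sqinter>\<^bsub>L\<^esub> ?s) = M.meet (J 0) \<inter> M.Join (M.meet ` J ` {1..k})"
      using meet_points[OF 1(1)[of 0] 2(1)] 1(2)[of 0] 2(2) by simp_all
    show "?m 0 \<sqinter>\<^bsub>L\<^esub> ?s .=\<^bsub>L\<^esub> ?t \<longleftrightarrow> ?eq (J 0) (J ` {1..k})"
      unfolding eq_points[OF 4(1) 3(1)] 4(2) 3(2) ..
  qed
  also have "\<dots> \<longleftrightarrow> M.fully_distributive"
  proof
    assume *: "\<forall>k\<ge>1. \<forall>J. ?conds k J \<longrightarrow> ?eq (J 0) (J ` {1..k})"
    show M.fully_distributive
      unfolding M.fully_distributive_def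
    proof (intro allI impI)
      fix A P assume A: "A \<subseteq> {..<n}" "\<Union>P \<subseteq> {..<n}" "A \<inter> \<Union>P = {}" "disjoint P"
      have "finite P" using A(2) M.fin finite_UnionD by blast
      show "M.meet A \<inter> M.Join (M.meet ` P) \<subseteq> M.Join ((\<lambda>B. M.meet (A \<union> B)) ` P)"
      \<comment> \<open>The empty set of blocks escapes the condition \<open>k \<ge> 1\<close>;
        there both sides involve the empty join and the inclusion is immediate.\<close>
      proof (cases "P = {}")
        case False
        define k where "k = card P"
        have k: "k \<ge> 1" using False \<open>finite P\<close> by (simp add: k_def Suc_le_eq card_gt_0_iff)
        \<comment> \<open>The blocks are numbered from \<open>1\<close>, index \<open>0\<close>
          being reserved for the set \<open>A\<close>.\<close>
        obtain h where h: "bij_betw h {1..k} P"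
          using \<open>finite P\<close> ex_bij_betw_nat_finite_1[of P] unfolding k_def by blast
        define J where "J i = (if i = 0 then A else h i)" for i
        have hP: "h i \<in> P" if "i \<in> {1..k}" for i using h that by (auto simp: bij_betw_def)
        have JP: "J ` {1..k} = P" using h by (auto simp: bij_betw_def J_def)
        have "J i \<subseteq> {..<n}" if "i \<le> k" for i
          using A(1,2) hP[of i] that by (cases "i = 0") (auto simp: J_def)
        moreover have "disjoint_family_on J {..k}"
          unfolding disjoint_family_on_def
        proof (intro ballI impI)
          fix i j assume ij: "i \<in> {..k}" "j \<in> {..k}" "i \<noteq> j"
          have "h i \<inter> h j = {}" if "i \<noteq> 0" "j \<noteq> 0"
          proof -
            have "i \<in> {1..k}" "j \<in> {1..k}" using ij that by auto
            then have "h i \<noteq> h j" using bij_betw_imp_inj_on[OF h] ij(3) by (meson inj_onD)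
            then show ?thesis using A(4) hP[of i] hP[of j] ij that by (auto simp: disjoint_def)
          qed
          moreover have "A \<inter> h l = {}" "h l \<inter> A = {}" if "l \<in> {1..k}" for l using A(3) hP[OF that] by blast+
          ultimately show "J i \<inter> J j = {}"
            using ij by (cases "i = 0"; cases "j = 0") (auto simp: J_def)
        qed
        ultimately have "?eq (J 0) (J ` {1..k})" using * k by blast
        then show ?thesis unfolding JP by (simp add: J_def)
      qed simp
    qed
  next
    assume fd: M.fully_distributive
    show "\<forall>k\<ge>1. \<forall>J. ?conds k J \<longrightarrow> ?eq (J 0) (J ` {1..k})"
    proof (intro allI impI)
      fix k :: nat and J :: "nat \<Rightarrow> nat set" assume k: "k \<ge> 1" and J: "?conds k J"
      have dj: "J i \<inter> J j = {}" if "i \<le> k" "j \<le> k" "i \<noteq> j" for i j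
        using J that by (auto simp: disjoint_family_on_def)
      have "J 0 \<subseteq> {..<n}" "\<Union>(J ` {1..k}) \<subseteq> {..<n}" using J by auto
      moreover have "J 0 \<inter> \<Union>(J ` {1..k}) = {}" using dj[of 0] by force
      \<comment> \<open>Distinct sets among the \<open>J i\<close> have distinct indices, so
        repetitions of the empty set do no harm.\<close>
      moreover have "disjoint (J ` {1..k})"
        unfolding disjoint_def
      proof (intro ballI impI)
        fix A B assume AB: "A \<in> J ` {1..k}" "B \<in> J ` {1..k}" "A \<noteq> B"
        then obtain i j where ij: "A = J i" "i \<in> {1..k}" "B = J j" "j \<in> {1..k}" by (elim imageE)
        then have "i \<noteq> j" using AB(3) by auto
        then show "A \<inter> B = {}" using dj ij by simp
      qed
      ultimately show "?eq (J 0) (J ` {1..k})"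
        using fd M.Join_meet_Un_le[of "J 0" "J ` {1..k}"] unfolding M.fully_distributive_def by blast
    qed
  qed
  finally show ?thesis .
qed

end

section \<open>Composite edges from the initial vertex of a cube\<close>

primrec cube_path :: "('o, 'm) cat \<Rightarrow> ('o, 'm) cube \<Rightarrow> nat \<Rightarrow> nat set \<Rightarrow> 'm" where
  "cube_path C F 0 I = Ident C (cvert F {})"
| "cube_path C F (Suc k) I =
     (if k \<in> I then cedge F k (I \<inter> {..<k}) \<odot>\<^bsub>C\<^esub> cube_path C F k I else cube_path C F k I)"

lemma cube_path_empty: "cube_path C F k {} = Ident C (cvert F {})"
  by (induction k) simp_all

lemma cube_path_cong: "I \<inter> {..<k} = I' \<inter> {..<k} \<Longrightarrow> cube_path C F k I = cube_path C F k I'"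
proof (induction k)
  case (Suc k)
  have "k \<in> I \<longleftrightarrow> k \<in> I'" "I \<inter> {..<k} = I' \<inter> {..<k}"
    using Suc.prems by (auto simp: set_eq_iff less_Suc_eq)
  then show ?case using Suc.IH by simp
qed simp

context category
begin

lemma Int_lessThan_Suc:
  fixes k :: nat
  shows "k \<in> I \<Longrightarrow> I \<inter> {..<Suc k} = insert k (I \<inter> {..<k})" "k \<notin> I \<Longrightarrow> I \<inter> {..<Suc k} = I \<inter> {..<k}"
  by (auto simp: less_Suc_eq)

lemma commutative_cubeD:
  assumes "commutative_cube C n F" "I \<subseteq> {..<n}"
  shows "cvert F I \<in> Obj C"
    and "i < n \<Longrightarrow> i \<notin> I \<Longrightarrow> cedge F i I \<in> Arr C"
    and "i < n \<Longrightarrow> i \<notin> I \<Longrightarrow> Dom C (cedge F i I) = cvert F I"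
    and "i < n \<Longrightarrow> i \<notin> I \<Longrightarrow> Cod C (cedge F i I) = cvert F (insert i I)"
    and "i < n \<Longrightarrow> j < n \<Longrightarrow> i \<notin> I \<Longrightarrow> j \<notin> I \<Longrightarrow> i \<noteq> j \<Longrightarrow>
      cedge F j (insert i I) \<odot> cedge F i I = cedge F i (insert j I) \<odot> cedge F j I"
  using assms by (auto simp: commutative_cube_def homset_iff)

lemma cube_path_Arr:
  assumes "commutative_cube C n F" "k \<le> n"
  shows "cube_path C F k I \<in> Arr C" "Dom C (cube_path C F k I) = cvert F {}"
    "Cod C (cube_path C F k I) = cvert F (I \<inter> {..<k})"
proof -
  have "cube_path C F k I \<in> Arr C \<and> Dom C (cube_path C F k I) = cvert F {} \<and>
      Cod C (cube_path C F k I) = cvert F (I \<inter> {..<k})"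
    using assms(2)
  proof (induction k)
    case 0
    then show ?case using commutative_cubeD(1)[OF assms(1), of "{}"] by simp
  next
    case (Suc k)
    have "I \<inter> {..<k} \<subseteq> {..<n}" "k < n" "k \<notin> I \<inter> {..<k}" using Suc.prems by auto
    then show ?case
      using Suc commutative_cubeD(2-4)[OF assms(1), of "I \<inter> {..<k}" k] by (simp add: Int_lessThan_Suc)
  qed
  then show "cube_path C F k I \<in> Arr C" "Dom C (cube_path C F k I) = cvert F {}"
    "Cod C (cube_path C F k I) = cvert F (I \<inter> {..<k})" by simp_all
qed

text \<open>A path inserts its directions in increasing order, so the additional edge has to be
  commuted past all edges in directions above \<open>i\<close>.\<close>

lemma cube_path_insert:
  assumes "commutative_cube C n F" "k \<le> n" "i < k" "i \<notin> I"
  shows "cedge F i (I \<inter> {..<k}) \<odot> cube_path C F k I = cube_path C F k (insert i I)"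
  using assms(2,3)
proof (induction k)
  case (Suc k)
  note D = commutative_cubeD[OF assms(1)] and P = cube_path_Arr[OF assms(1)]
  show ?case
  proof (cases "i = k")
    case True
    then show ?thesis
      using assms(4) cube_path_cong[of "insert k I" k I C F] by (simp add: Int_lessThan_Suc)
  next
    case False
    then have i: "i < k" "k < n" "i < n" "k \<le> n" using Suc.prems by auto
    show ?thesis
    proof (cases "k \<in> I")
      case True
      let ?I = "I \<inter> {..<k}"
      have sub: "?I \<subseteq> {..<n}" "insert i ?I \<subseteq> {..<n}" "insert k ?I \<subseteq> {..<n}" using i by auto
      have ins: "insert i I \<inter> {..<k} = insert i ?I" using i by auto
      have "cedge F i (insert k ?I) \<odot> (cedge F k ?I \<odot> cube_path C F k I) =
          cedge F k (insert i ?I) \<odot> (cedge F i ?I \<odot> cube_path C F k I)"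
        by (rule Comp_extend[OF D(5)]) (use sub i assms(4) D(2-4) P[of k I] in auto)
      also have "cedge F i ?I \<odot> cube_path C F k I = cube_path C F k (insert i I)"
        using Suc.IH i by simp
      finally show ?thesis using True i by (simp add: Int_lessThan_Suc ins)
    next
      case False
      then show ?thesis using Suc.IH i \<open>i \<noteq> k\<close> by (simp add: Int_lessThan_Suc)
    qed
  qed
qed simp

end

section \<open>Quotient cubes and the Chinese remainder theorem\<close>

lemma (in regular_category) regular_epi_cube_path:
  assumes "commutative_cube C n F" "k \<le> n"
    and "\<And>i I. I \<subseteq> {..<n} \<Longrightarrow> i < n \<Longrightarrow> i \<notin> I \<Longrightarrow> regular_epi C (cedge F i I)"
  shows "regular_epi C (cube_path C F k I)"
  using assms(2)
proof (induction k)
  case 0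
  then show ?case using commutative_cubeD(1)[OF assms(1), of "{}"] regular_epi_Ident by simp
next
  case (Suc k)
  have "I \<inter> {..<k} \<subseteq> {..<n}" "k < n" "k \<notin> I \<inter> {..<k}" using Suc.prems by auto
  then show ?case
    using Suc regular_epi_Comp assms(3)[of "I \<inter> {..<k}" k] cube_path_Arr(3)[OF assms(1), of k I]
      commutative_cubeD(3)[OF assms(1), of "I \<inter> {..<k}" k] by simp
qed

section \<open>Kernels of the maps onto the vertices of the quotient cube\<close>

locale quotient_cube = equivalence_tuple C X n R
  for C :: "('o, 'm) cat" (structure) and X n R +
  fixes B :: "('o, 'm) nrel" and F :: "('o, 'm) cube"
  assumes box: "is_box C n X R B" and Coeq: "is_Coeq C n B F"
begin

lemma nvert_box: "nvert B {} = X"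
  and nproj_box: "i < n \<Longrightarrow> nproj B False i {} = fst (R i)" "i < n \<Longrightarrow> nproj B True i {} = snd (R i)"
proof -
  have B: "nvert B {} = X" "\<forall>i<n. nrel_at B i {} = R i"
    using box by (simp_all add: is_box_def nfold_equivalence_on_def)
  then show "nvert B {} = X" by simp
  show "nproj B False i {} = fst (R i)" "nproj B True i {} = snd (R i)" if "i < n"
    using B(2) that by (metis nrel_at_def fst_conv, metis nrel_at_def snd_conv)
qed

text \<open>The canonical map from \<open>X\<close> to the vertex \<open>I\<close>; by
  \<open>kernel_\<pi>\<close> it is the quotient by the join of the relations \<open>R i\<close>
  with \<open>i \<in> I\<close>.\<close>

definition \<pi> :: "nat set \<Rightarrow> 'm" where
  "\<pi> I = cube_path C F n I"

text \<open>The objects \<open>V I J\<close> of \<open>is_Coeq\<close> matter only for \<open>I\<close> empty or a singleton: since the quotient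
  \<open>r\<close> of the object \<open>R i\<close> is epic, the edge in direction \<open>i\<close> at \<open>J\<close> coequalises the image of
  the relation \<open>R i\<close> itself.\<close>

lemma
  shows commutative_F: "commutative_cube C n F"
    and cvert_F: "cvert F {} = X"
    and edge_fork: "J \<subseteq> {..<n} \<Longrightarrow> i < n \<Longrightarrow> i \<notin> J \<Longrightarrow> \<exists>u v r. coequaliser C u v (cedge F i J) \<and>
      regular_epi C r \<and> Cod C r = Dom C u \<and> u \<odot> r = \<pi> J \<odot> fst (R i) \<and> v \<odot> r = \<pi> J \<odot> snd (R i)"
proof -
  obtain V :: "nat set \<Rightarrow> nat set \<Rightarrow> 'o" and d q where
    V0: "\<forall>I\<subseteq>{..<n}. V I {} = nvert B I \<and> (\<forall>i\<in>{..<n} - I. \<forall>b. d b i I {} = nproj B b i I)"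
    and F: "\<forall>J\<subseteq>{..<n}. cvert F J = V {} J \<and> (\<forall>i\<in>{..<n} - J. cedge F i J = q i {} J)"
    and all: "\<forall>I\<subseteq>{..<n}. \<forall>J\<subseteq>{..<n}. I \<inter> J = {} \<longrightarrow>
           V I J \<in> Obj C \<and>
           (\<forall>i\<in>{..<n} - (I \<union> J).
              (\<forall>b. d b i I J \<in> homset C (V (insert i I) J) (V I J)) \<and>
              q i I J \<in> homset C (V I J) (V I (insert i J)) \<and>
              coequaliser C (d False i I J) (d True i I J) (q i I J)) \<and>
           (\<forall>i\<in>{..<n} - (I \<union> J). \<forall>j\<in>{..<n} - (I \<union> J). i \<noteq> j \<longrightarrow>
              (\<forall>b c. d b i I J \<odot> d c j (insert i I) J =
                     d c j I J \<odot> d b i (insert j I) J) \<and>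
              (\<forall>b. q j I J \<odot> d b i I J =
                   d b i I (insert j J) \<odot> q j (insert i I) J) \<and>
              q j I (insert i J) \<odot> q i I J = q i I (insert j J) \<odot> q j I J)"
    using Coeq unfolding is_Coeq_def by (elim exE conjE) (rule that)
  have V: "V I J \<in> Obj C" if "I \<subseteq> {..<n}" "J \<subseteq> {..<n}" "I \<inter> J = {}" for I J
    using all that by simp
  have dq: "d b i I J \<in> homset C (V (insert i I) J) (V I J)" "q i I J \<in> homset C (V I J) (V I (insert i J))"
    "coequaliser C (d False i I J) (d True i I J) (q i I J)"
    if "I \<subseteq> {..<n}" "J \<subseteq> {..<n}" "I \<inter> J = {}" "i < n" "i \<notin> I" "i \<notin> J" for I J i b
    using all that by simp_all
  have qd: "q j I J \<odot> d b i I J = d b i I (insert j J) \<odot> q j (insert i I) J"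
    and qq: "q j I (insert i J) \<odot> q i I J = q i I (insert j J) \<odot> q j I J"
    if "I \<subseteq> {..<n}" "J \<subseteq> {..<n}" "I \<inter> J = {}" "i < n" "i \<notin> I" "i \<notin> J" "j < n" "j \<notin> I" "j \<notin> J" "i \<noteq> j"
    for I J i j b
    using all that by simp_all
  have vF: "cvert F J = V {} J" if "J \<subseteq> {..<n}" for J using F that by simp
  have eF: "cedge F i J = q i {} J" if "J \<subseteq> {..<n}" "i < n" "i \<notin> J" for i J using F that by simp
  show cF: "commutative_cube C n F"
    unfolding commutative_cube_def
  proof (intro conjI allI impI ballI)
    fix I assume I: "I \<subseteq> {..<n}"
    show "cvert F I \<in> Obj C" using V[of "{}" I] vF I by simp
    fix i assume i: "i \<in> {..<n} - I"
    show "cedge F i I \<in> homset C (cvert F I) (cvert F (insert i I))"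
      using dq(2)[of "{}" I i] vF[of I] vF[of "insert i I"] eF[of I i] I i by simp
    fix j assume j: "j \<in> {..<n} - I" "i \<noteq> j"
    show "cedge F j (insert i I) \<odot> cedge F i I = cedge F i (insert j I) \<odot> cedge F j I"
      using qq[of "{}" I i j] eF[of I i] eF[of I j] eF[of "insert i I" j] eF[of "insert j I" i] I i j by simp
  qed
  show vX: "cvert F {} = X" using vF[of "{}"] V0 nvert_box by simp
  show "\<exists>u v r. coequaliser C u v (cedge F i J) \<and> regular_epi C r \<and> Cod C r = Dom C u \<and>
      u \<odot> r = \<pi> J \<odot> fst (R i) \<and> v \<odot> r = \<pi> J \<odot> snd (R i)"
    if J: "J \<subseteq> {..<n}" and i: "i < n" "i \<notin> J" for i J
  proof -
    have path: "\<pi> I \<in> Arr C" "Dom C (\<pi> I) = X" "I \<subseteq> {..<n} \<Longrightarrow> Cod C (\<pi> I) = V {} I" for I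
      using cube_path_Arr[OF cF, of n I] vX vF[of I] by (auto simp: \<pi>_def Int_absorb2)
    have "finite J" using J by (rule M.fin)
    \<comment> \<open>\<open>r\<close> is the composite of the quotient maps \<open>q j {i}\<close>,
      starting from the object of \<open>R i\<close>. It is built along with the path
      \<open>\<pi> J\<close>, one direction at a time.\<close>
    then have "\<exists>r. regular_epi C r \<and> Dom C r = Dom C (fst (R i)) \<and> Cod C r = V {i} J \<and>
      (\<forall>b. d b i {} J \<odot> r = \<pi> J \<odot> d b i {} {})"
      using J i(2)
    proof (induction J rule: finite_induct)
      case empty
      have "V {i} {} \<in> Obj C" using V[of "{i}" "{}"] i by simp
      moreover have "Dom C (fst (R i)) = V {i} {}"
        using dq(1)[of "{}" "{}" i False] V0 nproj_box(1) i by (simp add: homset_iff)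
      moreover have "d b i {} {} \<odot> Ident C (V {i} {}) = \<pi> {} \<odot> d b i {} {}" for b
        using dq(1)[of "{}" "{}" i b] V0 nvert_box i vX by (simp add: \<pi>_def cube_path_empty homset_iff)
      ultimately show ?case
        using regular_epi_Ident[of "V {i} {}"] by (intro exI[of _ "Ident C (V {i} {})"]) simp
    next
      case (insert j J)
      then obtain r where r: "regular_epi C r" "Dom C r = Dom C (fst (R i))" "Cod C r = V {i} J"
        "\<And>b. d b i {} J \<odot> r = \<pi> J \<odot> d b i {} {}" by auto
      have ij: "j < n" "i \<noteq> j" "J \<subseteq> {..<n}" "i \<notin> J" using insert by auto
      have rA: "r \<in> Arr C" using r(1) by simp
      have qj: "q j {i} J \<in> Arr C" "Dom C (q j {i} J) = V {i} J" "Cod C (q j {i} J) = V {i} (insert j J)"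
        "regular_epi C (q j {i} J)"
        using dq(2,3)[of "{i}" J j] ij insert(2) i(1) by (auto simp: homset_iff regular_epi_def)
      have qj0: "q j {} J \<in> Arr C" "Dom C (q j {} J) = V {} J" "Cod C (q j {} J) = V {} (insert j J)"
        using dq(2)[of "{}" J j] ij insert(2) by (auto simp: homset_iff)
      have d: "d b i {} J \<in> Arr C" "Dom C (d b i {} J) = V {i} J" "Cod C (d b i {} J) = V {} J"
        "d b i {} (insert j J) \<in> Arr C" "Dom C (d b i {} (insert j J)) = V {i} (insert j J)"
        "d b i {} {} \<in> Arr C" "Cod C (d b i {} {}) = X" for b
        using dq(1)[of "{}" J i b] dq(1)[of "{}" "insert j J" i b] dq(1)[of "{}" "{}" i b] ij i V0 nvert_box
        by (auto simp: homset_iff)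
      have "d b i {} (insert j J) \<odot> (q j {i} J \<odot> r) = \<pi> (insert j J) \<odot> d b i {} {}" for b
      proof -
        have "d b i {} (insert j J) \<odot> (q j {i} J \<odot> r) = q j {} J \<odot> (d b i {} J \<odot> r)"
          by (rule Comp_extend[OF qd[symmetric]]) (use ij insert(2) i qj qj0 d rA r(3) in auto)
        also have "\<dots> = q j {} J \<odot> (\<pi> J \<odot> d b i {} {})" unfolding r(4) ..
        also have "\<dots> = \<pi> (insert j J) \<odot> d b i {} {}"
        proof (rule Comp_extend1)
          show "q j {} J \<odot> \<pi> J = \<pi> (insert j J)"
            using cube_path_insert[OF cF, of n j J] ij insert(2) eF[of J j]
            by (simp add: \<pi>_def Int_absorb2)
        qed (use qj0 path d ij in auto)
        finally show ?thesis .
      qed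
      moreover have "regular_epi C (q j {i} J \<odot> r)"
        using r(1,3) qj by (intro regular_epi_Comp) simp_all
      ultimately show ?case
        using r(2,3) rA qj by (intro exI[of _ "q j {i} J \<odot> r"]) simp
    qed
    then obtain r where r: "regular_epi C r" "Cod C r = V {i} J" "\<And>b. d b i {} J \<odot> r = \<pi> J \<odot> d b i {} {}"
      by blast
    have "d False i {} {} = fst (R i)" "d True i {} {} = snd (R i)"
      using V0 i nproj_box by simp_all
    moreover have "coequaliser C (d False i {} J) (d True i {} J) (cedge F i J)"
      using dq(3)[of "{}" J i] eF[of J i] J i by simp
    moreover have "Dom C (d False i {} J) = V {i} J" using dq(1)[of "{}" J i False] J i by (simp add: homset_iff)
    ultimately show ?thesis using r by metis
  qed
qed

lemma \<pi>_simps [simp]: "\<pi> I \<in> Arr C" "Dom C (\<pi> I) = X" "I \<subseteq> {..<n} \<Longrightarrow> Cod C (\<pi> I) = cvert F I"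
  using cube_path_Arr[OF commutative_F, of n I] cvert_F by (auto simp: \<pi>_def Int_absorb2)

lemma \<pi>_empty: "\<pi> {} = Ident C X"
  by (simp add: \<pi>_def cube_path_empty cvert_F)

lemma \<pi>_insert: "I \<subseteq> {..<n} \<Longrightarrow> i < n \<Longrightarrow> i \<notin> I \<Longrightarrow> cedge F i I \<odot> \<pi> I = \<pi> (insert i I)"
  using cube_path_insert[OF commutative_F, of n i I] by (simp add: \<pi>_def Int_absorb2)

lemma regular_epi_\<pi>: "regular_epi C (\<pi> I)"
  unfolding \<pi>_def
proof (rule regular_epi_cube_path[OF commutative_F])
  show "regular_epi C (cedge F i I)" if "I \<subseteq> {..<n}" "i < n" "i \<notin> I" for i I
    using edge_fork[OF that] by (auto simp: regular_epi_def)
qed simp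

lemmas cedge_simps [simp] = commutative_cubeD(2-4)[OF commutative_F]

text \<open>A morphism \<open>h\<close> whose kernel is the join identifies what
  \<open>\<pi> J\<close> identifies, hence factors through \<open>\<pi> J\<close>. It also
  identifies the projections of \<open>R i\<close>, hence factors further through the edge, which
  coequalises the image of \<open>R i\<close>. The converse inclusion is the leastness of the
  join.\<close>

lemma kernel_\<pi>_insert:
  assumes J: "J \<subseteq> {..<n}" and i: "i < n" "i \<notin> J"
  shows "kernel_rel (\<pi> (insert i J)) = local_join X (rel_points (R i)) (kernel_rel (\<pi> J))"
proof (rule equalityI)
  let ?A = "local_join X (rel_points (R i)) (kernel_rel (\<pi> J))"
  have K: "rel_points (R i) \<in> congruences X" "kernel_rel (\<pi> I) \<in> congruences X" for I
    using M.r_closed[OF i(1)] kernel_rel_congruence[of "\<pi> I"] by simp_all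
  note Ri = int_relD[OF equivalence_rel_int_rel[OF R[OF i(1)]]]
  obtain u v r where fork: "coequaliser C u v (cedge F i J)" "regular_epi C r" "Cod C r = Dom C u"
    "u \<odot> r = \<pi> J \<odot> fst (R i)" "v \<odot> r = \<pi> J \<odot> snd (R i)" using edge_fork[OF assms] by blast
  note cq = coequaliserD[OF fork(1)]
  have r: "r \<in> Arr C" using fork(2) by simp
  have cod: "Cod C u = cvert F J" using cq(6) J i by simp
  have "?A \<in> congruences X" by (rule M.join_closed[OF K])
  then obtain h where h: "h \<in> Arr C" "Dom C h = X" "?A = kernel_rel h" by (rule congruencesE)
  have sub: "rel_points (R i) \<subseteq> kernel_rel h" "kernel_rel (\<pi> J) \<subseteq> kernel_rel h"
    using M.join_upper1[OF K(1) K(2)[of J]] M.join_upper2[OF K(1) K(2)[of J]] h(3) by simp_all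
  obtain h' where h': "h' \<in> Arr C" "Dom C h' = Cod C (\<pi> J)" "Cod C h' = Cod C h" "h' \<odot> \<pi> J = h"
  proof (rule regular_epi_fill[OF regular_epi_\<pi>[of J] h(1)])
    fix x y assume "x \<in> Arr C" "y \<in> Arr C" "Dom C x = Dom C y" "Cod C x = Dom C (\<pi> J)"
      "Cod C y = Dom C (\<pi> J)" "\<pi> J \<odot> x = \<pi> J \<odot> y"
    then have "(x, y) \<in> kernel_rel (\<pi> J)" by (simp add: in_kernel_rel)
    then show "h \<odot> x = h \<odot> y" using sub(2) by (metis in_kernel_rel subsetD)
  qed (use h in auto)
  have h'J: "Dom C h' = cvert F J" using h'(2) J by simp
  have "(fst (R i), snd (R i)) \<in> kernel_rel h"
    using int_rel_related[OF equivalence_rel_int_rel[OF R[OF i(1)]]] sub(1) by (metis in_rel_points subsetD)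
  then have "h \<odot> fst (R i) = h \<odot> snd (R i)" by (simp only: in_kernel_rel)
  moreover have "(h' \<odot> u) \<odot> r = h \<odot> fst (R i)" "(h' \<odot> v) \<odot> r = h \<odot> snd (R i)"
    using Comp_extend1[OF h'(4), of "fst (R i)"] Comp_extend1[OF h'(4), of "snd (R i)"]
      h' h'J fork cq r cod J Ri by simp_all
  \<comment> \<open>The equation is known after composing with \<open>r\<close>, which covers the
    image of \<open>R i\<close> and is epic.\<close>
  ultimately have "h' \<odot> u = h' \<odot> v"
    by - (rule regular_epi_cancel[OF fork(2)], use h'(1) h'J fork(3) cq cod in simp_all)
  then obtain h'' where h'': "h'' \<in> Arr C" "Dom C h'' = Cod C (cedge F i J)" "h'' \<odot> cedge F i J = h'"
    using coequaliser_fill[OF fork(1) h'(1)] h'J cod by metis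
  have eq: "h'' \<odot> \<pi> (insert i J) = h"
    using Comp_extend1[OF h''(3), of "\<pi> J"] h'' h'(4) \<pi>_insert[OF assms] J i by simp
  show "kernel_rel (\<pi> (insert i J)) \<subseteq> ?A"
  proof (rule subrelI)
    fix x y assume "(x, y) \<in> kernel_rel (\<pi> (insert i J))"
    then have xy: "(x, y) \<in> pairs X" "\<pi> (insert i J) \<odot> x = \<pi> (insert i J) \<odot> y"
      by (simp_all add: in_kernel_rel)
    have dom: "Dom C h'' = Cod C (\<pi> (insert i J))" using h''(2) J i by simp
    have "h \<odot> x = h'' \<odot> (\<pi> (insert i J) \<odot> x)" "h \<odot> y = h'' \<odot> (\<pi> (insert i J) \<odot> y)"
      using Comp_extend1[OF eq, of x] Comp_extend1[OF eq, of y] xy(1) h''(1) dom by simp_all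
    then show "(x, y) \<in> ?A" unfolding h(3) in_kernel_rel h(2) using xy by simp
  qed
  show "?A \<subseteq> kernel_rel (\<pi> (insert i J))"
  proof (rule M.join_least[OF K K(2)])
    show "rel_points (R i) \<subseteq> kernel_rel (\<pi> (insert i J))"
    proof (rule subrelI)
      fix x y assume xy: "(x, y) \<in> rel_points (R i)"
      then have p: "(x, y) \<in> pairs X" using congruence_pairs[OF K(1)] by blast
      obtain k where k: "k \<in> Arr C" "Cod C k = Dom C (fst (R i))" "fst (R i) \<odot> k = x" "snd (R i) \<odot> k = y"
        using xy unfolding in_rel_points related_def by (metis homset_iff)
      have "\<pi> (insert i J) \<odot> fst (R i) = (cedge F i J \<odot> u) \<odot> r" "\<pi> (insert i J) \<odot> snd (R i) = (cedge F i J \<odot> v) \<odot> r"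
        using Comp_extend1[OF \<pi>_insert[OF assms], of "fst (R i)"]
          Comp_extend1[OF \<pi>_insert[OF assms], of "snd (R i)"] Ri fork cq(1-6) r J i by simp_all
      then have "\<pi> (insert i J) \<odot> fst (R i) = \<pi> (insert i J) \<odot> snd (R i)" using cq(7) by simp
      from Comp_extend[OF this, of k] have "\<pi> (insert i J) \<odot> x = \<pi> (insert i J) \<odot> y"
        using Ri k by simp
      then show "(x, y) \<in> kernel_rel (\<pi> (insert i J))" unfolding in_kernel_rel using p by simp
    qed
    show "kernel_rel (\<pi> J) \<subseteq> kernel_rel (\<pi> (insert i J))"
    proof (rule subrelI)
      fix x y assume "(x, y) \<in> kernel_rel (\<pi> J)"
      then have xy: "(x, y) \<in> pairs X" "\<pi> J \<odot> x = \<pi> J \<odot> y" by (simp_all add: in_kernel_rel)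
      have "\<pi> (insert i J) \<odot> x = cedge F i J \<odot> (\<pi> J \<odot> x)" "\<pi> (insert i J) \<odot> y = cedge F i J \<odot> (\<pi> J \<odot> y)"
        using Comp_extend1[OF \<pi>_insert[OF assms], of x] Comp_extend1[OF \<pi>_insert[OF assms], of y] xy(1) J i
        by simp_all
      then show "(x, y) \<in> kernel_rel (\<pi> (insert i J))" unfolding in_kernel_rel using xy by simp
    qed
  qed
qed

lemma kernel_\<pi>: "I \<subseteq> {..<n} \<Longrightarrow> kernel_rel (\<pi> I) = M.sup_of I"
proof (induction I rule: infinite_finite_induct)
  case (infinite I)
  then show ?case using M.fin by blast
next
  case empty
  have K: "kernel_rel (\<pi> {}) \<in> congruences X" using kernel_rel_congruence[of "\<pi> {}"] by simp
  have "M.sup_of {} \<in> congruences X" by (rule M.sup_of_closed) simp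
  then have "kernel_rel (\<pi> {}) \<subseteq> M.sup_of {}" unfolding \<pi>_empty by (rule bot_congruence[OF X])
  moreover have "M.sup_of {} \<subseteq> kernel_rel (\<pi> {})" unfolding M.sup_of_def by (rule M.Join_least[OF K]) simp
  ultimately show ?case by simp
next
  case (insert i I)
  then show ?case using kernel_\<pi>_insert[of I i] M.sup_of_insert[of i I] by simp
qed

lemma \<pi>_eq_iff:
  assumes "I \<subseteq> {..<n}"
  shows "(x, y) \<in> M.sup_of I \<longleftrightarrow> (x, y) \<in> pairs X \<and> \<pi> I \<odot> x = \<pi> I \<odot> y"
  using kernel_\<pi>[OF assms] by (metis in_kernel_rel \<pi>_simps(2))

section \<open>The Chinese remainder condition\<close>

definition solvable :: "nat set \<Rightarrow> nat set \<Rightarrow> 'o \<Rightarrow> (nat \<Rightarrow> 'm) \<Rightarrow> bool" where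
  "solvable I J T u \<longleftrightarrow> (\<exists>e z. regular_epi C e \<and> Cod C e = T \<and> z \<in> homset C (Dom C e) X \<and>
     (\<forall>j\<in>J. (z, u j \<odot> e) \<in> M.sup_of (insert j I)))"

text \<open>The sum of two ideals in the classical compatibility condition becomes the join of the
  two moduli, \<open>M.sup_of (insert k (insert j I))\<close>.\<close>

definition remainder :: "nat set \<Rightarrow> nat set \<Rightarrow> bool" where
  "remainder I J \<longleftrightarrow> (\<forall>T u. T \<in> Obj C \<longrightarrow> (\<forall>j\<in>J. u j \<in> homset C T X) \<longrightarrow>
     (\<forall>j\<in>J. \<forall>k\<in>J. j \<noteq> k \<longrightarrow> (u j, u k) \<in> M.sup_of (insert k (insert j I))) \<longrightarrow> solvable I J T u)"

text \<open>One cover serves a whole finite family: the covers for its members are composed, and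
  earlier lifts are restricted along later covers.\<close>

lemma common_lift:
  assumes "finite J" "I \<subseteq> {..<n}" "J \<subseteq> {..<n}" "T \<in> Obj C" "\<forall>j\<in>J. x j \<in> homset C T (cvert F (insert j I))"
  shows "\<exists>e u. regular_epi C e \<and> Cod C e = T \<and>
    (\<forall>j\<in>J. u j \<in> homset C (Dom C e) X \<and> \<pi> (insert j I) \<odot> u j = x j \<odot> e)"
  using assms(1,3,5)
proof (induction J rule: finite_induct)
  case empty
  then show ?case using regular_epi_Ident[OF assms(4)] assms(4) by (auto intro!: exI[of _ "Ident C T"])
next
  case (insert j J)
  then obtain e u where e: "regular_epi C e" "Cod C e = T"
    "\<forall>k\<in>J. u k \<in> homset C (Dom C e) X \<and> \<pi> (insert k I) \<odot> u k = x k \<odot> e" by auto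
  have eA: "e \<in> Arr C" using e by simp
  have sub: "insert k I \<subseteq> {..<n}" if "k \<in> insert j J" for k using that insert.prems assms(2) by auto
  have xk: "x k \<in> Arr C" "Dom C (x k) = T" "Cod C (x k) = cvert F (insert k I)" if "k \<in> insert j J" for k
    using that insert.prems by (auto simp: homset_iff)
  obtain e' y where e': "regular_epi C e'" "Cod C e' = Dom C (x j \<odot> e)" "y \<in> Arr C" "Dom C y = Dom C e'"
    "Cod C y = Dom C (\<pi> (insert j I))" "\<pi> (insert j I) \<odot> y = (x j \<odot> e) \<odot> e'"
    by (rule regular_epi_pullback[OF regular_epi_\<pi>[of "insert j I"], of "x j \<odot> e"])
      (use xk[of j] eA e(2) sub[of j] in auto)
  have e'A: "e' \<in> Arr C" "Cod C e' = Dom C e" using e'(1,2) xk[of j] eA e(2) by simp_all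
  let ?u = "\<lambda>k. if k = j then y else u k \<odot> e'"
  have "?u k \<in> homset C (Dom C (e \<odot> e')) X \<and> \<pi> (insert k I) \<odot> ?u k = x k \<odot> (e \<odot> e')"
    if k: "k \<in> insert j J" for k
  proof (cases "k = j")
    case True
    then show ?thesis using e' e'A eA e(2) xk[of j] by (simp add: homset_iff)
  next
    case False
    then have u: "u k \<in> Arr C" "Dom C (u k) = Dom C e" "Cod C (u k) = X" "\<pi> (insert k I) \<odot> u k = x k \<odot> e"
      using e(3) k by (auto simp: homset_iff)
    have "\<pi> (insert k I) \<odot> (u k \<odot> e') = x k \<odot> (e \<odot> e')"
      by (rule Comp_extend[OF u(4)]) (use u e'A eA e(2) xk[OF k] in auto)
    then show ?thesis using False u e'A eA by (simp add: homset_iff)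
  qed
  moreover have "regular_epi C (e \<odot> e')" using e(1) e'(1) e'A by (intro regular_epi_Comp)
  ultimately show ?case
    using eA e'A e(2) by (intro exI[of _ "e \<odot> e'"] exI[of _ ?u]) simp
qed

text \<open>The maps \<open>\<pi>\<close> are locally surjective, so after covers elements of the
  vertices come from elements of \<open>X\<close>, and equality at a vertex becomes membership in
  the corresponding join.\<close>

lemma lifting_iff_remainder:
  assumes I: "I \<subseteq> {..<n}" and J: "J \<subseteq> {..<n}" and IJ: "I \<inter> J = {}"
  shows "lifting C F I J \<longleftrightarrow> remainder I J"
proof
  have j: "j < n" "j \<notin> I" "insert j I \<subseteq> {..<n}" if "j \<in> J" for j using that I J IJ by auto
  {
    assume L: "lifting C F I J"
    show "remainder I J"
      unfolding remainder_def
    proof (intro allI impI)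
      fix T u assume T: "T \<in> Obj C" and u: "\<forall>j\<in>J. u j \<in> homset C T X"
        and rel: "\<forall>j\<in>J. \<forall>k\<in>J. j \<noteq> k \<longrightarrow> (u j, u k) \<in> M.sup_of (insert k (insert j I))"
      have uj: "u j \<in> Arr C" "Dom C (u j) = T" "Cod C (u j) = X" if "j \<in> J" for j
        using u that by (auto simp: homset_iff)
      have "compatible C F I J T (\<lambda>j. \<pi> (insert j I) \<odot> u j)"
        unfolding compatible_def
      proof (intro conjI ballI impI)
        show "\<pi> (insert j I) \<odot> u j \<in> homset C T (cvert F (insert j I))" if "j \<in> J" for j
          using uj[OF that] j[OF that] by (simp add: homset_iff)
        fix a b assume ab: "a \<in> J" "b \<in> J" "a \<noteq> b"
        have *: "cedge F b (insert a I) \<odot> (\<pi> (insert a I) \<odot> u a) = \<pi> (insert b (insert a I)) \<odot> u a"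
          if "a \<in> J" "b \<in> J" "a \<noteq> b" for a b
          by (rule Comp_extend1[OF \<pi>_insert]) (use that j[of a] j[of b] uj[of a] in auto)
        have "insert b (insert a I) \<subseteq> {..<n}" using ab j by blast
        then have "\<pi> (insert b (insert a I)) \<odot> u a = \<pi> (insert b (insert a I)) \<odot> u b"
          using rel ab \<pi>_eq_iff by blast
        then show "cedge F b (insert a I) \<odot> (\<pi> (insert a I) \<odot> u a) = cedge F a (insert b I) \<odot> (\<pi> (insert b I) \<odot> u b)"
          using *[of a b] *[of b a] ab by (simp add: insert_commute)
      qed
      then obtain e z where e: "regular_epi C e" "Cod C e = T" "z \<in> homset C (Dom C e) (cvert F I)"
        "\<forall>j\<in>J. cedge F j I \<odot> z = (\<pi> (insert j I) \<odot> u j) \<odot> e"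
        using L T unfolding lifting_def by blast
      have eA: "e \<in> Arr C" and z: "z \<in> Arr C" "Dom C z = Dom C e" "Cod C z = cvert F I"
        using e by (auto simp: homset_iff)
      obtain e' y where e': "regular_epi C e'" "Cod C e' = Dom C z" "y \<in> Arr C" "Dom C y = Dom C e'"
        "Cod C y = Dom C (\<pi> I)" "\<pi> I \<odot> y = z \<odot> e'"
        by (rule regular_epi_pullback[OF regular_epi_\<pi>[of I] z(1)]) (use z I in auto)
      have e'A: "e' \<in> Arr C" "Cod C e' = Dom C e" using e' z by simp_all
      have "(y, u a \<odot> (e \<odot> e')) \<in> M.sup_of (insert a I)" if a: "a \<in> J" for a
      proof -
        note ja = j[OF a] and ua = uj[OF a]
        have "\<pi> (insert a I) \<odot> y = cedge F a I \<odot> (\<pi> I \<odot> y)"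
          using Comp_extend1[OF \<pi>_insert[OF I ja(1,2)], of y] e' I ja by simp
        also have "\<dots> = cedge F a I \<odot> (z \<odot> e')" unfolding e'(6) ..
        also have "\<dots> = (\<pi> (insert a I) \<odot> u a) \<odot> (e \<odot> e')"
          by (rule trans[OF Comp_extend[OF e(4)[rule_format, OF a]]])
            (use z e'A eA e(2) ua ja I in auto)
        also have "\<dots> = \<pi> (insert a I) \<odot> (u a \<odot> (e \<odot> e'))" using ua eA e'A e(2) by simp
        finally show ?thesis
          unfolding \<pi>_eq_iff[OF ja(3)] using e' e'A eA e(2) ua by simp
      qed
      moreover have "regular_epi C (e \<odot> e')" using e(1) e'(1) e'A by (intro regular_epi_Comp)
      ultimately show "solvable I J T u"
        unfolding solvable_def using e(2) eA e'A e' by (intro exI[of _ "e \<odot> e'"] exI[of _ y]) (simp add: homset_iff)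
    qed
  }
  assume C: "remainder I J"
  show "lifting C F I J"
    unfolding lifting_def
  proof (intro ballI allI impI)
    fix T x assume T: "T \<in> Obj C" and x: "compatible C F I J T x"
    have xj: "x j \<in> Arr C" "Dom C (x j) = T" "Cod C (x j) = cvert F (insert j I)" if "j \<in> J" for j
      using x that by (auto simp: compatible_def homset_iff)
    have "\<forall>j\<in>J. x j \<in> homset C T (cvert F (insert j I))" using x by (simp add: compatible_def)
    from common_lift[OF M.fin[OF J] I J T this]
    obtain e u where e: "regular_epi C e" "Cod C e = T"
      "\<forall>j\<in>J. u j \<in> homset C (Dom C e) X \<and> \<pi> (insert j I) \<odot> u j = x j \<odot> e" by blast
    have eA: "e \<in> Arr C" using e by simp
    have uj: "u j \<in> Arr C" "Dom C (u j) = Dom C e" "Cod C (u j) = X" "\<pi> (insert j I) \<odot> u j = x j \<odot> e"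
      if "j \<in> J" for j using e(3) that by (auto simp: homset_iff)
    have "(u a, u b) \<in> M.sup_of (insert b (insert a I))" if ab: "a \<in> J" "b \<in> J" "a \<noteq> b" for a b
    proof -
      have *: "\<pi> (insert b (insert a I)) \<odot> u a = cedge F b (insert a I) \<odot> (x a \<odot> e)"
        if ab: "a \<in> J" "b \<in> J" "a \<noteq> b" for a b
      proof -
        have "cedge F b (insert a I) \<odot> (\<pi> (insert a I) \<odot> u a) = \<pi> (insert b (insert a I)) \<odot> u a"
          by (rule Comp_extend1[OF \<pi>_insert]) (use ab j[of a] j[of b] uj[of a] in auto)
        then show ?thesis using uj(4)[OF ab(1)] by simp
      qed
      have sub: "insert b (insert a I) \<subseteq> {..<n}" using ab j by blast
      have eq: "cedge F b (insert a I) \<odot> x a = cedge F a (insert b I) \<odot> x b"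
        using x ab by (simp add: compatible_def)
      have "cedge F b (insert a I) \<odot> (x a \<odot> e) = cedge F a (insert b I) \<odot> (x b \<odot> e)"
        by (rule Comp_extend[OF eq]) (use ab j[of a] j[of b] xj[of a] xj[of b] eA e(2) in auto)
      then show ?thesis
        unfolding \<pi>_eq_iff[OF sub] using *[of a b] *[of b a] ab uj by (simp add: insert_commute)
    qed
    moreover have "Dom C e \<in> Obj C" using eA by simp
    ultimately obtain e' z where e': "regular_epi C e'" "Cod C e' = Dom C e" "z \<in> homset C (Dom C e') X"
      "\<forall>j\<in>J. (z, u j \<odot> e') \<in> M.sup_of (insert j I)"
      using C e(3) unfolding remainder_def solvable_def by blast
    have e'A: "e' \<in> Arr C" and z: "z \<in> Arr C" "Dom C z = Dom C e'" "Cod C z = X"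
      using e' by (auto simp: homset_iff)
    have "cedge F a I \<odot> (\<pi> I \<odot> z) = x a \<odot> (e \<odot> e')" if a: "a \<in> J" for a
    proof -
      note ja = j[OF a]
      have "cedge F a I \<odot> (\<pi> I \<odot> z) = \<pi> (insert a I) \<odot> z"
        by (rule Comp_extend1[OF \<pi>_insert]) (use I ja z in auto)
      also have "\<dots> = \<pi> (insert a I) \<odot> (u a \<odot> e')" using e'(4) a \<pi>_eq_iff[OF ja(3)] by blast
      also have "\<dots> = x a \<odot> (e \<odot> e')"
        by (rule Comp_extend[OF uj(4)[OF a]]) (use uj[OF a] xj[OF a] eA e'A e' e(2) in auto)
      finally show ?thesis .
    qed
    moreover have "regular_epi C (e \<odot> e')" using e(1) e'(1,2) by (intro regular_epi_Comp)
    ultimately show "\<exists>e z. regular_epi C e \<and> Cod C e = T \<and> z \<in> homset C (Dom C e) (cvert F I) \<and>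
        (\<forall>j\<in>J. cedge F j I \<odot> z = x j \<odot> e)"
      using e(2) eA e'A e'(2) z I by (intro exI[of _ "e \<odot> e'"] exI[of _ "\<pi> I \<odot> z"]) (simp add: homset_iff)
  qed
qed

text \<open>Induction on \<open>I\<close>. The remainder condition is used for
  \<open>insert t J\<close> and a family with two values only. It supplies a middle element
  congruent to one end modulo every \<open>M.sup_of (insert j I)\<close> with
  \<open>j \<in> J\<close>, and to the other modulo \<open>M.sup_of (insert t I)\<close>.\<close>

lemma join_distributive_if_remainder:
  assumes "\<And>I J. I \<subseteq> {..<n} \<Longrightarrow> J \<subseteq> {..<n} \<Longrightarrow> I \<inter> J = {} \<Longrightarrow> J \<noteq> {} \<Longrightarrow> remainder I J"
  shows M.join_distributive
  unfolding M.join_distributive_def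
proof (intro allI impI)
  fix I J assume "I \<subseteq> {..<n}" and J: "J \<subseteq> {..<n}" and "I \<inter> J = {}"
  then have "finite I" using M.fin by simp
  then show "M.meet_of_sups I J \<subseteq> local_join X (M.sup_of I) (M.meet J)"
    using \<open>I \<subseteq> {..<n}\<close> \<open>I \<inter> J = {}\<close>
  proof (induction I rule: finite_induct)
    case empty
    have "M.sup_of {j} = rel_points (R j)" if "j \<in> J" for j using J that by (intro M.sup_of_single) auto
    then have "M.meet_of_sups {} J = M.meet J" by (simp add: M.meet_of_sups_def M.meet_def)
    then show ?case using J by (simp add: M.join_upper2 M.sup_of_closed M.meet_closed)
  next
    case (insert t I)
    have sub: "I \<subseteq> {..<n}" "t < n" "insert t J \<subseteq> {..<n}" "I \<inter> insert t J = {}" "t \<notin> J" "insert t I \<subseteq> {..<n}"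
      using insert J by auto
    note K = M.sup_of_closed[OF sub(1)] M.sup_of_closed[OF sub(6)] M.meet_closed[OF J] M.meet_of_sups_closed[OF sub(1) J]
    show ?case
    proof (cases "J = {}")
      case True
      then have "M.meet J = pairs X" "M.meet_of_sups (insert t I) J = pairs X"
        by (simp_all add: M.meet_def M.meet_of_sups_def)
      then show ?thesis using M.join_upper2[OF K(2,3)] by simp
    next
      case False
      have rem: "remainder I (insert t J)" by (rule assms) (use sub in auto)
      have "M.meet_of_sups (insert t I) J \<subseteq> local_join X (M.meet_of_sups I J) (M.sup_of (insert t I))"
      proof (rule subrelI)
        fix y z assume yz: "(y, z) \<in> M.meet_of_sups (insert t I) J"
        then have p: "(y, z) \<in> pairs X" by (simp add: M.meet_of_sups_def del: in_pairs)
        have yzj: "(y, z) \<in> M.sup_of (insert j (insert t I))" if "j \<in> J" for j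
          using yz that by (simp add: M.meet_of_sups_def)
        \<comment> \<open>Compatibility: two slots with value \<open>y\<close> agree trivially, and
          \<open>(y, z)\<close> lies in the join over \<open>I\<close>, \<open>t\<close> and
          \<open>j\<close> by assumption.\<close>
        let ?u = "\<lambda>j. if j = t then z else y"
        have "(?u j, ?u k) \<in> M.sup_of (insert k (insert j I))"
          if jk: "j \<in> insert t J" "k \<in> insert t J" "j \<noteq> k" for j k
        proof -
          have c: "M.sup_of (insert k (insert j I)) \<in> congruences X"
            using jk sub by (intro M.sup_of_closed) auto
          show ?thesis
            using jk p yzj[of j] yzj[of k] congruence_refl[OF c, of y] congruence_sym[OF c, of y z]
            by (auto simp: insert_commute)
        qed
        moreover have "\<forall>j\<in>insert t J. ?u j \<in> homset C (Dom C y) X" "Dom C y \<in> Obj C"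
          using p by (auto simp: homset_iff)
        ultimately obtain e x where e: "regular_epi C e" "Cod C e = Dom C y" "x \<in> homset C (Dom C e) X"
          "\<forall>j\<in>insert t J. (x, ?u j \<odot> e) \<in> M.sup_of (insert j I)"
          using rem[unfolded remainder_def, rule_format, of "Dom C y" ?u] unfolding solvable_def by blast
        have ye: "(y \<odot> e, x) \<in> M.sup_of (insert j I)" if "j \<in> J" for j
        proof -
          have "M.sup_of (insert j I) \<in> congruences X" using sub that by (intro M.sup_of_closed) auto
          moreover have "j \<noteq> t" using that sub(5) by auto
          then have "(x, y \<odot> e) \<in> M.sup_of (insert j I)" using bspec[OF e(4), of j] that by simp
          ultimately show ?thesis by (rule congruence_sym)
        qed
        then have "(y \<odot> e, x) \<in> M.meet_of_sups I J"
          using p e(1-3) by (auto simp: M.meet_of_sups_def homset_iff)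
        moreover have "(x, z \<odot> e) \<in> M.sup_of (insert t I)" using e(4) by simp
        ultimately show "(y, z) \<in> local_join X (M.meet_of_sups I J) (M.sup_of (insert t I))"
          unfolding local_join_def using p e(1,2) by blast
      qed
      also have "\<dots> \<subseteq> local_join X (M.sup_of (insert t I)) (M.meet J)"
      proof (rule M.join_least[OF K(4,2) M.join_closed[OF K(2,3)]])
        have "M.meet_of_sups I J \<subseteq> local_join X (M.sup_of I) (M.meet J)" using insert.IH sub by auto
        also have "\<dots> \<subseteq> local_join X (M.sup_of (insert t I)) (M.meet J)"
          using K sub by (intro M.join_mono M.sup_of_mono) auto
        finally show "M.meet_of_sups I J \<subseteq> local_join X (M.sup_of (insert t I)) (M.meet J)" .
      qed (rule M.join_upper1[OF K(2,3)])
      finally show ?thesis .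
    qed
  qed
qed

text \<open>The successive solution of the classical proof: a solution \<open>y\<close> for
  \<open>J\<close> is corrected to one for \<open>insert t J\<close>. The discrepancy between
  \<open>y\<close> and \<open>u t\<close> lies in a meet of joins, which join distributivity splits
  into a step within \<open>M.meet J\<close>, harmless for the congruences already solved, and a
  step modulo the new one.\<close>

lemma remainder_if_join_distributive:
  assumes jd: M.join_distributive and I: "I \<subseteq> {..<n}" and J: "J \<subseteq> {..<n}" "I \<inter> J = {}" "J \<noteq> {}"
  shows "remainder I J"
proof -
  have "finite J" using J(1) by (rule M.fin)
  then show ?thesis
    using J(3,1,2)
  proof (induction J rule: finite_ne_induct)
    case (singleton j)
    show ?case
      unfolding remainder_def
    proof (intro allI impI)
      fix T u assume T: "T \<in> Obj C" "\<forall>a\<in>{j}. u a \<in> homset C T X"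
      have "M.sup_of (insert j I) \<in> congruences X" using I singleton by (intro M.sup_of_closed) auto
      from congruence_refl[OF this, of "u j"]
      show "solvable I {j} T u"
        unfolding solvable_def using T regular_epi_Ident[OF T(1)]
        by (intro exI[of _ "Ident C T"] exI[of _ "u j"]) (simp add: homset_iff)
    qed
  next
    case (insert t J)
    have sub: "J \<subseteq> {..<n}" "t < n" "I \<inter> J = {}" "t \<notin> I" "insert t I \<subseteq> {..<n}" "insert t I \<inter> J = {}"
      using insert I by auto
    have subj: "insert j I \<subseteq> {..<n}" "insert j (insert t I) \<subseteq> {..<n}" if "j \<in> J" for j using that sub I by auto
    note K = M.sup_of_closed[OF sub(5)] M.meet_closed[OF sub(1)]
    show ?case
      unfolding remainder_def
    proof (intro allI impI)
      fix T u assume T: "T \<in> Obj C" and u: "\<forall>j\<in>insert t J. u j \<in> homset C T X"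
        and rel: "\<forall>j\<in>insert t J. \<forall>k\<in>insert t J. j \<noteq> k \<longrightarrow> (u j, u k) \<in> M.sup_of (insert k (insert j I))"
      have uj: "u j \<in> Arr C" "Dom C (u j) = T" "Cod C (u j) = X" if "j \<in> insert t J" for j
        using u that by (auto simp: homset_iff)
      obtain e y where e: "regular_epi C e" "Cod C e = T" "y \<in> homset C (Dom C e) X"
        "\<forall>j\<in>J. (y, u j \<odot> e) \<in> M.sup_of (insert j I)"
        using insert.IH[OF sub(1,3)] T u rel unfolding remainder_def solvable_def by (metis insertCI)
      have eA: "e \<in> Arr C" and y: "y \<in> Arr C" "Dom C y = Dom C e" "Cod C y = X"
        using e by (auto simp: homset_iff)
      have "(y, u t \<odot> e) \<in> M.sup_of (insert j (insert t I))" if j: "j \<in> J" for j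
      proof -
        note c = M.sup_of_closed[OF subj(2)[OF j]]
        have "(u j, u t) \<in> M.sup_of (insert j (insert t I))"
          using rel j insert.hyps by (auto simp: insert_commute)
        then have "(u j \<odot> e, u t \<odot> e) \<in> M.sup_of (insert j (insert t I))"
          by (rule congruence_precomp[OF c]) (use eA e(2) uj[of j] j in auto)
        moreover have "M.sup_of (insert j I) \<subseteq> M.sup_of (insert j (insert t I))"
          using subj[OF j] by (intro M.sup_of_mono) auto
        ultimately show ?thesis using e(4) j congruence_trans[OF c] by blast
      qed
      then have "(y, u t \<odot> e) \<in> M.meet_of_sups (insert t I) J"
        using y eA e(2) uj[of t] by (auto simp: M.meet_of_sups_def)
      also have "M.meet_of_sups (insert t I) J \<subseteq> local_join X (M.sup_of (insert t I)) (M.meet J)"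
        using jd sub unfolding M.join_distributive_def by blast
      \<comment> \<open>Permutability reverses the composite, so that the step starting at
        \<open>y\<close> stays within \<open>M.meet J\<close>; the middle element \<open>x\<close>
        is the corrected solution.\<close>
      also have "\<dots> = local_join X (M.meet J) (M.sup_of (insert t I))" by (rule M.join_commute[OF K])
      finally obtain e' x where e': "regular_epi C e'" "Cod C e' = Dom C y"
        "(y \<odot> e', x) \<in> M.meet J" "(x, (u t \<odot> e) \<odot> e') \<in> M.sup_of (insert t I)"
        unfolding local_join_def by blast
      have e'A: "e' \<in> Arr C" "Cod C e' = Dom C e" using e' y by simp_all
      have "(y \<odot> e', x) \<in> pairs X" using e'(3) congruence_pairs[OF K(2)] by blast
      then have x: "x \<in> homset C (Dom C e') X" using y e'A by (auto simp: homset_iff)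
      have "(x, u j \<odot> (e \<odot> e')) \<in> M.sup_of (insert j I)" if j: "j \<in> insert t J" for j
      proof (cases "j = t")
        case True
        then show ?thesis using e'(4) uj[of t] eA e'A e(2) by simp
      next
        case False
        then have j: "j \<in> J" using j by simp
        note c = M.sup_of_closed[OF subj(1)[OF j]]
        have "M.meet J \<subseteq> M.sup_of (insert j I)"
          using M.meet_le[OF j] M.le_sup_of[of j "insert j I"] by auto
        then have "(x, y \<odot> e') \<in> M.sup_of (insert j I)" using e'(3) congruence_sym[OF c] by blast
        moreover have "(y \<odot> e', (u j \<odot> e) \<odot> e') \<in> M.sup_of (insert j I)"
          by (rule congruence_precomp[OF c]) (use e(4) j e'A e'(2) in auto)
        ultimately have "(x, (u j \<odot> e) \<odot> e') \<in> M.sup_of (insert j I)" by (rule congruence_trans[OF c])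
        then show ?thesis using uj[of j] j eA e'A e(2) by simp
      qed
      moreover have "regular_epi C (e \<odot> e')" using e(1) e'(1) e'A by (intro regular_epi_Comp)
      ultimately show "solvable I (insert t J) T u"
        unfolding solvable_def using e(2) eA e'A x by (intro exI[of _ "e \<odot> e'"] exI[of _ x]) (simp add: homset_iff)
    qed
  qed
qed

theorem all_lifting_iff_distributive: "all_lifting C n F \<longleftrightarrow> distributive C n X R"
proof -
  have "all_lifting C n F \<longleftrightarrow>
    (\<forall>I J. I \<subseteq> {..<n} \<longrightarrow> J \<subseteq> {..<n} \<longrightarrow> I \<inter> J = {} \<longrightarrow> J \<noteq> {} \<longrightarrow> remainder I J)"
    unfolding all_lifting_def using lifting_iff_remainder by blast
  also have "\<dots> \<longleftrightarrow> M.join_distributive"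
    using join_distributive_if_remainder remainder_if_join_distributive by blast
  finally show ?thesis
    using M.fully_distributive_iff_join_distributive distributive_iff_fully_distributive by simp
qed

end

section \<open>Independence of the chosen tuple, and the equivalence of the three conditions\<close>

lemma distributive_cong:
  fixes R R' :: "nat \<Rightarrow> 'm \<times> 'm"
  assumes "\<And>i. i < n \<Longrightarrow> R i = R' i"
  shows "distributive C n X R \<longleftrightarrow> distributive C n X R'"
proof -
  let ?L = "eq_lattice C X"
  have img: "R ` J = R' ` J" if "J \<subseteq> {..<n}" for J using that assms by (intro image_cong) auto
  show ?thesis
    unfolding distributive_def Let_def
  proof (intro all_cong imp_cong refl)
    fix k :: nat and J :: "nat \<Rightarrow> nat set"
    assume "(\<forall>i\<le>k. J i \<subseteq> {..<n}) \<and> disjoint_family_on J {..k}"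
    then have "R ` J i = R' ` J i" "R ` (J 0 \<union> J i) = R' ` (J 0 \<union> J i)" if "i \<le> k" for i
      using img[of "J i"] img[of "J 0 \<union> J i"] that by simp_all
    then have eqs: "(\<lambda>i. \<Sqinter>\<^bsub>?L\<^esub>(R ` J i)) ` {1..k} = (\<lambda>i. \<Sqinter>\<^bsub>?L\<^esub>(R' ` J i)) ` {1..k}"
      "(\<lambda>i. \<Sqinter>\<^bsub>?L\<^esub>(R ` (J 0 \<union> J i))) ` {1..k} =
        (\<lambda>i. \<Sqinter>\<^bsub>?L\<^esub>(R' ` (J 0 \<union> J i))) ` {1..k}"
      "R ` J 0 = R' ` J 0"
      by (auto intro!: image_cong)
    show "(\<Sqinter>\<^bsub>?L\<^esub>(R ` J 0) \<sqinter>\<^bsub>?L\<^esub>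
          \<Squnion>\<^bsub>?L\<^esub>((\<lambda>i. \<Sqinter>\<^bsub>?L\<^esub>(R ` J i)) ` {1..k})
        .=\<^bsub>?L\<^esub> \<Squnion>\<^bsub>?L\<^esub>((\<lambda>i. \<Sqinter>\<^bsub>?L\<^esub>(R ` (J 0 \<union> J i))) ` {1..k})) \<longleftrightarrow>
      (\<Sqinter>\<^bsub>?L\<^esub>(R' ` J 0) \<sqinter>\<^bsub>?L\<^esub>
          \<Squnion>\<^bsub>?L\<^esub>((\<lambda>i. \<Sqinter>\<^bsub>?L\<^esub>(R' ` J i)) ` {1..k})
        .=\<^bsub>?L\<^esub> \<Squnion>\<^bsub>?L\<^esub>((\<lambda>i. \<Sqinter>\<^bsub>?L\<^esub>(R' ` (J 0 \<union> J i))) ` {1..k}))"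
      by (simp only: eqs)
  qed
qed

text \<open>\<open>B\<close> determines \<open>X\<close> as its underlying object and
  \<open>R i\<close> for \<open>i < n\<close> as the relations there. The tuple hidden in
  \<open>nrel_distributive\<close> can thus differ from \<open>R\<close> only at indices from
  \<open>n\<close> on, which \<open>distributive_cong\<close> ignores.\<close>

lemma nrel_distributive_iff:
  assumes "X \<in> Obj C" "\<forall>i<n. equivalence_rel C X (R i)" "is_box C n X R B"
  shows "nrel_distributive C n B \<longleftrightarrow> distributive C n X R"
proof
  assume "nrel_distributive C n B"
  then obtain X' R' where "is_box C n X' R' B" "distributive C n X' R'"
    by (auto simp: nrel_distributive_def)
  moreover from this have "X' = X" "R' i = R i" if "i < n" for i
    using assms(3) that by (auto simp: is_box_def nfold_equivalence_on_def)
  ultimately show "distributive C n X R"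
    using distributive_cong[of n R' R C X] assms(3) by (auto simp: is_box_def nfold_equivalence_on_def)
qed (use assms in \<open>auto simp: nrel_distributive_def\<close>)

theorem proposition3p21:
  fixes C :: "('o, 'm) cat"
    and X :: 'o
    and n :: nat
    and R :: "nat \<Rightarrow> 'm \<times> 'm"
    and B :: "('o, 'm) nrel"
    and F :: "('o, 'm) cube"
  assumes "exact_maltsev_category C"
    and "X \<in> Obj C"
    and "n \<ge> 3"
    and "\<forall>i<n. equivalence_rel C X (R i)"
    and "is_box C n X R B"
    and "is_Coeq C n B F"
  shows "(cubic_extension C n (nfold_arrow n F) \<longleftrightarrow> distributive C n X R) \<and>
    (distributive C n X R \<longleftrightarrow> nrel_distributive C n B)"
proof -
  interpret exact_maltsev_category C by (rule assms(1))
  interpret quotient_cube C X n R B F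
    by unfold_locales (use assms in auto)
  show ?thesis
    using cubic_extension_nfold_arrow[OF commutative_F] assms(3) all_lifting_iff_distributive
      nrel_distributive_iff[OF assms(2,4,5)] by simp
qed

end
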